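(* With the projections computed exactly by suitable dynamic programs, the runtime of $n$ iterations of MEIHT is $\mathcal{O}(knN)$ for the model $\mathcal{T}_k$ and $\mathcal{O}(M^2kn+nN)$ for the loopless overlapping group model $\mathfrak{G}_k$, where $k$ is the model order, $n$ is the number of iterations, $M$ is the number of groups and $N$ is the dimension of the signal.
   Context: $[N]=\{1,\ldots,N\}$. Models. (a) Tree model: fix an integer $D\ge2$ (regarded as a constant) and a $D$-ary rooted tree $\mathcal{T}$ whose nodes are the elements of $[N]$. $\mathcal{T}_k$ is the collection of all sets $\mathcal{K}$ of at most $k$ nodes such that all ancestors of every element of $\mathcal{K}$ are in $\mathcal{K}$ (so the root is in $\mathcal{K}$). (b) Group model: fix a group structure $\mathfrak{G}=\{\mathcal{G}_1,\ldots,\mathcal{G}_M\}$, $\mathcal{G}_j\subseteq[N]$, $\bigcup_j\mathcal{G}_j=[N]$, with maximum group size $g_{\max}$. It is loopless overlapping: the graph whose nodes are the groups and whose edges join pairs of groups with nonempty intersection contains no cycles. $\mathfrak{G}_k$ is the collection of all unions of at most $k$ groups. Write $\mathcal{M}_k$ for $\mathcal{T}_k$ or $\mathfrak{G}_k$. A vector is $\mathcal{M}_k$-sparse if its support is contained in some $\mathcal{K}\in\mathcal{M}_k$. Model-expanders. A bipartite graph $G=([N],[m],\mathcal{E})$ with every left node of degree $d$ is a $(k,d,\epsilon)$-model expander if $|\Gamma(\mathcal{S})|\ge(1-\epsilon)d|\mathcal{S}|$ for all $\mathcal{S}\subseteq\mathcal{K}$, $\mathcal{K}\in\mathcal{M}_k$,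 where $\Gamma(\cdot)$ denotes the set of neighbours; its adjacency matrix $\mathbf{A}\in\{0,1\}^{m\times N}$ has $A_{ji}=1$ iff $j\in\Gamma(i)$. Standing setting: $\mathbf{A}$ is the (sparsely stored) adjacency matrix of a model-expander for the model considered, with $\epsilon$ a constant and parameters as follows. For $\mathcal{T}_k$: $k=\omega(\log N)$, $d=\mathcal{O}\left(\frac{\log(N/k)}{\epsilon\log\log(N/k)}\right)$, $m=\mathcal{O}(dk/\epsilon)$. For $\mathfrak{G}_k$: $M\ge2$, $g_{\max}=\omega(\log N)$, $N>kg_{\max}$, $d=\mathcal{O}\left(\frac{\log N}{\epsilon\log(kg_{\max})}\right)$, $m=\mathcal{O}(dkg_{\max}/\epsilon)$. MEIHT. $\mathrm{Med}:\mathbb{R}^m\to\mathbb{R}^N$ is $[\mathrm{Med}(\mathbf{u})]_i=\mathrm{median}[u_j:j\in\Gamma(i)]$, and $\mathcal{P}_{\mathcal{M}_k}(\mathbf{b})$ is any minimizer of $\|\mathbf{b}-\mathbf{z}\|_1$ over all $\mathcal{M}_k$-sparse $\mathbf{z}\in\mathbb{R}^N$. Given $\mathbf{A}$ and $\mathbf{y}\in\mathbb{R}^m$, MEIHT sets $\mathbf{x}^0=\mathbf{0}$ and iterates $\mathbf{x}^{n+1}=\mathcal{P}_{\mathcal{M}_k}\left[\mathbf{x}^n+\mathrm{Med}(\mathbf{y}-\mathbf{A}\mathbf{x}^n)\right]$. Runtime counts real arithmetic operations and comparisons at unit cost.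
   Formalization: For the tree model, N/k is assumed to stay above a constant larger than e, since otherwise log log(N/k) may vanish or be negative, the bound on d becomes void and the claimed runtime fails; n ≥ 1 and k ≥ 1 are assumed throughout. *)

theory Defs
  imports Complex_Main "HOL-Library.Multiset" "HOL-Library.Landau_Symbols"
begin

section \<open>A real random access machine\<close>

text \<open>Running times refer to a small imperative language over named, multidimensional arrays of
natural numbers (indices, counters) and of reals (data); a scalar is an array read at the index
\<open>[]\<close>. Real data are opaque: they can only be combined by field operations and compared (there is
no rounding and no conversion from reals to indices), and the only literals are natural numbers and
integers. On index values only addition, truncated subtraction and comparison are available, so the
unit-cost measure cannot be exploited by multiplying large naturals.\<close>

record memory =
  ints :: "string \<Rightarrow> nat list \<Rightarrow> nat"
  reals :: "string \<Rightarrow> nat list \<Rightarrow> real"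

datatype iexp =
    IConst nat
  | IRead string "iexp list"
  | IPlus iexp iexp
  | IMinus iexp iexp

datatype rexp =
    RConst int
  | RRead string "iexp list"
  | RPlus rexp rexp
  | RMinus rexp rexp
  | RTimes rexp rexp
  | RDivide rexp rexp

datatype bexp =
    ILess iexp iexp
  | RLess rexp rexp
  | BNot bexp
  | BAnd bexp bexp

datatype prog =
    Skip
  | IWrite string "iexp list" iexp
  | RWrite string "iexp list" rexp
  | Seq prog prog  (infixr \<open>;;\<close> 60)
  | Cond bexp prog prog
  | While bexp prog

fun ival :: "memory \<Rightarrow> iexp \<Rightarrow> nat" where
  "ival s (IConst c) = c"
| "ival s (IRead a es) = ints s a (map (ival s) es)"
| "ival s (IPlus e f) = ival s e + ival s f"
| "ival s (IMinus e f) = ival s e - ival s f"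

fun rval :: "memory \<Rightarrow> rexp \<Rightarrow> real" where
  "rval s (RConst c) = of_int c"
| "rval s (RRead a es) = reals s a (map (ival s) es)"
| "rval s (RPlus e f) = rval s e + rval s f"
| "rval s (RMinus e f) = rval s e - rval s f"
| "rval s (RTimes e f) = rval s e * rval s f"
| "rval s (RDivide e f) = rval s e / rval s f"

fun bval :: "memory \<Rightarrow> bexp \<Rightarrow> bool" where
  "bval s (ILess e f) \<longleftrightarrow> ival s e < ival s f"
| "bval s (RLess e f) \<longleftrightarrow> rval s e < rval s f"
| "bval s (BNot b) \<longleftrightarrow> \<not> bval s b"
| "bval s (BAnd b c) \<longleftrightarrow> bval s b \<and> bval s c"

text \<open>Every literal, memory access, arithmetic operation, comparison, Boolean connective,
assignment and branching decision costs one unit. In particular all real operations and comparisons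
are counted, and nothing is free.\<close>

fun icost :: "iexp \<Rightarrow> nat" where
  "icost (IConst c) = 1"
| "icost (IRead a es) = 1 + sum_list (map icost es)"
| "icost (IPlus e f) = 1 + icost e + icost f"
| "icost (IMinus e f) = 1 + icost e + icost f"

fun rcost :: "rexp \<Rightarrow> nat" where
  "rcost (RConst c) = 1"
| "rcost (RRead a es) = 1 + sum_list (map icost es)"
| "rcost (RPlus e f) = 1 + rcost e + rcost f"
| "rcost (RMinus e f) = 1 + rcost e + rcost f"
| "rcost (RTimes e f) = 1 + rcost e + rcost f"
| "rcost (RDivide e f) = 1 + rcost e + rcost f"

fun bcost :: "bexp \<Rightarrow> nat" where
  "bcost (ILess e f) = 1 + icost e + icost f"
| "bcost (RLess e f) = 1 + rcost e + rcost f"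
| "bcost (BNot b) = 1 + bcost b"
| "bcost (BAnd b c) = 1 + bcost b + bcost c"

definition iupd :: "string \<Rightarrow> nat list \<Rightarrow> nat \<Rightarrow> memory \<Rightarrow> memory" where
  "iupd a is v s = s\<lparr>ints := (ints s)(a := (ints s a)(is := v))\<rparr>"

definition rupd :: "string \<Rightarrow> nat list \<Rightarrow> real \<Rightarrow> memory \<Rightarrow> memory" where
  "rupd a is v s = s\<lparr>reals := (reals s)(a := (reals s a)(is := v))\<rparr>"

text \<open>\<open>exec p s t s'\<close>: started in memory \<open>s\<close>, program \<open>p\<close> halts after exactly \<open>t\<close> time units
in memory \<open>s'\<close>.\<close>

inductive exec :: "prog \<Rightarrow> memory \<Rightarrow> nat \<Rightarrow> memory \<Rightarrow> bool" where
  Skip: "exec Skip s 1 s"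
| IWrite: "exec (IWrite a es e) s (1 + sum_list (map icost es) + icost e)
      (iupd a (map (ival s) es) (ival s e) s)"
| RWrite: "exec (RWrite a es e) s (1 + sum_list (map icost es) + rcost e)
      (rupd a (map (ival s) es) (rval s e) s)"
| Seq: "exec p s t s' \<Longrightarrow> exec q s' u s'' \<Longrightarrow> exec (p ;; q) s (t + u) s''"
| CondTrue: "bval s b \<Longrightarrow> exec p s t s' \<Longrightarrow> exec (Cond b p q) s (1 + bcost b + t) s'"
| CondFalse: "\<not> bval s b \<Longrightarrow> exec q s t s' \<Longrightarrow> exec (Cond b p q) s (1 + bcost b + t) s'"
| WhileFalse: "\<not> bval s b \<Longrightarrow> exec (While b p) s (1 + bcost b) s"
| WhileTrue: "bval s b \<Longrightarrow> exec p s t s' \<Longrightarrow> exec (While b p) s' u s'' \<Longrightarrow>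
      exec (While b p) s (1 + bcost b + t + u) s''"

inductive_cases exec_SkipE: "exec Skip s t s'"
  and exec_IWriteE: "exec (IWrite a es e) s t s'"
  and exec_RWriteE: "exec (RWrite a es e) s t s'"
  and exec_SeqE: "exec (p ;; q) s t s'"
  and exec_CondE: "exec (Cond b p q) s t s'"
  and exec_WhileE: "exec (While b p) s t s'"

lemma exec_deterministic:
  "exec p s t s' \<Longrightarrow> exec p s u s'' \<Longrightarrow> t = u \<and> s' = s''"
proof (induction arbitrary: u s'' rule: exec.induct)
  case (Skip s)
  then show ?case by (auto elim: exec_SkipE)
next
  case (IWrite a es e s)
  then show ?case by (auto elim: exec_IWriteE)
next
  case (RWrite a es e s)
  then show ?case by (auto elim: exec_RWriteE)
next
  case (Seq p s t s' q u' s2)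
  from Seq.prems obtain t1 m u1 where "u = t1 + u1" "exec p s t1 m" "exec q m u1 s''"
    by (rule exec_SeqE)
  with Seq.IH(1)[of t1 m] Seq.IH(2)[of u1 s''] show ?case by simp
next
  case (CondTrue s b p t s' q)
  from CondTrue.prems CondTrue.hyps obtain t1 where "u = 1 + bcost b + t1" "exec p s t1 s''"
    by (auto elim: exec_CondE)
  with CondTrue.IH[of t1 s''] show ?case by simp
next
  case (CondFalse s b q t s' p)
  from CondFalse.prems CondFalse.hyps obtain t1 where "u = 1 + bcost b + t1" "exec q s t1 s''"
    by (auto elim: exec_CondE)
  with CondFalse.IH[of t1 s''] show ?case by simp
next
  case (WhileFalse s b p)
  from WhileFalse.prems WhileFalse.hyps show ?case
    by cases auto
next
  case (WhileTrue s b p t s' u' s2)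
  from WhileTrue.prems WhileTrue.hyps(1) obtain t1 m u1
    where "u = 1 + bcost b + t1 + u1" "exec p s t1 m" "exec (While b p) m u1 s''"
    by (auto elim: exec_WhileE)
  with WhileTrue.IH(1)[of t1 m] WhileTrue.IH(2)[of u1 s''] show ?case by simp
qed


section \<open>Sparsity models\<close>

text \<open>Vectors in \<open>\<real>\<^sup>N\<close> are functions of which only the values on \<open>{1..N}\<close> matter; a model is
a collection of subsets of \<open>{1..N}\<close>.\<close>

definition model_sparse :: "nat \<Rightarrow> nat set set \<Rightarrow> (nat \<Rightarrow> real) \<Rightarrow> bool" where
  "model_sparse N \<M> z \<longleftrightarrow> (\<exists>K\<in>\<M>. {i \<in> {1..N}. z i \<noteq> 0} \<subseteq> K)"

definition model_projection ::
    "nat \<Rightarrow> nat set set \<Rightarrow> (nat \<Rightarrow> real) \<Rightarrow> (nat \<Rightarrow> real) \<Rightarrow> bool" where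
  "model_projection N \<M> b z \<longleftrightarrow> is_arg_min (\<lambda>w. \<Sum>i=1..N. \<bar>b i - w i\<bar>) (model_sparse N \<M>) z"

definition parent_rel :: "nat \<Rightarrow> nat \<Rightarrow> (nat \<Rightarrow> nat) \<Rightarrow> (nat \<times> nat) set" where
  "parent_rel N r par = {(par v, v) | v. v \<in> {1..N} - {r}}"

text \<open>A \<open>D\<close>-ary tree is one in which every node has at most \<open>D\<close> children.\<close>

definition dary_tree :: "nat \<Rightarrow> nat \<Rightarrow> nat \<Rightarrow> (nat \<Rightarrow> nat) \<Rightarrow> bool" where
  "dary_tree D N r par \<longleftrightarrow>
     r \<in> {1..N} \<and>
     (\<forall>v\<in>{1..N} - {r}. par v \<in> {1..N}) \<and>
     (\<forall>v\<in>{1..N}. (r, v) \<in> (parent_rel N r par)\<^sup>*) \<and>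
     (\<forall>u\<in>{1..N}. card {v. (u, v) \<in> parent_rel N r par} \<le> D)"

definition tree_model :: "nat \<Rightarrow> nat \<Rightarrow> (nat \<Rightarrow> nat) \<Rightarrow> nat \<Rightarrow> nat set set" where
  "tree_model N r par k =
     {K. K \<subseteq> {1..N} \<and> card K \<le> k \<and> r \<in> K \<and>
         (\<forall>v\<in>K. \<forall>u. (u, v) \<in> (parent_rel N r par)\<^sup>+ \<longrightarrow> u \<in> K)}"

definition groups_meet :: "nat \<Rightarrow> (nat \<Rightarrow> nat set) \<Rightarrow> nat \<Rightarrow> nat \<Rightarrow> bool" where
  "groups_meet M G i j \<longleftrightarrow>
     i \<in> {1..M} \<and> j \<in> {1..M} \<and> i \<noteq> j \<and> G i \<inter> G j \<noteq> {}"

text \<open>A cycle of the intersection graph is a list of at least three distinct groups in which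
cyclically consecutive groups meet.\<close>

definition loopless :: "nat \<Rightarrow> (nat \<Rightarrow> nat set) \<Rightarrow> bool" where
  "loopless M G \<longleftrightarrow>
     \<not> (\<exists>js. 3 \<le> length js \<and> distinct js \<and>
          (\<forall>l<length js. groups_meet M G (js ! l) (js ! (Suc l mod length js))))"

definition group_structure :: "nat \<Rightarrow> nat \<Rightarrow> (nat \<Rightarrow> nat set) \<Rightarrow> bool" where
  "group_structure N M G \<longleftrightarrow> inj_on G {1..M} \<and> (\<Union>j\<in>{1..M}. G j) = {1..N} \<and> loopless M G"

definition max_group_size :: "nat \<Rightarrow> (nat \<Rightarrow> nat set) \<Rightarrow> nat" where
  "max_group_size M G = Max ((\<lambda>j. card (G j)) ` {1..M})"

definition group_model :: "nat \<Rightarrow> (nat \<Rightarrow> nat set) \<Rightarrow> nat \<Rightarrow> nat set set" where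
  "group_model M G k = {(\<Union>j\<in>J. G j) | J. J \<subseteq> {1..M} \<and> card J \<le> k}"


section \<open>Model expanders and the MEIHT iteration\<close>

text \<open>A bipartite graph on \<open>{1..N}\<close> and \<open>{1..m}\<close> is given by the neighbour sets \<open>\<Gamma> i\<close> of the
left nodes.\<close>

definition left_regular :: "nat \<Rightarrow> nat \<Rightarrow> nat \<Rightarrow> (nat \<Rightarrow> nat set) \<Rightarrow> bool" where
  "left_regular N m d \<Gamma> \<longleftrightarrow> 1 \<le> d \<and> (\<forall>i\<in>{1..N}. \<Gamma> i \<subseteq> {1..m} \<and> card (\<Gamma> i) = d)"

definition model_expander ::
    "nat \<Rightarrow> nat \<Rightarrow> nat \<Rightarrow> real \<Rightarrow> nat set set \<Rightarrow> (nat \<Rightarrow> nat set) \<Rightarrow> bool" where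
  "model_expander N m d \<epsilon> \<M> \<Gamma> \<longleftrightarrow>
     left_regular N m d \<Gamma> \<and>
     (\<forall>K\<in>\<M>. \<forall>S\<subseteq>K. real (card (\<Union>i\<in>S. \<Gamma> i)) \<ge> (1 - \<epsilon>) * real d * real (card S))"

definition adjacency :: "(nat \<Rightarrow> nat set) \<Rightarrow> nat \<Rightarrow> nat \<Rightarrow> real" where
  "adjacency \<Gamma> j i = (if j \<in> \<Gamma> i then 1 else 0)"

text \<open>The usual median: the middle entry of the sorted sample, or the mean of the two middle
entries if the sample has even size.\<close>

definition median :: "real multiset \<Rightarrow> real" where
  "median X = (let xs = sorted_list_of_multiset X; n = length xs
     in (xs ! ((n - 1) div 2) + xs ! (n div 2)) / 2)"

definition Med :: "(nat \<Rightarrow> nat set) \<Rightarrow> (nat \<Rightarrow> real) \<Rightarrow> nat \<Rightarrow> real" where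
  "Med \<Gamma> u i = median (image_mset u (mset_set (\<Gamma> i)))"

text \<open>The vector \<open>x + Med(y - A x)\<close>.\<close>

definition median_step ::
    "nat \<Rightarrow> (nat \<Rightarrow> nat set) \<Rightarrow> (nat \<Rightarrow> real) \<Rightarrow> (nat \<Rightarrow> real) \<Rightarrow> nat \<Rightarrow> real" where
  "median_step N \<Gamma> y x i = x i + Med \<Gamma> (\<lambda>j. y j - (\<Sum>l=1..N. adjacency \<Gamma> j l * x l)) i"

definition meiht_iterates ::
    "nat \<Rightarrow> nat set set \<Rightarrow> (nat \<Rightarrow> nat set) \<Rightarrow> (nat \<Rightarrow> real) \<Rightarrow> nat \<Rightarrow>
     (nat \<Rightarrow> nat \<Rightarrow> real) \<Rightarrow> bool" where
  "meiht_iterates N \<M> \<Gamma> y n X \<longleftrightarrow>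
     X 0 = (\<lambda>i. 0) \<and>
     (\<forall>l<n. model_projection N \<M> (median_step N \<Gamma> y (X l)) (X (Suc l)))"


section \<open>Data layout and the MEIHT program\<close>

definition holds_vector :: "memory \<Rightarrow> string \<Rightarrow> nat \<Rightarrow> (nat \<Rightarrow> real) \<Rightarrow> bool" where
  "holds_vector s a N x \<longleftrightarrow> (\<forall>i\<in>{1..N}. reals s a [i] = x i)"

text \<open>The adjacency matrix is stored sparsely: \<open>nbr[i,0], \<dots>, nbr[i,d-1]\<close> list the neighbours of
\<open>i\<close> in some order. Memory that is not mentioned has arbitrary contents.\<close>

definition holds_matrix :: "memory \<Rightarrow> nat \<Rightarrow> nat \<Rightarrow> nat \<Rightarrow> (nat \<Rightarrow> nat set) \<Rightarrow> bool" where
  "holds_matrix s N m d \<Gamma> \<longleftrightarrow>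
     ints s ''N'' [] = N \<and> ints s ''m'' [] = m \<and> ints s ''d'' [] = d \<and>
     (\<forall>i\<in>{1..N}. bij_betw (\<lambda>l. ints s ''nbr'' [i, l]) {0..<d} (\<Gamma> i))"

definition holds_tree :: "memory \<Rightarrow> nat \<Rightarrow> nat \<Rightarrow> (nat \<Rightarrow> nat) \<Rightarrow> nat \<Rightarrow> bool" where
  "holds_tree s N r par k \<longleftrightarrow>
     ints s ''N'' [] = N \<and> ints s ''k'' [] = k \<and> ints s ''root'' [] = r \<and>
     (\<forall>v\<in>{1..N} - {r}. ints s ''par'' [v] = par v)"

text \<open>\<open>grp[j,0], \<dots>, grp[j,gsize[j]-1]\<close> list the elements of the \<open>j\<close>-th group.\<close>

definition holds_groups :: "memory \<Rightarrow> nat \<Rightarrow> nat \<Rightarrow> (nat \<Rightarrow> nat set) \<Rightarrow> nat \<Rightarrow> bool" where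
  "holds_groups s N M G k \<longleftrightarrow>
     ints s ''N'' [] = N \<and> ints s ''M'' [] = M \<and> ints s ''k'' [] = k \<and>
     (\<forall>j\<in>{1..M}. ints s ''gsize'' [j] = card (G j) \<and>
        bij_betw (\<lambda>l. ints s ''grp'' [j, l]) {0..<card (G j)} (G j))"

text \<open>Subroutines: one computes \<open>b = x + Med(y - A x)\<close>, the others overwrite \<open>x\<close> by an exact
projection of \<open>b\<close>.\<close>

definition computes_median_step :: "prog \<Rightarrow> bool" where
  "computes_median_step p \<longleftrightarrow>
     (\<forall>N m d \<Gamma> x y s. left_regular N m d \<Gamma> \<and> holds_matrix s N m d \<Gamma> \<and>
        holds_vector s ''y'' m y \<and> holds_vector s ''x'' N x \<longrightarrow>
        (\<exists>t s'. exec p s t s' \<and> holds_vector s' ''b'' N (median_step N \<Gamma> y x)))"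

definition computes_tree_projection :: "prog \<Rightarrow> bool" where
  "computes_tree_projection p \<longleftrightarrow>
     (\<forall>D N r par k b s. 2 \<le> D \<and> dary_tree D N r par \<and> 1 \<le> k \<and>
        holds_tree s N r par k \<and> holds_vector s ''b'' N b \<longrightarrow>
        (\<exists>t s' z. exec p s t s' \<and> holds_vector s' ''x'' N z \<and>
           model_projection N (tree_model N r par k) b z))"

definition computes_group_projection :: "prog \<Rightarrow> bool" where
  "computes_group_projection p \<longleftrightarrow>
     (\<forall>N M G k b s. 2 \<le> M \<and> group_structure N M G \<and> 1 \<le> k \<and>
        holds_groups s N M G k \<and> holds_vector s ''b'' N b \<longrightarrow>
        (\<exists>t s' z. exec p s t s' \<and> holds_vector s' ''x'' N z \<and>
           model_projection N (group_model M G k) b z))"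

definition meiht_prog :: "prog \<Rightarrow> prog \<Rightarrow> prog" where
  "meiht_prog med proj =
     IWrite ''i'' [] (IRead ''N'' []) ;;
     While (ILess (IConst 0) (IRead ''i'' []))
       (RWrite ''x'' [IRead ''i'' []] (RConst 0) ;;
        IWrite ''i'' [] (IMinus (IRead ''i'' []) (IConst 1))) ;;
     IWrite ''iter'' [] (IRead ''n'' []) ;;
     While (ILess (IConst 0) (IRead ''iter'' []))
       (med ;;
        proj ;;
        IWrite ''iter'' [] (IMinus (IRead ''iter'' []) (IConst 1)))"

text \<open>From memory \<open>s\<close>, \<open>meiht_prog\<close> halts after \<open>t\<close> time units with \<open>x\<close> holding the \<open>n\<close>-th
MEIHT iterate for the model \<open>\<M>\<close>. The existential quantifier reflects that ties between minimizers
may be broken arbitrarily.\<close>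

definition runs_meiht ::
    "prog \<Rightarrow> prog \<Rightarrow> nat \<Rightarrow> nat set set \<Rightarrow> (nat \<Rightarrow> nat set) \<Rightarrow> (nat \<Rightarrow> real) \<Rightarrow> nat \<Rightarrow>
     memory \<Rightarrow> nat \<Rightarrow> bool" where
  "runs_meiht med proj N \<M> \<Gamma> y n s t \<longleftrightarrow>
     (\<exists>s' X. exec (meiht_prog med proj) s t s' \<and> meiht_iterates N \<M> \<Gamma> y n X \<and>
        holds_vector s' ''x'' N (X n))"

definition tree_input ::
    "nat \<Rightarrow> real \<Rightarrow> nat \<Rightarrow> nat \<Rightarrow> nat \<Rightarrow> nat \<Rightarrow> nat \<Rightarrow> nat \<Rightarrow> (nat \<Rightarrow> nat) \<Rightarrow>
     (nat \<Rightarrow> nat set) \<Rightarrow> (nat \<Rightarrow> real) \<Rightarrow> memory \<Rightarrow> bool" where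
  "tree_input D \<epsilon> N k m d n r par \<Gamma> y s \<longleftrightarrow>
     dary_tree D N r par \<and> 1 \<le> k \<and> 1 \<le> n \<and>
     model_expander N m d \<epsilon> (tree_model N r par k) \<Gamma> \<and>
     holds_tree s N r par k \<and> holds_matrix s N m d \<Gamma> \<and> holds_vector s ''y'' m y \<and>
     ints s ''n'' [] = n"

definition group_input ::
    "real \<Rightarrow> nat \<Rightarrow> nat \<Rightarrow> nat \<Rightarrow> nat \<Rightarrow> nat \<Rightarrow> nat \<Rightarrow> (nat \<Rightarrow> nat set) \<Rightarrow>
     (nat \<Rightarrow> nat set) \<Rightarrow> (nat \<Rightarrow> real) \<Rightarrow> memory \<Rightarrow> bool" where
  "group_input \<epsilon> N M k m d n G \<Gamma> y s \<longleftrightarrow>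
     2 \<le> M \<and> group_structure N M G \<and> 1 \<le> k \<and> 1 \<le> n \<and> k * max_group_size M G < N \<and>
     model_expander N m d \<epsilon> (group_model M G k) \<Gamma> \<and>
     holds_groups s N M G k \<and> holds_matrix s N m d \<Gamma> \<and> holds_vector s ''y'' m y \<and>
     ints s ''n'' [] = n"

end

theory Submission
  imports Defs
begin

text \<open>Each of the three subroutines is written down as a concrete program of the machine, and its result
and its running time are established together.

\<^item> \<^emph>\<open>Median step.\<close> The residual \<open>y - A x\<close> is accumulated along the stored edges in time
\<open>O(m + d N)\<close>. Each of the \<open>N\<close> medians is read off after a bottom-up merge sort of \<open>d\<close> values, in time
\<open>O(d log d)\<close> (\<open>med_prog\<close>). A quadratic sort would be too slow for trees: the hypotheses there give
\<open>d log d = O(log N)\<close>, hence \<open>O(k)\<close>, but they do not bound \<open>d\<^sup>2\<close> by \<open>k\<close>.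

\<^item> \<^emph>\<open>Tree projection.\<close> An exact projection keeps \<open>b\<close> on an admissible support of largest weight
\<open>\<Sum>\<bar>b i\<bar>\<close> (\<open>model_projectionI\<close>). In a postorder numbering the subtree of the node numbered \<open>p\<close> occupies
an interval of numbers \<open>q p + 1, \<dots>, p\<close>. A support that is closed under ancestors either contains \<open>p\<close>, and
the rest lives on the numbers below \<open>p\<close> with one node less in the budget, or it avoids the whole interval.
So the best weight satisfies \<open>F p j = max (w p + F (p - 1) (j - 1)) (F (q p) j)\<close>, with constant work for
each of the \<open>(N + 1) (k + 1)\<close> entries and without any merging of the tables of children (\<open>tree_prog\<close>).

\<^item> \<^emph>\<open>Group projection.\<close> In a loopless structure an element lies in at most two groups and the intersection
graph is a forest, so the weight of a union of groups is the sum of the weights of the groups minus the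
overlaps along the edges. Groups are removed one at a time, always one that meets at most one remaining group
(\<open>loopless_leaf\<close>), and its table of best selections is merged into the table of that neighbour
(\<open>merge_selection\<close>). A merge costs \<open>O(k\<^sup>2)\<close> for the values and \<open>O(M k)\<close> for copying the selections
themselves, which are stored as bit vectors; since \<open>k \<le> M\<close> this adds up to \<open>O(M\<^sup>2 k)\<close> (\<open>group_prog\<close>).

It remains to compare the cost of the \<open>N\<close> sorts with the claimed bounds. For trees this is
\<open>sort_cost_log\<close>. For groups with largest size \<open>g\<close>, either \<open>k g\<close> is at least \<open>N\<^sup>1\<^sup>/\<^sup>4\<close> and the hypothesis
makes \<open>d\<close> bounded, or \<open>g\<close> is smaller than that and \<open>M \<ge> N / g\<close> makes \<open>M\<^sup>2\<close> so large that it absorbs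
\<open>N d\<^sup>2\<close> (\<open>quadratic_degree_bound\<close>).\<close>


section \<open>Total correctness with time credits\<close>

text \<open>Weakest preconditions with time credits: from memory \<open>s\<close>, program \<open>p\<close> halts within \<open>B\<close> time units, and
\<open>Q\<close> holds of the final memory and of the credits that are left. Handing on the credits, instead of
naming the time of every part, makes sequential composition free of arithmetic and lets a loop invariant
mention the time that is still available.\<close>

definition wp :: "prog \<Rightarrow> (memory \<Rightarrow> nat \<Rightarrow> bool) \<Rightarrow> memory \<Rightarrow> nat \<Rightarrow> bool" where
  "wp p Q s B \<longleftrightarrow> (\<exists>t s'. exec p s t s' \<and> t \<le> B \<and> Q s' (B - t))"

abbreviation runs :: "prog \<Rightarrow> memory \<Rightarrow> nat \<Rightarrow> (memory \<Rightarrow> bool) \<Rightarrow> bool" where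
  "runs p s T Q \<equiv> wp p (\<lambda>s' _. Q s') s T"

lemma wp_Skip [simp]: "wp Skip Q s B \<longleftrightarrow> 1 \<le> B \<and> Q s (B - 1)"
  unfolding wp_def by (auto elim: exec_SkipE intro!: exI exec.Skip[simplified])

lemma wp_IWrite [simp]:
  "wp (IWrite a es e) Q s B \<longleftrightarrow> 1 + sum_list (map icost es) + icost e \<le> B \<and>
     Q (iupd a (map (ival s) es) (ival s e) s) (B - (1 + sum_list (map icost es) + icost e))"
  unfolding wp_def by (auto elim!: exec_IWriteE intro!: exec.IWrite exI)

lemma wp_RWrite [simp]:
  "wp (RWrite a es e) Q s B \<longleftrightarrow> 1 + sum_list (map icost es) + rcost e \<le> B \<and>
     Q (rupd a (map (ival s) es) (rval s e) s) (B - (1 + sum_list (map icost es) + rcost e))"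
  unfolding wp_def by (auto elim!: exec_RWriteE intro!: exec.RWrite exI)

lemma wp_Seq [simp]: "wp (p ;; q) Q s B \<longleftrightarrow> wp p (wp q Q) s B"
proof
  assume "wp (p ;; q) Q s B"
  then obtain t s' where "exec (p ;; q) s t s'" "t \<le> B" "Q s' (B - t)" by (auto simp: wp_def)
  then obtain t1 u1 m where "t = t1 + u1" "exec p s t1 m" "exec q m u1 s'" by (auto elim: exec_SeqE)
  with \<open>t \<le> B\<close> \<open>Q s' (B - t)\<close> show "wp p (wp q Q) s B"
    unfolding wp_def by (intro exI[of _ t1] exI[of _ m] conjI exI[of _ u1] exI[of _ s']) auto
next
  assume "wp p (wp q Q) s B"
  then obtain t1 u1 m s' where "exec p s t1 m" "t1 \<le> B" "exec q m u1 s'" "u1 \<le> B - t1"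
      "Q s' (B - t1 - u1)" by (auto simp: wp_def)
  then show "wp (p ;; q) Q s B"
    unfolding wp_def by (intro exI[of _ "t1 + u1"] exI[of _ s']) (auto intro: exec.Seq)
qed

lemma wp_Cond [simp]:
  "wp (Cond b p q) Q s B \<longleftrightarrow> 1 + bcost b \<le> B \<and>
     (if bval s b then wp p Q s (B - (1 + bcost b)) else wp q Q s (B - (1 + bcost b)))"
proof
  assume "wp (Cond b p q) Q s B"
  then show "1 + bcost b \<le> B \<and>
     (if bval s b then wp p Q s (B - (1 + bcost b)) else wp q Q s (B - (1 + bcost b)))"
    unfolding wp_def by (fastforce elim!: exec_CondE)
next
  assume *: "1 + bcost b \<le> B \<and>
     (if bval s b then wp p Q s (B - (1 + bcost b)) else wp q Q s (B - (1 + bcost b)))"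
  define r where "r = (if bval s b then p else q)"
  from * obtain t s' where "exec r s t s'" "t \<le> B - (1 + bcost b)" "Q s' (B - (1 + bcost b) - t)"
    by (auto simp: wp_def r_def split: if_splits)
  with * show "wp (Cond b p q) Q s B"
    unfolding wp_def
    by (intro exI[of _ "1 + bcost b + t"] exI[of _ s'])
       (auto simp: r_def intro: exec.CondTrue[simplified] exec.CondFalse[simplified] split: if_splits)
qed

lemma wp_While:
  assumes "1 + bcost b \<le> B"
    and "bval s b \<Longrightarrow> wp p (wp (While b p) Q) s (B - (1 + bcost b))"
    and "\<not> bval s b \<Longrightarrow> Q s (B - (1 + bcost b))"
  shows "wp (While b p) Q s B"
proof (cases "bval s b")
  case False
  with assms show ?thesis unfolding wp_def
    by (intro exI[of _ "1 + bcost b"] exI[of _ s]) (auto intro: exec.WhileFalse[simplified])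
next
  case True
  from assms(2)[OF True] obtain t1 u1 m s' where "exec p s t1 m" "t1 \<le> B - (1 + bcost b)"
      "exec (While b p) m u1 s'" "u1 \<le> B - (1 + bcost b) - t1"
      "Q s' (B - (1 + bcost b) - t1 - u1)" by (auto simp: wp_def)
  with True assms(1) show ?thesis
    unfolding wp_def by (intro exI[of _ "1 + bcost b + t1 + u1"] exI[of _ s'])
      (auto intro: exec.WhileTrue[simplified])
qed

text \<open>\<open>iw a p\<close> and \<open>rw a p\<close> say that the array \<open>a\<close> of naturals or of reals is assigned to somewhere in \<open>p\<close>.
This syntactic approximation is what shows that inputs and loop constants survive a subprogram.\<close>

fun iw :: "string \<Rightarrow> prog \<Rightarrow> bool" where
  "iw a Skip \<longleftrightarrow> False"
| "iw a (IWrite b es e) \<longleftrightarrow> a = b"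
| "iw a (RWrite b es e) \<longleftrightarrow> False"
| "iw a (p ;; q) \<longleftrightarrow> iw a p \<or> iw a q"
| "iw a (Cond b p q) \<longleftrightarrow> iw a p \<or> iw a q"
| "iw a (While b p) \<longleftrightarrow> iw a p"

fun rw :: "string \<Rightarrow> prog \<Rightarrow> bool" where
  "rw a Skip \<longleftrightarrow> False"
| "rw a (IWrite b es e) \<longleftrightarrow> False"
| "rw a (RWrite b es e) \<longleftrightarrow> a = b"
| "rw a (p ;; q) \<longleftrightarrow> rw a p \<or> rw a q"
| "rw a (Cond b p q) \<longleftrightarrow> rw a p \<or> rw a q"
| "rw a (While b p) \<longleftrightarrow> rw a p"

lemma ints_iupd [simp]: "ints (iupd a is v s) b = (if b = a then (ints s a)(is := v) else ints s b)"
  and reals_iupd [simp]: "reals (iupd a is v s) = reals s"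
  and ints_rupd [simp]: "ints (rupd a is w s) = ints s"
  and reals_rupd [simp]: "reals (rupd a is w s) b = (if b = a then (reals s a)(is := w) else reals s b)"
  by (auto simp: iupd_def rupd_def)

definition frame :: "prog \<Rightarrow> memory \<Rightarrow> memory \<Rightarrow> bool" where
  "frame p s s' \<longleftrightarrow> (\<forall>a. \<not> iw a p \<longrightarrow> ints s' a = ints s a) \<and> (\<forall>a. \<not> rw a p \<longrightarrow> reals s' a = reals s a)"

lemma frame_ints: "frame p s s' \<Longrightarrow> \<not> iw a p \<Longrightarrow> ints s' a = ints s a"
  by (auto simp: frame_def)

lemma frame_refl [simp]: "frame p s s"
  by (auto simp: frame_def)

lemma frame_trans: "frame p s s' \<Longrightarrow> frame p s' s'' \<Longrightarrow> frame p s s''"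
  by (auto simp: frame_def)

lemma exec_frame: "exec p s t s' \<Longrightarrow> frame p s s'"
  by (induction rule: exec.induct) (auto simp: frame_def)

lemma wp_mono:
  assumes "wp p R s A" "A \<le> B" "\<And>s' C. R s' C \<Longrightarrow> frame p s s' \<Longrightarrow> Q s' (C + (B - A))"
  shows "wp p Q s B"
proof -
  from assms(1) obtain t s' where e: "exec p s t s'" "t \<le> A" "R s' (A - t)" by (auto simp: wp_def)
  with assms(2) have "A - t + (B - A) = B - t" by simp
  with assms(3)[OF e(3) exec_frame[OF e(1)]] e assms(2) show ?thesis
    unfolding wp_def by (intro exI[of _ t] exI[of _ s']) auto
qed

text \<open>The form in which a verified subprogram is used inside a larger one.\<close>

lemma wp_runs:
  assumes "runs p s T R" "T \<le> B"
    and "\<And>s' B'. R s' \<Longrightarrow> frame p s s' \<Longrightarrow> B \<le> B' + T \<Longrightarrow> Q s' B'"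
  shows "wp p Q s B"
  by (rule wp_mono[OF assms(1,2)]) (rule assms(3), use assms(2) in auto)

lemma runs_mono:
  assumes "runs p s T R" "T \<le> B" "\<And>s'. R s' \<Longrightarrow> frame p s s' \<Longrightarrow> Q s'"
  shows "runs p s B Q"
  by (rule wp_runs[OF assms(1,2)]) (rule assms(3))

text \<open>Every test of the loop condition costs at least one unit, so the credits in the invariant decrease from one
iteration to the next: they are the variant of the loop. The invariant only has to speak about what the body
changes, since everything else is supplied by the frame.\<close>

lemma wp_While_invariant:
  assumes "I s B"
    and "\<And>s' B'. I s' B' \<Longrightarrow> frame p s s' \<Longrightarrow> 1 + bcost b \<le> B' \<and>
           (if bval s' b then wp p I s' (B' - (1 + bcost b)) else Q s' (B' - (1 + bcost b)))"
  shows "wp (While b p) Q s B"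
proof -
  have "I s' B' \<Longrightarrow> frame p s s' \<Longrightarrow> wp (While b p) Q s' B'" for s' B'
  proof (induction B' arbitrary: s' rule: less_induct)
    case (less B')
    note st = assms(2)[OF less.prems]
    show ?case
    proof (rule wp_While)
      show "1 + bcost b \<le> B'" using st by simp
      show "Q s' (B' - (1 + bcost b))" if "\<not> bval s' b" using st that by simp
      assume b: "bval s' b"
      obtain t s'' where e: "exec p s' t s''" "t \<le> B' - (1 + bcost b)" "I s'' (B' - (1 + bcost b) - t)"
        using st b by (auto simp: wp_def)
      have "wp (While b p) Q s'' (B' - (1 + bcost b) - t)"
        by (rule less.IH) (use e st frame_trans[OF less.prems(2) exec_frame] in auto)
      with e show "wp p (wp (While b p) Q) s' (B' - (1 + bcost b))" by (auto simp: wp_def)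
    qed
  qed
  with assms(1) show ?thesis by simp
qed

text \<open>The upper bound is an expression that is evaluated again before every iteration, so the rules below ask
that the body leaves its value alone.\<close>

definition For :: "string \<Rightarrow> iexp \<Rightarrow> iexp \<Rightarrow> prog \<Rightarrow> prog" where
  "For v a e p = IWrite v [] a ;;
     While (ILess (IRead v []) e) (p ;; IWrite v [] (IPlus (IRead v []) (IConst 1)))"

lemma iw_For [simp]: "iw a (For v lo hi p) \<longleftrightarrow> a = v \<or> iw a p"
  and rw_For [simp]: "rw a (For v lo hi p) \<longleftrightarrow> rw a p"
  by (auto simp: For_def)

text \<open>The cost \<open>K i\<close> of an iteration may depend on its index, as for a loop over groups of different sizes.\<close>

lemma runs_For_sum:
  assumes I0: "I lo (iupd v [] lo s)"
    and step: "\<And>i s'. lo \<le> i \<Longrightarrow> i < hi \<Longrightarrow> I i s' \<Longrightarrow> ints s' v [] = i \<Longrightarrow> frame (For v a e p) s s' \<Longrightarrow>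
        runs p s' (K i) (\<lambda>s''. I (Suc i) (iupd v [] (Suc i) s''))"
    and lo: "ival s a = lo" "lo \<le> hi"
    and hi: "\<And>s'. frame (For v a e p) s s' \<Longrightarrow> ival s' e = hi"
    and v: "\<not> iw v p"
    and T: "(\<Sum>i\<in>{lo..<hi}. K i + 7 + icost e) + (4 + icost e + icost a) \<le> T"
  shows "runs (For v a e p) s T (I hi)"
proof -
  define c where "c = (\<lambda>i. K i + 7 + icost e)"
  define J where "J = (\<lambda>s' B. \<exists>i. lo \<le> i \<and> i \<le> hi \<and> ints s' v [] = i \<and> I i s' \<and> sum c {i..<hi} + (3 + icost e) \<le> B)"
  have fr: "frame (For v a e p) s s'"
    if "frame (p ;; IWrite v [] (IPlus (IRead v []) (IConst 1))) (iupd v [] lo s) s'" for s'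
    using that by (auto simp: frame_def)
  have *: "wp (While (ILess (IRead v []) e) (p ;; IWrite v [] (IPlus (IRead v []) (IConst 1))))
      (\<lambda>s' _. I hi s') (iupd v [] lo s) (T - (1 + icost a))"
  proof (rule wp_While_invariant[where I = J])
    show "J (iupd v [] lo s) (T - (1 + icost a))"
      unfolding J_def by (rule exI[of _ lo]) (use I0 lo T in \<open>auto simp: c_def\<close>)
    fix s' B
    assume J: "J s' B" and f: "frame (p ;; IWrite v [] (IPlus (IRead v []) (IConst 1))) (iupd v [] lo s) s'"
    note f' = fr[OF f]
    from J obtain i where i: "lo \<le> i" "i \<le> hi" "ints s' v [] = i" "I i s'"
      "sum c {i..<hi} + (3 + icost e) \<le> B" by (auto simp: J_def)
    have "wp (p ;; IWrite v [] (IPlus (IRead v []) (IConst 1))) J s' (B - (3 + icost e))" if "i < hi"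
    proof -
      from that have s: "sum c {i..<hi} = c i + sum c {Suc i..<hi}" by (simp add: sum.atLeast_Suc_lessThan)
      have B: "K i + 7 + icost e + sum c {Suc i..<hi} + (3 + icost e) \<le> B"
        using i(5) unfolding s by (simp add: c_def)
      show ?thesis unfolding wp_Seq
      proof (rule wp_runs[OF step[OF i(1) that i(4,3) f']])
        show "K i \<le> B - (3 + icost e)" using B by simp
        fix s'' B' assume a: "I (Suc i) (iupd v [] (Suc i) s'')" "frame p s' s''" "B - (3 + icost e) \<le> B' + K i"
        have "ints s'' v [] = i" using i(3) frame_ints[OF a(2) v] by simp
        with a B that i show "wp (IWrite v [] (IPlus (IRead v []) (IConst 1))) J s'' B'"
          by (auto simp: J_def)
      qed
    qed
    with i hi[OF f'] show "1 + bcost (ILess (IRead v []) e) \<le> B \<and>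
       (if bval s' (ILess (IRead v []) e)
        then wp (p ;; IWrite v [] (IPlus (IRead v []) (IConst 1))) J s' (B - (1 + bcost (ILess (IRead v []) e)))
        else I hi s')" by (auto simp: numeral_3_eq_3 simp del: wp_Seq)
  qed
  show ?thesis unfolding For_def wp_Seq using * lo T by simp
qed

lemma runs_For:
  assumes "I lo (iupd v [] lo s)"
    and "\<And>i s'. lo \<le> i \<Longrightarrow> i < hi \<Longrightarrow> I i s' \<Longrightarrow> ints s' v [] = i \<Longrightarrow> frame (For v a e p) s s' \<Longrightarrow>
        runs p s' K (\<lambda>s''. I (Suc i) (iupd v [] (Suc i) s''))"
    and "ival s a = lo" "lo \<le> hi"
    and "\<And>s'. frame (For v a e p) s s' \<Longrightarrow> ival s' e = hi"
    and "\<not> iw v p"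
    and "(hi - lo) * (K + 7 + icost e) + (4 + icost e + icost a) \<le> T"
  shows "runs (For v a e p) s T (I hi)"
  by (rule runs_For_sum[where K = "\<lambda>_. K" and I = I, OF assms(1-6)]) (use assms(7) in simp_all)

lemma Suc_Suc_0 [simp]: "Suc (Suc 0) = 2"
  by simp

abbreviation V :: "string \<Rightarrow> iexp" where "V x \<equiv> IRead x []"

lemma fold_fun_upd: "(\<lambda>l. if l = i then v else f l) = f(i := v)"
  by auto

section \<open>Merge sort\<close>

definition ascending :: "(nat \<Rightarrow> real) \<Rightarrow> nat \<Rightarrow> nat \<Rightarrow> bool" where
  "ascending f lo hi \<longleftrightarrow> (\<forall>x y. lo \<le> x \<and> x \<le> y \<and> y < hi \<longrightarrow> f x \<le> f y)"

definition entries :: "(nat \<Rightarrow> real) \<Rightarrow> nat \<Rightarrow> nat \<Rightarrow> real multiset" where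
  "entries f lo hi = image_mset f (mset_set {lo..<hi})"

lemma entries_empty [simp]: "hi \<le> lo \<Longrightarrow> entries f lo hi = {#}"
  by (simp add: entries_def)

lemma entries_Suc: "lo \<le> hi \<Longrightarrow> entries f lo (Suc hi) = add_mset (f hi) (entries f lo hi)"
  by (simp add: entries_def atLeastLessThanSuc)

lemma entries_cong: "(\<And>l. lo \<le> l \<Longrightarrow> l < hi \<Longrightarrow> f l = g l) \<Longrightarrow> entries f lo hi = entries g lo hi"
  unfolding entries_def by (rule image_mset_cong) auto

lemma entries_append: "lo \<le> mid \<Longrightarrow> mid \<le> hi \<Longrightarrow> entries f lo hi = entries f lo mid + entries f mid hi"
proof -
  assume "lo \<le> mid" "mid \<le> hi"
  then have "{lo..<hi} = {lo..<mid} \<union> {mid..<hi}" by auto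
  then show ?thesis unfolding entries_def by (simp add: mset_set_Union)
qed

text \<open>The state of a merge of the two sorted runs \<open>a[lo..<mid]\<close> and \<open>a[mid..<hi]\<close> into \<open>b\<close>: positions below \<open>i\<close> and
\<open>j\<close> have been consumed, \<open>out\<close> is the next free position of \<open>b\<close>, and \<open>c\<close> is the initial content of \<open>b\<close>.
That everything written is below everything not yet consumed is what keeps the output sorted.\<close>

definition merging where
  "merging a lo mid hi c b out i j \<longleftrightarrow>
     lo \<le> i \<and> i \<le> mid \<and> mid \<le> j \<and> j \<le> hi \<and> out + mid = i + j \<and>
     entries b lo out = entries a lo i + entries a mid j \<and> ascending b lo out \<and>
     (\<forall>x y. lo \<le> x \<and> x < out \<and> (i \<le> y \<and> y < mid \<or> j \<le> y \<and> y < hi) \<longrightarrow> b x \<le> a y) \<and>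
     (\<forall>l. l < lo \<or> out \<le> l \<longrightarrow> b l = c l)"

lemma merging_left:
  assumes "merging a lo mid hi c b out i j" "ascending a lo mid" "ascending a mid hi"
    "i < mid" "j < hi \<longrightarrow> a i \<le> a j"
  shows "merging a lo mid hi c (b(out := a i)) (Suc out) (Suc i) j"
proof -
  note m = assms(1)[unfolded merging_def]
  have out: "lo \<le> out" using m by linarith
  have le: "a i \<le> a y" if "Suc i \<le> y \<and> y < mid \<or> j \<le> y \<and> y < hi" for y
    using that
  proof
    assume "Suc i \<le> y \<and> y < mid" then show ?thesis using assms(2) m unfolding ascending_def by auto
  next
    assume y: "j \<le> y \<and> y < hi"
    then have "a j \<le> a y" using assms(3) m unfolding ascending_def by auto
    with y assms(5) show ?thesis by auto
  qed
  have "entries (b(out := a i)) lo (Suc out) = entries a lo (Suc i) + entries a mid j"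
    using m out by (simp add: entries_Suc entries_cong[of lo out "b(out := a i)" b])
  moreover have "ascending (b(out := a i)) lo (Suc out)"
    using m assms(4) unfolding ascending_def by (auto simp: less_Suc_eq)
  moreover have "(b(out := a i)) x \<le> a y"
    if "lo \<le> x" "x < Suc out" "Suc i \<le> y \<and> y < mid \<or> j \<le> y \<and> y < hi" for x y
    using that le[OF that(3)] m by (cases "x = out") auto
  ultimately show ?thesis
    using m assms(4) out unfolding merging_def by auto
qed

lemma merging_right:
  assumes "merging a lo mid hi c b out i j" "ascending a lo mid" "ascending a mid hi"
    "j < hi" "i < mid \<longrightarrow> a j \<le> a i"
  shows "merging a lo mid hi c (b(out := a j)) (Suc out) i (Suc j)"
proof -
  note m = assms(1)[unfolded merging_def]
  have out: "lo \<le> out" using m by linarith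
  have le: "a j \<le> a y" if "i \<le> y \<and> y < mid \<or> Suc j \<le> y \<and> y < hi" for y
    using that
  proof
    assume y: "i \<le> y \<and> y < mid"
    then have "a i \<le> a y" using assms(2) m unfolding ascending_def by auto
    with y assms(5) show ?thesis by auto
  next
    assume "Suc j \<le> y \<and> y < hi" then show ?thesis using assms(3) m unfolding ascending_def by auto
  qed
  have "entries (b(out := a j)) lo (Suc out) = entries a lo i + entries a mid (Suc j)"
    using m out by (simp add: entries_Suc entries_cong[of lo out "b(out := a j)" b])
  moreover have "ascending (b(out := a j)) lo (Suc out)"
    using m assms(4) unfolding ascending_def by (auto simp: less_Suc_eq)
  moreover have "(b(out := a j)) x \<le> a y"
    if "lo \<le> x" "x < Suc out" "i \<le> y \<and> y < mid \<or> Suc j \<le> y \<and> y < hi" for x y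
    using that le[OF that(3)] m by (cases "x = out") auto
  ultimately show ?thesis
    using m assms(4) out unfolding merging_def by auto
qed

definition merge_prog :: prog where
  "merge_prog =
     IWrite ''i1'' [] (V ''lo'') ;; IWrite ''i2'' [] (V ''mid'') ;;
     For ''o'' (V ''lo'') (V ''hi'')
       (Cond (BAnd (ILess (V ''i1'') (V ''mid''))
               (BNot (BAnd (ILess (V ''i2'') (V ''hi'')) (RLess (RRead ''a'' [V ''i2'']) (RRead ''a'' [V ''i1''])))))
         (RWrite ''a2'' [V ''o''] (RRead ''a'' [V ''i1'']) ;; IWrite ''i1'' [] (IPlus (V ''i1'') (IConst 1)))
         (RWrite ''a2'' [V ''o''] (RRead ''a'' [V ''i2'']) ;; IWrite ''i2'' [] (IPlus (V ''i2'') (IConst 1))))"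

lemma iw_merge_prog [simp]: "iw v merge_prog \<longleftrightarrow> v \<in> {''i1'', ''i2'', ''o''}"
  and rw_merge_prog [simp]: "rw v merge_prog \<longleftrightarrow> v = ''a2''"
  by (auto simp: merge_prog_def)

lemma merge_prog:
  assumes "ints s ''lo'' [] = lo" "ints s ''mid'' [] = mid" "ints s ''hi'' [] = hi"
    and "lo \<le> mid" "mid \<le> hi"
    and a: "a = (\<lambda>l. reals s ''a'' [l])" "ascending a lo mid" "ascending a mid hi"
    and c: "c = (\<lambda>l. reals s ''a2'' [l])"
    and T: "40 * (hi - lo) + 10 \<le> T"
  shows "runs merge_prog s T (\<lambda>s'. let b = (\<lambda>l. reals s' ''a2'' [l]) in
     entries b lo hi = entries a lo hi \<and> ascending b lo hi \<and> (\<forall>l. l < lo \<or> hi \<le> l \<longrightarrow> b l = c l))"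
proof -
  define I where "I = (\<lambda>out (s' :: memory). merging a lo mid hi c (\<lambda>l. reals s' ''a2'' [l]) out
     (ints s' ''i1'' []) (ints s' ''i2'' []))"
  have "runs (For ''o'' (V ''lo'') (V ''hi'')
       (Cond (BAnd (ILess (V ''i1'') (V ''mid''))
               (BNot (BAnd (ILess (V ''i2'') (V ''hi'')) (RLess (RRead ''a'' [V ''i2'']) (RRead ''a'' [V ''i1''])))))
         (RWrite ''a2'' [V ''o''] (RRead ''a'' [V ''i1'']) ;; IWrite ''i1'' [] (IPlus (V ''i1'') (IConst 1)))
         (RWrite ''a2'' [V ''o''] (RRead ''a'' [V ''i2'']) ;; IWrite ''i2'' [] (IPlus (V ''i2'') (IConst 1)))))
     (iupd ''i2'' [] mid (iupd ''i1'' [] lo s)) (6 + 40 * (hi - lo)) (I hi)"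
    (is "runs (For ?v ?a ?e ?p) ?s _ _")
  proof (rule runs_For[where lo = lo and hi = hi and K = 32])
    show "I lo (iupd ''o'' [] lo ?s)"
      using assms(4,5) by (simp add: I_def merging_def c ascending_def)
    fix out s' assume o: "lo \<le> out" "out < hi" "I out s'" "ints s' ''o'' [] = out" and f: "frame (For ?v ?a ?e ?p) ?s s'"
    have u: "ints s' ''mid'' [] = mid" "ints s' ''hi'' [] = hi" "\<And>l. reals s' ''a'' [l] = a l"
      using f assms by (simp_all add: frame_def)
    note m = o(3)[unfolded I_def]
    have "ints s' ''i2'' [] < hi" if "\<not> ints s' ''i1'' [] < mid"
      using m that o(2) unfolding merging_def by linarith
    then show "runs ?p s' 32 (\<lambda>s''. I (Suc out) (iupd ''o'' [] (Suc out) s''))"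
      using merging_left[OF m a(2,3)] merging_right[OF m a(2,3)]
      by (auto simp: I_def o u fold_fun_upd)
  qed (use assms in \<open>auto simp: frame_def\<close>)
  then have "runs merge_prog s (40 * (hi - lo) + 10) (I hi)"
    unfolding merge_prog_def by (simp add: assms)
  then show ?thesis
  proof (rule runs_mono[OF _ T])
    fix s' assume "I hi s'"
    then have m: "merging a lo mid hi c (\<lambda>l. reals s' ''a2'' [l]) hi (ints s' ''i1'' []) (ints s' ''i2'' [])"
      by (simp add: I_def)
    then have "ints s' ''i1'' [] = mid" "ints s' ''i2'' [] = hi"
      unfolding merging_def by linarith+
    with m show "let b = (\<lambda>l. reals s' ''a2'' [l]) in
     entries b lo hi = entries a lo hi \<and> ascending b lo hi \<and> (\<forall>l. l < lo \<or> hi \<le> l \<longrightarrow> b l = c l)"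
      unfolding merging_def Let_def using entries_append[OF assms(4,5), of a] by simp
  qed
qed

text \<open>The first \<open>n\<close> positions, cut into blocks of length \<open>w\<close> with a possibly shorter last one, are sorted block by block.\<close>

definition blocks :: "(nat \<Rightarrow> real) \<Rightarrow> nat \<Rightarrow> nat \<Rightarrow> bool" where
  "blocks f w n \<longleftrightarrow> (\<forall>q. ascending f (q * w) (min (q * w + w) n))"

lemma blocks_step:
  assumes "blocks b (2 * w) (q * (2 * w))" "ascending b' (q * (2 * w)) hi"
    "\<forall>l. l < q * (2 * w) \<longrightarrow> b' l = b l" "hi \<le> q * (2 * w) + 2 * w"
  shows "blocks b' (2 * w) hi"
  unfolding blocks_def
proof
  fix q'
  consider "q' < q" | "q' = q" | "q < q'" by linarith
  then show "ascending b' (q' * (2 * w)) (min (q' * (2 * w) + 2 * w) hi)"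
  proof cases
    case 1
    then have "Suc q' * (2 * w) \<le> q * (2 * w)" by (intro mult_le_mono1) simp
    then have "q' * (2 * w) + 2 * w \<le> q * (2 * w)" by simp
    moreover from this have "ascending b (q' * (2 * w)) (q' * (2 * w) + 2 * w)"
      using assms(1) by (metis blocks_def min.absorb1)
    ultimately show ?thesis using assms(3) unfolding ascending_def by auto
  next
    case 2
    then show ?thesis using assms(2) unfolding ascending_def by auto
  next
    case 3
    then have "Suc q * (2 * w) \<le> q' * (2 * w)" by (intro mult_le_mono1) simp
    then show ?thesis using assms(4) unfolding ascending_def by auto
  qed
qed

definition merge_pass :: prog where
  "merge_pass =
     IWrite ''lo'' [] (IConst 0) ;;
     While (ILess (V ''lo'') (V ''d''))
       (Cond (ILess (IPlus (V ''lo'') (V ''w'')) (V ''d''))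
          (IWrite ''mid'' [] (IPlus (V ''lo'') (V ''w''))) (IWrite ''mid'' [] (V ''d'')) ;;
        Cond (ILess (IPlus (V ''mid'') (V ''w'')) (V ''d''))
          (IWrite ''hi'' [] (IPlus (V ''mid'') (V ''w''))) (IWrite ''hi'' [] (V ''d'')) ;;
        merge_prog ;;
        IWrite ''lo'' [] (V ''hi''))"

lemma iw_merge_pass [simp]: "iw v merge_pass \<longleftrightarrow> v \<in> {''lo'', ''mid'', ''hi'', ''i1'', ''i2'', ''o''}"
  and rw_merge_pass [simp]: "rw v merge_pass \<longleftrightarrow> v = ''a2''"
  by (auto simp: merge_pass_def)

text \<open>A block costs a constant plus a multiple of its length. As no block is empty, the constant is charged to the
length as well, and the lengths add up to \<open>d\<close>.\<close>

lemma merge_pass: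
  assumes d: "ints s ''d'' [] = d" and w: "ints s ''w'' [] = w" "1 \<le> w"
    and a: "a = (\<lambda>l. reals s ''a'' [l])" "blocks a w d"
    and T: "100 * d + 10 \<le> T"
  shows "runs merge_pass s T (\<lambda>s'. let b = (\<lambda>l. reals s' ''a2'' [l]) in
     entries b 0 d = entries a 0 d \<and> blocks b (2 * w) d)"
proof -
  define J where "J = (\<lambda>(s' :: memory) B. \<exists>lo b. ints s' ''lo'' [] = lo \<and> lo \<le> d \<and> b = (\<lambda>l. reals s' ''a2'' [l]) \<and>
     (lo = d \<or> (\<exists>q. lo = q * (2 * w))) \<and> entries b 0 lo = entries a 0 lo \<and> blocks b (2 * w) lo \<and>
     100 * (d - lo) + 4 \<le> B)"
  have "runs merge_pass s (100 * d + 10) (\<lambda>s'. let b = (\<lambda>l. reals s' ''a2'' [l]) in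
     entries b 0 d = entries a 0 d \<and> blocks b (2 * w) d)"
    unfolding merge_pass_def wp_Seq wp_IWrite
  proof (intro conjI wp_While_invariant[where I = J], goal_cases)
    case 1 show ?case by simp
  next
    case 2 show ?case unfolding J_def by (auto simp: blocks_def ascending_def)
  next
    case (3 s' B)
    then obtain lo b where J: "ints s' ''lo'' [] = lo" "lo \<le> d" "b = (\<lambda>l. reals s' ''a2'' [l])"
      "lo = d \<or> (\<exists>q. lo = q * (2 * w))" "entries b 0 lo = entries a 0 lo" "blocks b (2 * w) lo"
      "100 * (d - lo) + 4 \<le> B" by (auto simp: J_def)
    from J show ?case by auto
  next
    case (4 s' B)
    then obtain lo b where J: "ints s' ''lo'' [] = lo" "lo \<le> d" "b = (\<lambda>l. reals s' ''a2'' [l])"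
      "lo = d \<or> (\<exists>q. lo = q * (2 * w))" "entries b 0 lo = entries a 0 lo" "blocks b (2 * w) lo"
      "100 * (d - lo) + 4 \<le> B" by (auto simp: J_def)
    have u: "ints s' ''d'' [] = d" "ints s' ''w'' [] = w" "\<And>l. reals s' ''a'' [l] = a l"
      using 4(2) d w a(1) by (simp_all add: frame_def)
    show ?case
    proof (cases "lo < d")
      case False
      with J u show ?thesis by auto
    next
      case True
      with J obtain q where q: "lo = q * (2 * w)" by auto
      define mid where "mid = min (lo + w) d"
      define hi where "hi = min (mid + w) d"
      have h: "lo < hi" "lo \<le> mid" "mid \<le> hi" "hi \<le> d" "hi \<le> lo + 2 * w" "hi = d \<or> hi = lo + 2 * w"
        using True w(2) by (auto simp: mid_def hi_def)
      have s1: "ascending a lo mid" using a(2)[unfolded blocks_def, rule_format, of "2 * q"] by (simp add: mid_def q mult.assoc mult.left_commute)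
      have s2: "ascending a mid hi"
      proof (cases "lo + w < d")
        case True
        have "ascending a (Suc (2 * q) * w) (min (Suc (2 * q) * w + w) d)"
          using a(2) by (simp only: blocks_def)
        with True show ?thesis by (simp add: mid_def hi_def q algebra_simps)
      qed (auto simp: mid_def hi_def ascending_def)
      have "runs merge_prog t T' (\<lambda>s'. let b' = (\<lambda>l. reals s' ''a2'' [l]) in
          entries b' lo hi = entries a lo hi \<and> ascending b' lo hi \<and> (\<forall>l. l < lo \<or> hi \<le> l \<longrightarrow> b' l = b l))"
        if "ints t ''lo'' [] = lo" "ints t ''mid'' [] = mid" "ints t ''hi'' [] = hi"
           "\<And>l. reals t ''a'' [l] = a l" "\<And>l. reals t ''a2'' [l] = b l" "40 * (hi - lo) + 10 \<le> T'" for t T'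
        using merge_prog[of t lo mid hi a b T'] that s1 s2 h by auto
      have fin: "wp (merge_prog ;; IWrite ''lo'' [] (V ''hi'')) J t T'"
        if t: "ints t ''lo'' [] = lo" "ints t ''mid'' [] = mid" "ints t ''hi'' [] = hi"
           "\<And>l. reals t ''a'' [l] = a l" "\<And>l. reals t ''a2'' [l] = b l" "B \<le> T' + 30" for t T'
        unfolding wp_Seq
      proof (rule wp_runs)
        show "runs merge_prog t (40 * (hi - lo) + 10) (\<lambda>s'. let b' = (\<lambda>l. reals s' ''a2'' [l]) in
          entries b' lo hi = entries a lo hi \<and> ascending b' lo hi \<and> (\<forall>l. l < lo \<or> hi \<le> l \<longrightarrow> b' l = b l))"
          using merge_prog[of t lo mid hi a b] t s1 s2 h by auto
        have "100 * (hi - lo) + 100 * (d - hi) = 100 * (d - lo)" using h by simp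
        then have B: "40 * (hi - lo) + 60 + 100 * (d - hi) + 4 \<le> B" using J(7) h(1) by linarith
        with that(6) show "40 * (hi - lo) + 10 \<le> T'" by linarith
        fix t' B'
        assume t': "let b' = (\<lambda>l. reals t' ''a2'' [l]) in
          entries b' lo hi = entries a lo hi \<and> ascending b' lo hi \<and> (\<forall>l. l < lo \<or> hi \<le> l \<longrightarrow> b' l = b l)"
          and f: "frame merge_prog t t'" and B': "T' \<le> B' + (40 * (hi - lo) + 10)"
        define b' where "b' = (\<lambda>l. reals t' ''a2'' [l])"
        from t' have t'': "entries b' lo hi = entries a lo hi" "ascending b' lo hi" "\<forall>l. l < lo \<or> hi \<le> l \<longrightarrow> b' l = b l"
          by (auto simp: b'_def Let_def)
        have "entries b' 0 lo = entries a 0 lo"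
          using J(5) t''(3) by (metis entries_cong)
        then have e: "entries b' 0 hi = entries a 0 hi"
          using entries_append[of 0 lo hi b'] entries_append[of 0 lo hi a] t''(1) h by simp
        have bl: "blocks b' (2 * w) hi"
          by (rule blocks_step[of b w q]) (use J(6) t'' h q in auto)
        have hi: "ints t' ''hi'' [] = hi" using f t by (simp add: frame_def)
        show "wp (IWrite ''lo'' [] (V ''hi'')) J t' B'"
        proof -
          have "hi = d \<or> (\<exists>q. hi = q * (2 * w))" using h(6) q by (auto intro: exI[of _ "Suc q"])
          moreover have le: "100 * (d - hi) + 4 \<le> B' - 2" using B B' that(6) by linarith
          ultimately have "J (iupd ''lo'' [] hi t') (B' - 2)"
            unfolding J_def
            by (intro exI[of _ hi] exI[of _ b'] conjI) (use e bl h in \<open>auto simp: b'_def\<close>)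
          then show ?thesis using hi le by simp
        qed
      qed
      have B60: "60 \<le> B" using J(7) True by linarith
      show ?thesis
        using True J u B60 unfolding wp_Seq[symmetric]
        apply (simp del: wp_Seq)
        apply (simp only: wp_Seq[of "Cond b p q" for b p q] wp_Cond wp_IWrite)
        apply (auto intro!: fin simp: mid_def hi_def simp del: wp_Seq)
        done
    qed
  qed
  then show ?thesis by (rule runs_mono[OF _ T])
qed

definition sort_prog :: prog where
  "sort_prog =
     IWrite ''w'' [] (IConst 1) ;;
     While (ILess (V ''w'') (V ''d''))
       (merge_pass ;;
        For ''o'' (IConst 0) (V ''d'') (RWrite ''a'' [V ''o''] (RRead ''a2'' [V ''o''])) ;;
        IWrite ''w'' [] (IPlus (V ''w'') (V ''w'')))"

lemma iw_sort_prog [simp]: "iw v sort_prog \<longleftrightarrow> v \<in> {''lo'', ''mid'', ''hi'', ''i1'', ''i2'', ''o'', ''w''}"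
  and rw_sort_prog [simp]: "rw v sort_prog \<longleftrightarrow> v \<in> {''a'', ''a2''}"
  by (auto simp: sort_prog_def)

lemma blocks_cong: "blocks f w n \<Longrightarrow> (\<And>l. l < n \<Longrightarrow> g l = f l) \<Longrightarrow> blocks g w n"
  unfolding blocks_def ascending_def by auto

lemma blocks_1: "blocks f (Suc 0) n"
proof -
  have "f x \<le> f y" if "q \<le> x" "x \<le> y" "y < Suc q" for q x y
  proof -
    from that have "x = y" by linarith
    then show ?thesis by simp
  qed
  then show ?thesis unfolding blocks_def ascending_def by auto
qed

text \<open>The block length doubles in every pass, so \<open>L\<close> passes suffice as soon as \<open>d \<le> 2 ^ L\<close>.\<close>

lemma sort_prog:
  assumes d: "ints s ''d'' [] = d" "d \<le> 2 ^ L"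
    and a: "a = (\<lambda>l. reals s ''a'' [l])"
    and T: "L * (150 * d + 60) + 20 \<le> T"
  shows "runs sort_prog s T (\<lambda>s'. let b = (\<lambda>l. reals s' ''a'' [l]) in
     entries b 0 d = entries a 0 d \<and> ascending b 0 d)"
proof -
  define J where "J = (\<lambda>(s' :: memory) B. \<exists>p b. ints s' ''w'' [] = 2 ^ p \<and> b = (\<lambda>l. reals s' ''a'' [l]) \<and>
     entries b 0 d = entries a 0 d \<and> blocks b (2 ^ p) d \<and> (L - p) * (150 * d + 60) + 5 \<le> B)"
  have "runs sort_prog s (20 + L * (150 * d + 60)) (\<lambda>s'. let b = (\<lambda>l. reals s' ''a'' [l]) in
     entries b 0 d = entries a 0 d \<and> ascending b 0 d)"
    unfolding sort_prog_def wp_Seq wp_IWrite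
  proof (intro conjI wp_While_invariant[where I = J], goal_cases)
    case 1 show ?case by simp
  next
    case 2 show ?case unfolding J_def
      by (intro exI[of _ 0] exI[of _ a]) (use blocks_1 in \<open>auto simp: a\<close>)
  next
    case (3 s' B)
    then show ?case by (auto simp: J_def)
  next
    case (4 s' B)
    then obtain p b where J: "ints s' ''w'' [] = 2 ^ p" "b = (\<lambda>l. reals s' ''a'' [l])"
      "entries b 0 d = entries a 0 d" "blocks b (2 ^ p) d" "(L - p) * (150 * d + 60) + 5 \<le> B"
      by (auto simp: J_def)
    have u: "ints s' ''d'' [] = d"
      using 4(2) d by (simp_all add: frame_def)
    show ?case
    proof (cases "2 ^ p < d")
      case False
      then have "ascending b 0 d" using J(4)[unfolded blocks_def, rule_format, of 0] by simp
      with False J u show ?thesis by auto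
    next
      case True
      then have "(2::nat) ^ p < 2 ^ L" using d(2) by (rule less_le_trans)
      then have "p < L" by simp
      then have "L - p = Suc (L - Suc p)" by simp
      with J(5) have B: "(150 * d + 60) + (L - Suc p) * (150 * d + 60) + 5 \<le> B" by simp
      have "wp (merge_pass ;;
        For ''o'' (IConst 0) (V ''d'') (RWrite ''a'' [V ''o''] (RRead ''a2'' [V ''o''])) ;;
        IWrite ''w'' [] (IPlus (V ''w'') (V ''w''))) J s' (B - 4)"
        unfolding wp_Seq
      proof (rule wp_runs[OF merge_pass[OF u J(1) _ J(2,4) order_refl]], goal_cases)
        case 1 show ?case by simp
      next
        case 2 show ?case using B by linarith
      next
        case (3 s1 B1)
        define c where "c = (\<lambda>l. reals s1 ''a2'' [l])"
        have c: "entries c 0 d = entries b 0 d" "blocks c (2 * 2 ^ p) d"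
          using 3(1) by (auto simp: c_def Let_def)
        have u1: "ints s1 ''d'' [] = d" "ints s1 ''w'' [] = 2 ^ p"
          using 3(2) u J(1) by (simp_all add: frame_def)
        show ?case
        proof (rule wp_runs[OF runs_For[where lo = 0 and hi = d and K = 4 and
                I = "\<lambda>n s2. \<forall>l<n. reals s2 ''a'' [l] = c l", OF _ _ _ _ _ _ order_refl]], goal_cases)
          case (2 i s2)
          then have "reals s2 ''a2'' [l] = c l" for l by (simp add: c_def frame_def)
          with 2 show ?case by (auto simp: less_Suc_eq)
        next
          case (5 s2)
          then show ?case using u1 by (simp add: frame_def)
        next
          case 7
          then show ?case using B 3(3) by simp
        next
          case (8 s2 B2)
          define e where "e = (\<lambda>l. reals s2 ''a'' [l])"
          have u2: "ints s2 ''w'' [] = 2 ^ p" using 8(2) u1 by (simp add: frame_def)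
          have e: "entries e 0 d = entries a 0 d" "blocks e (2 * 2 ^ p) d"
            using blocks_cong[OF c(2), of e] entries_cong[of 0 d e c] 8(1) c(1) J(3) by (auto simp: e_def)
          have B2: "(L - Suc p) * (150 * d + 60) + 10 \<le> B2" using 8(3) 3(3) B by simp
          then have "J (iupd ''w'' [] (2 ^ Suc p) s2) (B2 - 4)"
            unfolding J_def by (intro exI[of _ "Suc p"] exI[of _ e] conjI) (use e in \<open>auto simp: e_def\<close>)
          moreover have "4 \<le> B2" using B2 by simp
          ultimately show ?case by (simp add: u2 mult_2)
        qed simp_all
      qed
      with True u J(1) B show ?thesis by (simp del: wp_Seq)
    qed
  qed
  then show ?thesis by (rule runs_mono) (use T in auto)
qed

section \<open>The median step\<close>

lemma median_entries:
  assumes "ascending f 0 d" "1 \<le> d"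
  shows "median (entries f 0 d) = (f ((d - 1) div 2) + f (d div 2)) / 2"
proof -
  define xs where "xs = map f [0..<d]"
  have "sorted xs" using assms(1) by (auto simp: xs_def ascending_def sorted_iff_nth_mono)
  then have "sorted_list_of_multiset (mset xs) = xs" by (simp add: sorted_sort_id)
  moreover have "mset xs = entries f 0 d" by (simp add: xs_def entries_def)
  ultimately have "sorted_list_of_multiset (entries f 0 d) = xs" by simp
  with assms(2) show ?thesis by (auto simp: median_def xs_def Let_def)
qed

definition residual_prog :: prog where
  "residual_prog =
     For ''j'' (IConst 1) (IPlus (V ''m'') (IConst 1)) (RWrite ''r'' [V ''j''] (RRead ''y'' [V ''j''])) ;;
     For ''i'' (IConst 1) (IPlus (V ''N'') (IConst 1))
       (For ''l'' (IConst 0) (V ''d'')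
         (RWrite ''r'' [IRead ''nbr'' [V ''i'', V ''l'']]
           (RMinus (RRead ''r'' [IRead ''nbr'' [V ''i'', V ''l'']]) (RRead ''x'' [V ''i'']))))"

lemma iw_residual_prog [simp]: "iw v residual_prog \<longleftrightarrow> v \<in> {''j'', ''i'', ''l''}"
  and rw_residual_prog [simp]: "rw v residual_prog \<longleftrightarrow> v = ''r''"
  by (auto simp: residual_prog_def)

lemma residual_prog:
  assumes reg: "left_regular N m d \<Gamma>" and mat: "holds_matrix s N m d \<Gamma>"
    and y: "holds_vector s ''y'' m y" and x: "holds_vector s ''x'' N x"
    and T: "m * 20 + N * (d * 40 + 40) + 40 \<le> T"
  shows "runs residual_prog s T
     (\<lambda>s'. \<forall>j\<in>{1..m}. reals s' ''r'' [j] = y j - (\<Sum>l=1..N. adjacency \<Gamma> j l * x l))"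
proof -
  note mat' = mat[unfolded holds_matrix_def]
  have "runs residual_prog s (m * 20 + N * (d * 40 + 40) + 40)
     (\<lambda>s'. \<forall>j\<in>{1..m}. reals s' ''r'' [j] = y j - (\<Sum>l\<in>{1..<N+1}. adjacency \<Gamma> j l * x l))"
    unfolding residual_prog_def wp_Seq
  proof (rule wp_runs[OF runs_For[where lo = 1 and hi = "m + 1" and K = 4 and
          I = "\<lambda>n s'. \<forall>j\<in>{1..<n}. reals s' ''r'' [j] = y j", OF _ _ _ _ _ _ order_refl]], goal_cases)
    case (2 i s')
    then have "reals s' ''y'' [i] = y i" using y by (simp add: holds_vector_def frame_def)
    with 2 show ?case by (auto simp: less_Suc_eq)
  next
    case (5 s')
    then show ?case using mat' by (simp add: frame_def)
  next
    case (8 s1 B1)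
    show ?case
    proof (rule runs_mono[OF runs_For[where lo = 1 and hi = "N + 1" and K = "d * 30 + 10" and
          I = "\<lambda>n s'. \<forall>j\<in>{1..m}. reals s' ''r'' [j] = y j - (\<Sum>l\<in>{1..<n}. adjacency \<Gamma> j l * x l)",
           OF _ _ _ _ _ _ order_refl]], goal_cases)
      case 1
      show ?case using 8(1) by auto
    next
      case (2 i s2)
      have u2: "ints s2 ''nbr'' = ints s ''nbr''" "ints s2 ''d'' [] = d" "reals s2 ''x'' [i] = x i"
        using 2 8(2) mat' x by (simp_all add: frame_def holds_vector_def)
      have bij: "bij_betw (\<lambda>l. ints s2 ''nbr'' [i, l]) {0..<d} (\<Gamma> i)"
        using mat' 2 unfolding u2 by auto
      have sub: "\<Gamma> i \<subseteq> {1..m}" using reg 2 by (auto simp: left_regular_def)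
      show ?case
      proof (rule runs_mono[OF runs_For[where lo = 0 and hi = d and K = 15 and
          I = "\<lambda>n s'. \<forall>j\<in>{1..m}. reals s' ''r'' [j] = y j - (\<Sum>l\<in>{1..<i}. adjacency \<Gamma> j l * x l)
                 - (if j \<in> (\<lambda>l. ints s2 ''nbr'' [i, l]) ` {0..<n} then x i else 0)",
           OF _ _ _ _ _ _ order_refl]], goal_cases)
        case 1
        show ?case using 2 by simp
      next
        case (2 l s3)
        define t where "t = ints s2 ''nbr'' [i, l]"
        have "t \<in> {1..m}" using bij_betw_apply[OF bij, of l] sub 2 unfolding t_def by auto
        moreover have "t \<notin> (\<lambda>l. ints s2 ''nbr'' [i, l]) ` {0..<l}"
        proof
          assume "t \<in> (\<lambda>l. ints s2 ''nbr'' [i, l]) ` {0..<l}"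
          then obtain l' where "l' < l" "ints s2 ''nbr'' [i, l] = ints s2 ''nbr'' [i, l']"
            by (auto simp: t_def)
          with inj_onD[OF bij_betw_imp_inj_on[OF bij], of l l'] \<open>l < d\<close> show False by fastforce
        qed
        moreover have "ints s3 ''nbr'' [i, l] = t" "ints s3 ''i'' [] = i" "reals s3 ''x'' [i] = x i"
          using 2 \<open>ints s2 ''i'' [] = i\<close> u2 by (simp_all add: frame_def t_def)
        moreover have "(\<lambda>l. ints s2 ''nbr'' [i, l]) ` {0..<Suc l} = insert t ((\<lambda>l. ints s2 ''nbr'' [i, l]) ` {0..<l})"
          by (auto simp: t_def atLeast0_lessThan_Suc)
        ultimately show ?case using 2 by auto
      next
        case (5 s3)
        then show ?case using u2 by (simp add: frame_def)
      next
        case (8 s3)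
        then show ?case using bij \<open>1 \<le> i\<close> by (auto simp: bij_betw_def adjacency_def)
      qed simp_all
    next
      case (5 s2)
      then show ?case using 8(2) mat' by (simp add: frame_def)
    next
      case 7
      show ?case using 8(3) by (simp add: algebra_simps)
    next
      case (8 s2)
      then show ?case by simp
    qed simp_all
  qed simp_all
  moreover have "{1..<N+1} = {1..N}" by auto
  ultimately show ?thesis by (elim runs_mono[OF _ T]) (simp only: )
qed

text \<open>The machine cannot divide naturals, so \<open>d div 2\<close> and \<open>d mod 2\<close> are found by counting. Together they give
both middle positions, since \<open>(d - 1) div 2 = d div 2 + d mod 2 - 1\<close>.\<close>

definition half_prog :: prog where
  "half_prog =
     IWrite ''h'' [] (IConst 0) ;; IWrite ''c'' [] (V ''d'') ;;
     While (ILess (IConst 1) (V ''c''))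
       (IWrite ''h'' [] (IPlus (V ''h'') (IConst 1)) ;; IWrite ''c'' [] (IMinus (V ''c'') (IConst 2)))"

lemma half_prog:
  assumes "ints s ''d'' [] = d" "d * 20 + 20 \<le> T"
  shows "runs half_prog s T (\<lambda>s'. ints s' ''h'' [] = d div 2 \<and> ints s' ''c'' [] = d mod 2)"
  unfolding half_prog_def wp_Seq wp_IWrite
proof (intro conjI wp_While_invariant[where I = "\<lambda>s' B. 2 * ints s' ''h'' [] + ints s' ''c'' [] = d
       \<and> ints s' ''c'' [] * 20 + 4 \<le> B"], goal_cases)
  case (6 s' B)
  show ?case
  proof (cases "1 < ints s' ''c'' []")
    case True
    then obtain e where "ints s' ''c'' [] = Suc (Suc e)" by (metis One_nat_def less_imp_Suc_add add_Suc)
    with 6 show ?thesis by auto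
  next
    case False
    moreover have "h = d div 2 \<and> c = d mod 2" if "2 * h + c = d" "\<not> 1 < c" for h c
      using that by presburger
    ultimately have "ints s' ''h'' [] = d div 2 \<and> ints s' ''c'' [] = d mod 2" using 6 by blast
    with False show ?thesis by simp
  qed
qed (use assms in auto)

lemma iw_half_prog [simp]: "iw v half_prog \<longleftrightarrow> v \<in> {''h'', ''c''}"
  and rw_half_prog [simp]: "\<not> rw v half_prog"
  by (auto simp: half_prog_def)

definition med_prog :: prog where
  "med_prog =
     residual_prog ;;
     half_prog ;;
     For ''i'' (IConst 1) (IPlus (V ''N'') (IConst 1))
       (For ''l'' (IConst 0) (V ''d'')
          (RWrite ''a'' [V ''l''] (RRead ''r'' [IRead ''nbr'' [V ''i'', V ''l'']])) ;;
        sort_prog ;;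
        RWrite ''b'' [V ''i'']
          (RPlus (RRead ''x'' [V ''i''])
             (RDivide (RPlus (RRead ''a'' [IMinus (IPlus (V ''h'') (V ''c'')) (IConst 1)]) (RRead ''a'' [V ''h'']))
                (RConst 2))))"

lemma iw_med_prog [simp]:
    "iw v med_prog \<longleftrightarrow> v \<in> {''j'', ''i'', ''l'', ''h'', ''c'', ''lo'', ''mid'', ''hi'', ''i1'', ''i2'', ''o'', ''w''}"
  and rw_med_prog [simp]: "rw v med_prog \<longleftrightarrow> v \<in> {''r'', ''a'', ''a2'', ''b''}"
  by (auto simp: med_prog_def)

lemma med_prog:
  assumes reg: "left_regular N m d \<Gamma>" and mat: "holds_matrix s N m d \<Gamma>"
    and y: "holds_vector s ''y'' m y" and x: "holds_vector s ''x'' N x"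
    and L: "d \<le> 2 ^ L" and T: "400 * ((N + 1) * (d + 1) * (L + 1) + m) \<le> T"
  shows "runs med_prog s T (\<lambda>s'. holds_vector s' ''b'' N (median_step N \<Gamma> y x))"
proof -
  note mat' = mat[unfolded holds_matrix_def]
  define u where "u = (\<lambda>j. y j - (\<Sum>l=1..N. adjacency \<Gamma> j l * x l))"
  define KL where "KL = L * (150 * d + 60) + d * 20 + 60"
  have d1: "1 \<le> d" using reg by (auto simp: left_regular_def)
  have "runs med_prog s (m * 20 + N * (d * 40 + 40) + d * 20 + N * (KL + 20) + 100)
     (\<lambda>s'. \<forall>i\<in>{1..<N+1}. reals s' ''b'' [i] = median_step N \<Gamma> y x i)"
    unfolding med_prog_def wp_Seq
  proof (rule wp_runs[OF residual_prog[OF reg mat y x order_refl]], goal_cases)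
    case 1 show ?case by simp
  next
    case (2 s1 B1)
    have r: "\<forall>j\<in>{1..m}. reals s1 ''r'' [j] = u j" using 2(1) by (simp add: u_def)
    show ?case
    proof (rule wp_runs[OF half_prog[OF _ order_refl, of s1 d]], goal_cases)
      case 1 show ?case using mat' 2(2) by (simp add: frame_def)
    next
      case 2 then show ?case using \<open>_ \<le> B1 + _\<close> by simp
    next
      case (3 s2 B2)
      show ?case
      proof (rule runs_mono[OF runs_For[where lo = 1 and hi = "N + 1" and K = KL and
            I = "\<lambda>n s'. \<forall>i\<in>{1..<n}. reals s' ''b'' [i] = median_step N \<Gamma> y x i",
             OF _ _ _ _ _ _ order_refl]], goal_cases)
        case (2 i s3)
        have u3: "ints s3 ''nbr'' = ints s ''nbr''" "ints s3 ''d'' [] = d" "reals s3 ''x'' [i] = x i"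
            "ints s3 ''h'' [] = d div 2" "ints s3 ''c'' [] = d mod 2" "\<forall>j\<in>{1..m}. reals s3 ''r'' [j] = u j"
          using 2 3 r \<open>frame residual_prog s s1\<close> mat' x by (simp_all add: frame_def holds_vector_def)
        have bij: "bij_betw (\<lambda>l. ints s3 ''nbr'' [i, l]) {0..<d} (\<Gamma> i)"
          using mat' 2 unfolding u3 by auto
        have sub: "\<Gamma> i \<subseteq> {1..m}" using reg 2 by (auto simp: left_regular_def)
        define a where "a = (\<lambda>l. u (ints s3 ''nbr'' [i, l]))"
        have ent: "entries a 0 d = image_mset u (mset_set (\<Gamma> i))"
        proof -
          have "mset_set (\<Gamma> i) = image_mset (\<lambda>l. ints s3 ''nbr'' [i, l]) (mset_set {0..<d})"
            using bij by (simp add: bij_betw_def image_mset_mset_set)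
          then show ?thesis by (simp add: a_def entries_def multiset.map_comp o_def)
        qed
        show ?case unfolding wp_Seq
        proof (rule wp_runs[OF runs_For[where lo = 0 and hi = d and K = 8 and
            I = "\<lambda>n s'. \<forall>l<n. reals s' ''a'' [l] = a l",
             OF _ _ _ _ _ _ order_refl]], goal_cases)
          case (2 l s4)
          have "ints s4 ''nbr'' [i, l] \<in> {1..m}"
            using bij_betw_apply[OF bij, of l] sub 2 by (auto simp: frame_def)
          with u3(6) have "reals s4 ''r'' [ints s4 ''nbr'' [i, l]] = a l"
            using 2 by (simp add: a_def frame_def)
          moreover have "ints s4 ''i'' [] = i" using 2 \<open>ints s3 ''i'' [] = i\<close> by (simp add: frame_def)
          ultimately show ?case using 2 by (auto simp: less_Suc_eq)
        next
          case (5 s4)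
          then show ?case using u3 by (simp add: frame_def)
        next
          case 7 then show ?case by (simp add: KL_def)
        next
          case (8 s4 B4)
          have u4: "ints s4 ''d'' [] = d" using 8 u3 by (simp add: frame_def)
          have e4: "entries (\<lambda>l. reals s4 ''a'' [l]) 0 d = entries a 0 d"
            using 8(1) by (intro entries_cong) auto
          show ?case
          proof (rule wp_runs[OF sort_prog[OF u4 L refl order_refl]], goal_cases)
            case 1 show ?case using 8(3) by (simp add: KL_def)
          next
            case (2 s5 B5)
            have u5: "ints s5 ''h'' [] = d div 2" "ints s5 ''c'' [] = d mod 2" "ints s5 ''i'' [] = i"
                "reals s5 ''x'' [i] = x i"
              using 2 8(2) u3 \<open>ints s3 ''i'' [] = i\<close> by (simp_all add: frame_def)
            have "median (image_mset u (mset_set (\<Gamma> i))) =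
               (reals s5 ''a'' [(d - 1) div 2] + reals s5 ''a'' [d div 2]) / 2"
              using 2(1) median_entries[OF _ d1, of "\<lambda>l. reals s5 ''a'' [l]"] ent e4 by (simp add: Let_def)
            moreover have "d div 2 + d mod 2 - 1 = (d - 1) div 2" using d1 by presburger
            moreover have "\<forall>i\<in>{1..<i}. reals s5 ''b'' [i] = median_step N \<Gamma> y x i"
              using 2(2) 8(2) \<open>\<forall>i\<in>{1..<i}. _ i\<close> by (simp add: frame_def)
            ultimately show ?case
              using 2(3) 8(3) u5 by (auto simp: KL_def median_step_def Med_def u_def less_Suc_eq)
          qed
        qed simp_all
      next
        case (5 s3)
        then show ?case using 3 \<open>frame residual_prog s s1\<close> mat' by (simp add: frame_def)
      next
        case 7
        then show ?case using 3(3) 2(3) by (simp add: algebra_simps)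
      qed simp_all
    qed
  qed
  moreover have "m * 20 + N * (d * 40 + 40) + d * 20 + N * (KL + 20) + 100 \<le> T"
    using T by (simp add: KL_def algebra_simps)
  ultimately show ?thesis
    by (elim runs_mono) (auto simp: holds_vector_def)
qed

section \<open>Projections as supports of largest weight\<close>

text \<open>The error of a vector supported in \<open>K'\<close> is at least the weight of \<open>b\<close> outside \<open>K'\<close>, with equality for the
restriction of \<open>b\<close>. Projecting is therefore the same as maximizing the weight of the support. The support \<open>X\<close>
only has to be contained in a member of the model.\<close>

lemma model_projectionI:
  assumes K: "K \<in> \<M>" "X \<subseteq> K" "X \<subseteq> {1..N}"
    and z: "\<And>i. i \<in> {1..N} \<Longrightarrow> z i = (if i \<in> X then b i else 0)"
    and opt: "\<And>K'. K' \<in> \<M> \<Longrightarrow> (\<Sum>i\<in>K' \<inter> {1..N}. \<bar>b i\<bar>) \<le> (\<Sum>i\<in>X. \<bar>b i\<bar>)"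
  shows "model_projection N \<M> b z"
proof -
  have split: "(\<Sum>i=1..N. \<bar>b i\<bar>) = (\<Sum>i\<in>Y. \<bar>b i\<bar>) + (\<Sum>i\<in>{1..N} - Y. \<bar>b i\<bar>)" if "Y \<subseteq> {1..N}" for Y
    using sum.subset_diff[OF that, of "\<lambda>i. \<bar>b i\<bar>"] by simp
  have "{i \<in> {1..N}. z i \<noteq> 0} \<subseteq> K" using K z by (auto split: if_splits)
  then have "model_sparse N \<M> z" using K by (auto simp: model_sparse_def)
  moreover have "(\<Sum>i=1..N. \<bar>b i - z i\<bar>) \<le> (\<Sum>i=1..N. \<bar>b i - y i\<bar>)" if sparse: "model_sparse N \<M> y" for y
  proof -
    obtain K' where K': "K' \<in> \<M>" "{i \<in> {1..N}. y i \<noteq> 0} \<subseteq> K'"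
      using sparse unfolding model_sparse_def by blast
    have "(\<Sum>i=1..N. \<bar>b i - z i\<bar>) = (\<Sum>i\<in>{1..N}-X. \<bar>b i\<bar>)"
      by (rule sum.mono_neutral_cong_right) (use z K(3) in auto)
    also have "\<dots> \<le> (\<Sum>i\<in>{1..N} - (K' \<inter> {1..N}). \<bar>b i\<bar>)"
      using split[OF K(3)] split[of "K' \<inter> {1..N}"] opt[OF K'(1)] by simp
    also have "\<dots> = (\<Sum>i\<in>{1..N} - (K' \<inter> {1..N}). \<bar>b i - y i\<bar>)"
      by (rule sum.cong) (use K'(2) in auto)
    also have "\<dots> \<le> (\<Sum>i=1..N. \<bar>b i - y i\<bar>)" by (rule sum_mono2) auto
    finally show ?thesis .
  qed
  ultimately show ?thesis unfolding model_projection_def is_arg_min_def by (auto simp: not_less)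
qed

section \<open>The knapsack recurrence along a postorder\<close>

text \<open>In a postorder numbering the subtree of the node numbered \<open>p\<close> has the numbers \<open>q p + 1, \<dots>, p\<close>. Two such
intervals are disjoint or nested. This laminarity is all that the dynamic program knows about the tree.\<close>

definition nested :: "nat \<Rightarrow> (nat \<Rightarrow> nat) \<Rightarrow> bool" where
  "nested N q \<longleftrightarrow> (\<forall>p\<in>{1..N}. q p < p \<and> (\<forall>p'. q p < p' \<and> p' \<le> p \<longrightarrow> q p \<le> q p'))"

text \<open>Sets of at most \<open>j\<close> numbers up to \<open>p\<close> that are closed under ancestors: \<open>p'\<close> is an ancestor of \<open>a\<close> if \<open>a\<close>
lies in the interval of \<open>p'\<close>.\<close>

definition feasible :: "(nat \<Rightarrow> nat) \<Rightarrow> nat \<Rightarrow> nat \<Rightarrow> nat set \<Rightarrow> bool" where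
  "feasible q p j K \<longleftrightarrow> K \<subseteq> {1..p} \<and> card K \<le> j \<and>
     (\<forall>a\<in>K. \<forall>p'\<in>{1..p}. q p' < a \<and> a \<le> p' \<longrightarrow> p' \<in> K)"

text \<open>\<open>T p j\<close> records which alternative of the recurrence attains the maximum: whether \<open>p\<close> is taken, or skipped with
its whole subtree.\<close>

definition knapsack_table :: "nat \<Rightarrow> nat \<Rightarrow> (nat \<Rightarrow> nat) \<Rightarrow> (nat \<Rightarrow> real) \<Rightarrow> (nat \<Rightarrow> nat \<Rightarrow> real) \<Rightarrow> (nat \<Rightarrow> nat \<Rightarrow> nat) \<Rightarrow> bool" where
  "knapsack_table N k q w F T \<longleftrightarrow> (\<forall>j\<le>k. F 0 j = 0) \<and> (\<forall>p\<in>{1..N}. F p 0 = 0 \<and> (\<forall>j\<in>{1..k}.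
     if 0 < T p j then F p j = F (p - 1) (j - 1) + w p \<and> F (q p) j \<le> F p j
     else F p j = F (q p) j \<and> F (p - 1) (j - 1) + w p \<le> F p j))"

lemma feasible_take:
  assumes "nested N q" "p \<in> {1..N}" "1 \<le> j" "feasible q (p - 1) (j - 1) K"
  shows "feasible q p j (insert p K)"
proof -
  have "finite K" using assms(4) by (auto simp: feasible_def dest: finite_subset)
  then have "card (insert p K) \<le> j" using assms(3,4) card_insert_le_m1[of j K p] by (auto simp: feasible_def)
  moreover have "p' \<in> insert p K" if "a \<in> insert p K" "p' \<in> {1..p}" "q p' < a" "a \<le> p'" for a p'
  proof (cases "p' = p")
    case False
    then have "a \<noteq> p" "p' \<in> {1..p-1}" using that by auto
    then show ?thesis using that assms(4) by (auto simp: feasible_def)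
  qed simp
  moreover have "insert p K \<subseteq> {1..p}"
    using assms(2,4) by (fastforce simp: feasible_def)
  ultimately show ?thesis unfolding feasible_def by blast
qed

text \<open>The numbers between \<open>q p\<close> and \<open>p\<close> belong to descendants of \<open>p\<close>; by laminarity none of them is an ancestor of
a number up to \<open>q p\<close>.\<close>

lemma feasible_skip:
  assumes "nested N q" "p \<in> {1..N}" "feasible q (q p) j K"
  shows "feasible q p j K"
proof -
  have q: "q p < p" "\<And>p'. q p < p' \<Longrightarrow> p' \<le> p \<Longrightarrow> q p \<le> q p'" using assms by (auto simp: nested_def)
  have "p' \<in> K" if "a \<in> K" "p' \<in> {1..p}" "q p' < a" "a \<le> p'" for a p'
  proof -
    have "a \<le> q p" using that assms(3) by (auto simp: feasible_def)
    have "p' \<le> q p"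
    proof (rule ccontr)
      assume "\<not> p' \<le> q p"
      then have "q p \<le> q p'" using q(2)[of p'] that by simp
      with \<open>a \<le> q p\<close> that show False by simp
    qed
    then show ?thesis using that assms(3) unfolding feasible_def by auto
  qed
  moreover have "K \<subseteq> {1..p}" "card K \<le> j"
    using assms(3) q(1) by (fastforce simp: feasible_def)+
  ultimately show ?thesis unfolding feasible_def by blast
qed

text \<open>If \<open>p\<close> is not in a closed set then neither is any of its descendants, which leaves the numbers up to \<open>q p\<close>.\<close>

lemma knapsack_upper:
  assumes n: "nested N q" and F: "knapsack_table N k q w F T"
  shows "p \<le> N \<Longrightarrow> j \<le> k \<Longrightarrow> feasible q p j K \<Longrightarrow> sum w K \<le> F p j"
proof (induction p arbitrary: j K rule: less_induct)
  case (less p)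
  have fin: "finite K" using less.prems by (auto simp: feasible_def dest: finite_subset)
  show ?case
  proof (cases "p = 0 \<or> j = 0")
    case True
    then have "K = {}" using less.prems(3) fin by (auto simp: feasible_def)
    then show ?thesis using F less.prems True by (cases "p = 0") (auto simp: knapsack_table_def)
  next
    case False
    then have p: "p \<in> {1..N}" "j \<in> {1..k}" using less.prems by auto
    have q: "q p < p" using n p by (auto simp: nested_def)
    have t: "F (p - 1) (j - 1) + w p \<le> F p j" "F (q p) j \<le> F p j"
    proof -
      have "if 0 < T p j then F p j = F (p - 1) (j - 1) + w p \<and> F (q p) j \<le> F p j
         else F p j = F (q p) j \<and> F (p - 1) (j - 1) + w p \<le> F p j"
        using F p unfolding knapsack_table_def by blast
      then show "F (p - 1) (j - 1) + w p \<le> F p j" "F (q p) j \<le> F p j"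
        by (auto split: if_splits)
    qed
    show ?thesis
    proof (cases "p \<in> K")
      case True
      have "card K \<le> j" using less.prems(3) by (simp add: feasible_def)
      then have "card (K - {p}) \<le> j - 1" using True fin by (simp add: diff_le_mono)
      moreover have "K - {p} \<subseteq> {1..p - 1}" using less.prems(3) by (force simp: feasible_def)
      ultimately have "feasible q (p - 1) (j - 1) (K - {p})"
        using less.prems(3) unfolding feasible_def by auto
      then have "sum w (K - {p}) \<le> F (p - 1) (j - 1)"
        using less.IH[of "p - 1" "j - 1" "K - {p}"] p by auto
      with t(1) True fin show ?thesis by (simp add: sum.remove)
    next
      case False
      have "a \<le> q p" if "a \<in> K" for a
      proof (rule ccontr)
        assume "\<not> a \<le> q p"
        moreover have "a \<le> p" using that less.prems(3) by (auto simp: feasible_def)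
        ultimately show False using False that p less.prems(3) by (auto simp: feasible_def)
      qed
      then have "feasible q (q p) j K" using less.prems(3) q unfolding feasible_def by auto
      then have "sum w K \<le> F (q p) j" using less.IH[of "q p" j K] q less.prems by auto
      with t(2) show ?thesis by simp
    qed
  qed
qed

section \<open>Descendants\<close>

definition desc where "desc N r par v = {u. (v, u) \<in> (parent_rel N r par)\<^sup>*}"

definition children :: "nat \<Rightarrow> nat \<Rightarrow> (nat \<Rightarrow> nat) \<Rightarrow> nat \<Rightarrow> nat list" where
  "children N r par v = filter (\<lambda>c. c \<noteq> r \<and> par c = v) (rev [1..<Suc N])"

lemma set_children: "c \<in> set (children N r par v) \<longleftrightarrow> (v, c) \<in> parent_rel N r par"
  by (auto simp: children_def parent_rel_def)

lemma distinct_children: "distinct (children N r par v)"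
  by (simp add: children_def)

lemma desc_unfold: "desc N r par v = insert v (\<Union>c\<in>set (children N r par v). desc N r par c)"
  by (auto simp: desc_def set_children elim: converse_rtranclE intro: converse_rtrancl_into_rtrancl)

lemma desc_self [simp]: "v \<in> desc N r par v"
  by (simp add: desc_def)

lemma parent_unique: "(u, v) \<in> parent_rel N r par \<Longrightarrow> (u', v) \<in> parent_rel N r par \<Longrightarrow> u = u'"
  by (auto simp: parent_rel_def)

lemma desc_subset:
  assumes "dary_tree D N r par" "v \<in> {1..N}"
  shows "desc N r par v \<subseteq> {1..N}"
proof
  fix u assume "u \<in> desc N r par v"
  then have "(v, u) \<in> (parent_rel N r par)\<^sup>*" by (simp add: desc_def)
  then show "u \<in> {1..N}" using assms(2) by (induction rule: rtrancl_induct) (auto simp: parent_rel_def)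
qed

lemma desc_root: "dary_tree D N r par \<Longrightarrow> desc N r par r = {1..N}"
  using desc_subset[of D N r par r] by (auto simp: dary_tree_def desc_def)

text \<open>Parents are unique and the root has none, so a cycle through \<open>v\<close> would run through all ancestors of \<open>v\<close> and
finally through the root.\<close>

lemma tree_acyclic:
  assumes "dary_tree D N r par" "v \<in> {1..N}"
  shows "(v, v) \<notin> (parent_rel N r par)\<^sup>+"
proof -
  have "(r, v) \<in> (parent_rel N r par)\<^sup>*" using assms by (auto simp: dary_tree_def)
  then show ?thesis
  proof (induction rule: rtrancl_induct)
    case base
    show ?case by (auto simp: parent_rel_def elim: tranclE)
  next
    case (step u v)
    show ?case
    proof
      assume "(v, v) \<in> (parent_rel N r par)\<^sup>+"
      then obtain u' where "(v, u') \<in> (parent_rel N r par)\<^sup>*" "(u', v) \<in> parent_rel N r par"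
        by (metis tranclD2)
      with parent_unique[OF step(2)] have "(v, u) \<in> (parent_rel N r par)\<^sup>*" by auto
      with step(2,3) show False by (auto dest: rtrancl_into_trancl2)
    qed
  qed
qed

lemma parent_not_desc:
  assumes "dary_tree D N r par" "(v, c) \<in> parent_rel N r par"
  shows "v \<notin> desc N r par c"
proof
  assume "v \<in> desc N r par c"
  with assms(2) have "(v, v) \<in> (parent_rel N r par)\<^sup>+" by (auto simp: desc_def dest: rtrancl_into_trancl2)
  moreover have "v \<in> {1..N}" using assms by (auto simp: parent_rel_def dary_tree_def)
  ultimately show False using tree_acyclic[OF assms(1)] by blast
qed

text \<open>The ancestors of a common descendant form a chain, so one sibling would be a proper descendant of the other, and their
parent a descendant of its own child.\<close>

lemma siblings_disjoint:
  assumes t: "dary_tree D N r par" and xy: "(v, x) \<in> parent_rel N r par" "(v, y) \<in> parent_rel N r par" "x \<noteq> y"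
  shows "desc N r par x \<inter> desc N r par y = {}"
proof (rule ccontr)
  have *: False if "(x, y) \<in> (parent_rel N r par)\<^sup>*" "(v, x) \<in> parent_rel N r par" "(v, y) \<in> parent_rel N r par" "x \<noteq> y" for x y
  proof -
    from that(1,4) obtain u where "(x, u) \<in> (parent_rel N r par)\<^sup>*" "(u, y) \<in> parent_rel N r par"
      by (metis rtranclE)
    with parent_unique[OF that(3)] have "v \<in> desc N r par x" by (auto simp: desc_def)
    with parent_not_desc[OF t that(2)] show False by simp
  qed
  assume "desc N r par x \<inter> desc N r par y \<noteq> {}"
  then obtain z where z: "(x, z) \<in> (parent_rel N r par)\<^sup>*" "(y, z) \<in> (parent_rel N r par)\<^sup>*"
    by (auto simp: desc_def)
  have "(x, y) \<in> (parent_rel N r par)\<^sup>* \<or> (y, x) \<in> (parent_rel N r par)\<^sup>*"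
    using z
  proof (induction rule: rtrancl_induct)
    case (step a b)
    show ?case
    proof (cases "y = b")
      case True
      then show ?thesis using step(1,2) by auto
    next
      case False
      with step(4) obtain a' where "(y, a') \<in> (parent_rel N r par)\<^sup>*" "(a', b) \<in> parent_rel N r par"
        by (metis rtranclE)
      then show ?thesis using step parent_unique by blast
    qed
  qed auto
  with *[of x y] *[of y x] xy show False by blast
qed

section \<open>Numbering a tree in postorder\<close>

text \<open>A singly linked list whose first entry is \<open>c\<close>; the number \<open>0\<close>, which is not a node, ends it.\<close>

fun linked :: "(nat \<Rightarrow> nat) \<Rightarrow> nat \<Rightarrow> nat list \<Rightarrow> bool" where
  "linked nxt c [] \<longleftrightarrow> c = 0"
| "linked nxt c (x # xs) \<longleftrightarrow> c = x \<and> linked nxt (nxt x) xs"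

lemma linked_upd: "v \<notin> set xs \<Longrightarrow> linked (nxt(v := y)) c xs = linked nxt c xs"
  by (induction xs arbitrary: c) auto

text \<open>Every node is put in front of the list of its parent, so the list of \<open>v\<close> is \<open>children N r par v\<close> in the order of
decreasing node numbers.\<close>

definition link_prog :: prog where
  "link_prog =
     For ''v'' (IConst 1) (IPlus (V ''N'') (IConst 1)) (IWrite ''fc'' [V ''v''] (IConst 0)) ;;
     For ''v'' (IConst 1) (IPlus (V ''N'') (IConst 1))
       (Cond (BAnd (BNot (ILess (V ''v'') (V ''root''))) (BNot (ILess (V ''root'') (V ''v''))))
          Skip
          (IWrite ''sb'' [V ''v''] (IRead ''fc'' [IRead ''par'' [V ''v'']]) ;;
           IWrite ''fc'' [IRead ''par'' [V ''v'']] (V ''v'')))"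

lemma iw_link_prog [simp]: "iw v link_prog \<longleftrightarrow> v \<in> {''v'', ''fc'', ''sb''}"
  and rw_link_prog [simp]: "\<not> rw v link_prog"
  by (auto simp: link_prog_def)

lemma link_prog:
  assumes t: "dary_tree D N r par" and s: "holds_tree s N r par k" and T: "N * 60 + 40 \<le> T"
  shows "runs link_prog s T (\<lambda>s'. \<forall>u\<in>{1..N}.
     linked (\<lambda>v. ints s' ''sb'' [v]) (ints s' ''fc'' [u]) (children N r par u))"
proof -
  note s' = s[unfolded holds_tree_def]
  have "runs link_prog s (N * 60 + 40) (\<lambda>s'. \<forall>u\<in>{1..N}.
     linked (\<lambda>v. ints s' ''sb'' [v]) (ints s' ''fc'' [u]) (filter (\<lambda>c. c \<noteq> r \<and> par c = u) (rev [1..<N + 1])))"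
    unfolding link_prog_def wp_Seq
  proof (rule wp_runs[OF runs_For[where lo = 1 and hi = "N + 1" and K = 4 and
          I = "\<lambda>n s'. \<forall>u\<in>{1..<n}. ints s' ''fc'' [u] = 0", OF _ _ _ _ _ _ order_refl]], goal_cases)
    case (5 s1)
    then show ?case using s' by (simp add: frame_def)
  next
    case (8 s1 B1)
    show ?case
    proof (rule runs_mono[OF runs_For[where lo = 1 and hi = "N + 1" and K = 30 and
          I = "\<lambda>n s'. \<forall>u\<in>{1..N}. linked (\<lambda>v. ints s' ''sb'' [v]) (ints s' ''fc'' [u])
                  (filter (\<lambda>c. c \<noteq> r \<and> par c = u) (rev [1..<n]))", OF _ _ _ _ _ _ order_refl]], goal_cases)
      case 1
      then show ?case using 8(1) by auto
    next
      case (2 v s2)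
      have u: "ints s2 ''root'' [] = r" "v \<noteq> r \<longrightarrow> ints s2 ''par'' [v] = par v"
        using s' 8(2) 2 by (auto simp: frame_def)
      have p: "v \<noteq> r \<Longrightarrow> par v \<in> {1..N}" using t 2 by (auto simp: dary_tree_def)
      have up: "[1..<Suc v] = [1..<v] @ [v]" using 2 by simp
      show ?case
      proof (cases "v = r")
        case True
        then show ?thesis using 2 u unfolding up by simp
      next
        case False
        then have "v < r \<or> r < v" by linarith
        with False show ?thesis using 2 u p unfolding up by (auto simp: fold_fun_upd linked_upd)
      qed
    next
      case (5 s2)
      then show ?case using 8(2) s' by (simp add: frame_def)
    next
      case 7
      then show ?case using 8(3) by simp
    qed simp_all
  qed (auto simp: less_Suc_eq)
  then show ?thesis by (rule runs_mono[OF _ T]) (simp add: children_def)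
qed

text \<open>The traversal without a stack: \<open>v\<close> is the current node and \<open>up\<close> tells whether it is being entered or left.
A node is numbered when it is left; \<open>q0\<close> remembers how many nodes had been numbered when it was entered.\<close>

definition dfs_cond :: bexp where "dfs_cond = ILess (IConst 0) (V ''v'')"

definition dfs_body :: prog where
  "dfs_body =
     Cond (ILess (V ''up'') (IConst 1))
       (IWrite ''q0'' [V ''v''] (V ''cnt'') ;;
        Cond (ILess (IConst 0) (IRead ''fc'' [V ''v'']))
          (IWrite ''v'' [] (IRead ''fc'' [V ''v'']))
          (IWrite ''up'' [] (IConst 1)))
       (IWrite ''cnt'' [] (IPlus (V ''cnt'') (IConst 1)) ;;
        IWrite ''ord'' [V ''cnt''] (V ''v'') ;;
        IWrite ''q'' [V ''cnt''] (IRead ''q0'' [V ''v'']) ;;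
        Cond (BAnd (BNot (ILess (V ''v'') (V ''root''))) (BNot (ILess (V ''root'') (V ''v''))))
          (IWrite ''v'' [] (IConst 0))
          (Cond (ILess (IConst 0) (IRead ''sb'' [V ''v'']))
             (IWrite ''v'' [] (IRead ''sb'' [V ''v'']) ;; IWrite ''up'' [] (IConst 0))
             (IWrite ''v'' [] (IRead ''par'' [V ''v'']))))"

definition dfs_prog :: prog where
  "dfs_prog = IWrite ''v'' [] (V ''root'') ;; IWrite ''up'' [] (IConst 0) ;; IWrite ''cnt'' [] (IConst 0) ;;
     While dfs_cond dfs_body"

lemma iw_dfs_prog [simp]: "iw v dfs_prog \<longleftrightarrow> v \<in> {''v'', ''up'', ''cnt'', ''q0'', ''ord'', ''q''}"
  and rw_dfs_prog [simp]: "\<not> rw v dfs_prog"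
  by (auto simp: dfs_prog_def dfs_body_def)

locale dfs =
  fixes D N r :: nat and par :: "nat \<Rightarrow> nat" and FC SB PAR :: "nat list \<Rightarrow> nat"
  assumes tree: "dary_tree D N r par"
    and links: "u \<in> {1..N} \<Longrightarrow> linked (\<lambda>v. SB [v]) (FC [u]) (children N r par u)"
    and PAR: "v \<in> {1..N} \<Longrightarrow> v \<noteq> r \<Longrightarrow> PAR [v] = par v"
begin

abbreviation "ds \<equiv> desc N r par"

definition st :: "memory \<Rightarrow> bool" where
  "st s \<longleftrightarrow> ints s ''fc'' = FC \<and> ints s ''sb'' = SB \<and> ints s ''par'' = PAR \<and> ints s ''root'' [] = r"

definition at_node :: "memory \<Rightarrow> nat \<Rightarrow> nat \<Rightarrow> nat \<Rightarrow> bool" where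
  "at_node s v up c \<longleftrightarrow> st s \<and> ints s ''v'' [] = v \<and> ints s ''up'' [] = up \<and> ints s ''cnt'' [] = c"

text \<open>The numbers in \<open>{c<..c'}\<close> have been given to the nodes in \<open>W\<close>, and the array \<open>q\<close> is correct for them.\<close>

definition numbered :: "memory \<Rightarrow> nat \<Rightarrow> nat \<Rightarrow> nat set \<Rightarrow> bool" where
  "numbered s c c' W \<longleftrightarrow> bij_betw (\<lambda>p. ints s ''ord'' [p]) {c<..c'} W \<and>
     (\<forall>p\<in>{c<..c'}. ints s ''q'' [p] < p \<and>
        ds (ints s ''ord'' [p]) = (\<lambda>p. ints s ''ord'' [p]) ` {ints s ''q'' [p]<..p})"

text \<open>Between \<open>s\<close> and \<open>s'\<close> exactly the nodes of \<open>W\<close> have been numbered, starting after \<open>c\<close>; the entries of \<open>q0\<close> may have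
changed on \<open>U\<close>. The entry for \<open>v\<close> has to survive while the descendants of \<open>v\<close> are processed.\<close>

definition extends :: "memory \<Rightarrow> memory \<Rightarrow> nat \<Rightarrow> nat set \<Rightarrow> nat set \<Rightarrow> bool" where
  "extends s s' c W U \<longleftrightarrow> numbered s' c (c + card W) W \<and>
     (\<forall>p\<le>c. ints s' ''ord'' [p] = ints s ''ord'' [p] \<and> ints s' ''q'' [p] = ints s ''q'' [p]) \<and>
     (\<forall>u. u \<notin> U \<longrightarrow> ints s' ''q0'' [u] = ints s ''q0'' [u])"

lemma numberedI:
  assumes "bij_betw (\<lambda>p. ints s ''ord'' [p]) {c<..c'} W"
    and "\<And>p. p \<in> {c<..c'} \<Longrightarrow> ints s ''q'' [p] < p \<and>
        ds (ints s ''ord'' [p]) = (\<lambda>p. ints s ''ord'' [p]) ` {ints s ''q'' [p]<..p}"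
  shows "numbered s c c' W"
  using assms unfolding numbered_def by blast

lemma numberedD:
  assumes "numbered s c c' W"
  shows "bij_betw (\<lambda>p. ints s ''ord'' [p]) {c<..c'} W"
    and "\<And>p. p \<in> {c<..c'} \<Longrightarrow> ints s ''q'' [p] < p \<and>
        ds (ints s ''ord'' [p]) = (\<lambda>p. ints s ''ord'' [p]) ` {ints s ''q'' [p]<..p}"
  using assms unfolding numbered_def by blast+

lemma extends_trans:
  assumes 1: "extends s s1 c W1 U1" and 2: "extends s1 s2 (c + card W1) W2 U2"
    and fin: "finite W1" "finite W2" "W1 \<inter> W2 = {}"
  shows "extends s s2 c (W1 \<union> W2) (U1 \<union> U2)"
proof -
  define m where "m = c + card W1"
  define e where "e = m + card W2"
  have card: "c + card (W1 \<union> W2) = e" using fin by (simp add: card_Un_disjoint m_def e_def)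
  have m: "c \<le> m" "m \<le> e" by (simp_all add: m_def e_def)
  have n1: "numbered s1 c m W1" and n2: "numbered s2 m e W2"
    using 1 2 by (simp_all only: extends_def m_def e_def)
  have same: "ints s2 ''ord'' [p] = ints s1 ''ord'' [p]" "ints s2 ''q'' [p] = ints s1 ''q'' [p]" if "p \<le> m" for p
    using 2 that unfolding extends_def m_def by blast+
  have "bij_betw (\<lambda>p. ints s2 ''ord'' [p]) {c<..m} W1 \<longleftrightarrow> bij_betw (\<lambda>p. ints s1 ''ord'' [p]) {c<..m} W1"
    by (rule bij_betw_cong) (simp add: same)
  then have "bij_betw (\<lambda>p. ints s2 ''ord'' [p]) ({c<..m} \<union> {m<..e}) (W1 \<union> W2)"
    using numberedD(1)[OF n1] numberedD(1)[OF n2] fin(3) by (blast intro: bij_betw_combine)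
  moreover have "{c<..m} \<union> {m<..e} = {c<..e}" using m by auto
  ultimately have "bij_betw (\<lambda>p. ints s2 ''ord'' [p]) {c<..e} (W1 \<union> W2)" by simp
  then have "numbered s2 c e (W1 \<union> W2)"
  proof (rule numberedI)
    fix p assume p: "p \<in> {c<..e}"
    show "ints s2 ''q'' [p] < p \<and> ds (ints s2 ''ord'' [p]) = (\<lambda>p. ints s2 ''ord'' [p]) ` {ints s2 ''q'' [p]<..p}"
    proof (cases "p \<le> m")
      case True
      have "(\<lambda>p. ints s2 ''ord'' [p]) ` {ints s1 ''q'' [p]<..p} = (\<lambda>p. ints s1 ''ord'' [p]) ` {ints s1 ''q'' [p]<..p}"
        by (rule image_cong) (use same True in auto)
      then show ?thesis using numberedD(2)[OF n1, of p] p True unfolding same[OF True] by simp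
    next
      case False
      then show ?thesis using numberedD(2)[OF n2, of p] p by simp
    qed
  qed
  moreover have "ints s2 ''ord'' [p] = ints s ''ord'' [p] \<and> ints s2 ''q'' [p] = ints s ''q'' [p]" if "p \<le> c" for p
    using same[of p] 1 that m(1) unfolding extends_def by simp
  moreover have "ints s2 ''q0'' [u] = ints s ''q0'' [u]" if "u \<notin> U1 \<union> U2" for u
    using 1 2 that unfolding extends_def by simp
  ultimately show ?thesis unfolding extends_def card by blast
qed

text \<open>An upper bound for the cost of one iteration of the traversal.\<close>

definition K where "K = (100 :: nat)"

lemma finite_ds: "v \<in> {1..N} \<Longrightarrow> finite (ds v)"
  using desc_subset[OF tree] by (metis finite_atLeastAtMost finite_subset)

lemma child:
  assumes "x \<in> set (children N r par v)"
  shows "x \<in> {1..N}" "x \<noteq> r" "par x = v"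
  using assms by (auto simp: children_def)

text \<open>Leaving \<open>x\<close> gives it the next number, which completes the interval of its subtree. The continuation covers the three
places where the traversal can go on: nowhere after the root, to the next sibling, or up to the parent.\<close>

lemma leave_step:
  assumes s: "at_node s x 1 c'" and x: "x \<in> {1..N}" and e: "extends s0 s c (ds x - {x}) (ds x)"
    and c': "c' = c + card (ds x) - 1" and q0: "ints s ''q0'' [x] = c" and B: "K \<le> B"
    and cont: "\<And>s' B'. B \<le> B' + K \<Longrightarrow> extends s0 s' c (ds x) (ds x) \<Longrightarrow>
       (if x = r then at_node s' 0 1 (c + card (ds x))
        else if 0 < SB [x] then at_node s' (SB [x]) 0 (c + card (ds x)) else at_node s' (par x) 1 (c + card (ds x))) \<Longrightarrow>
       wp (While dfs_cond dfs_body) Q s' B'"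
  shows "wp (While dfs_cond dfs_body) Q s B"
proof -
  have pos: "0 < card (ds x)" using finite_ds[OF x] desc_self by (metis card_gt_0_iff empty_iff)
  have c1: "Suc c' = c + card (ds x)" "c' = c + card (ds x - {x})"
    using pos c' finite_ds[OF x] by (auto simp: card_Diff_singleton)
  define s1 where "s1 = iupd ''q'' [Suc c'] c (iupd ''ord'' [Suc c'] x (iupd ''cnt'' [] (Suc c') s))"
  have o: "ints s1 ''ord'' = (ints s ''ord'')([Suc c'] := x)" "ints s1 ''q'' = (ints s ''q'')([Suc c'] := c)"
      "ints s1 ''q0'' = ints s ''q0''"
    by (simp_all add: s1_def)
  have "(\<lambda>p. ints s1 ''ord'' [p]) ` {c<..Suc c'} = ds x"
  proof -
    have "{c<..Suc c'} = insert (Suc c') {c<..c'}" using c1 pos by auto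
    then have "(\<lambda>p. ints s1 ''ord'' [p]) ` {c<..Suc c'} = insert x ((\<lambda>p. ints s1 ''ord'' [p]) ` {c<..c'})"
      by (simp only: image_insert) (simp add: o)
    also have "(\<lambda>p. ints s1 ''ord'' [p]) ` {c<..c'} = (\<lambda>p. ints s ''ord'' [p]) ` {c<..c'}"
      by (rule image_cong) (auto simp: o)
    also have "\<dots> = ds x - {x}"
      using e c1 by (auto simp: extends_def numbered_def bij_betw_def)
    finally show ?thesis by (simp add: insert_absorb)
  qed
  moreover have "{c'<..Suc c'} = {Suc c'}" by auto
  moreover have "c < Suc c'" using c1 pos by simp
  ultimately have "numbered s1 c' (Suc c') {x}" by (simp add: numbered_def o)
  then have "extends s s1 (c + card (ds x - {x})) {x} {}"
    unfolding extends_def c1(2)[symmetric] by (simp add: o)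
  then have "extends s0 s1 c (ds x - {x} \<union> {x}) (ds x \<union> {})"
    by (intro extends_trans[OF e]) (use finite_ds[OF x] in auto)
  moreover have "ds x - {x} \<union> {x} = ds x" by auto
  ultimately have e1: "extends s0 s1 c (ds x) (ds x)" by simp
  have e2: "extends s0 s' c (ds x) (ds x)" if "ints s' ''ord'' = ints s1 ''ord''" "ints s' ''q'' = ints s1 ''q''"
    "ints s' ''q0'' = ints s1 ''q0''" for s'
    using e1 that by (simp add: extends_def numbered_def)
  have st1: "st s1" using s by (auto simp: at_node_def st_def s1_def)
  have x0: "0 < x" using x by simp
  show ?thesis
  proof (rule wp_While, goal_cases)
    case 1 show ?case using B by (simp add: dfs_cond_def K_def)
  next
    case 2
    show ?case
    proof (cases "x = r")
      case True
      have "wp (While dfs_cond dfs_body) Q (iupd ''v'' [] 0 s1) B'" if "B \<le> B' + 60" for B'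
        proof (rule cont, goal_cases)
          case 2 show ?case by (rule e2) simp_all
        qed (use that B True st1 s c1 in \<open>auto simp: K_def at_node_def st_def s1_def\<close>)
      then show ?thesis using s True B q0 unfolding dfs_body_def
        by (auto simp: at_node_def st_def dfs_cond_def K_def s1_def)
    next
      case False
      then have xr: "x < r \<or> r < x" by linarith
      show ?thesis
      proof (cases "0 < SB [x]")
        case True
        have "wp (While dfs_cond dfs_body) Q (iupd ''up'' [] 0 (iupd ''v'' [] (SB [x]) s1)) B'" if "B \<le> B' + 60" for B'
        proof (rule cont, goal_cases)
          case 2 show ?case by (rule e2) simp_all
        qed (use that B True False st1 s c1 in \<open>auto simp: K_def at_node_def st_def s1_def\<close>)
        then show ?thesis using s xr True B q0 unfolding dfs_body_def
          by (auto simp: at_node_def st_def dfs_cond_def K_def s1_def)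
      next
        case sb: False
        have "wp (While dfs_cond dfs_body) Q (iupd ''v'' [] (par x) s1) B'" if "B \<le> B' + 60" for B'
        proof (rule cont, goal_cases)
          case 2 show ?case by (rule e2) simp_all
        qed (use that B sb False st1 s c1 in \<open>auto simp: K_def at_node_def st_def s1_def\<close>)
        then show ?thesis using s xr sb B q0 PAR[OF x False] unfolding dfs_body_def
          by (auto simp: at_node_def st_def dfs_cond_def K_def s1_def)
      qed
    qed
  next
    case 3
    then show ?case using s x0 by (simp add: dfs_cond_def at_node_def)
  qed
qed

text \<open>The specification of visiting the subtree of \<open>x\<close>, in continuation style: to show that the loop achieves \<open>Q\<close> when it
enters \<open>x\<close>, it suffices to show this for the moment when \<open>x\<close> is about to be left. A subtree takes an odd number of
iterations up to this point, two for each of its nodes except for the last one; this is the difference of \<open>K\<close> in the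
credits. In this form a part of the run of a loop can be handled by induction on the tree.\<close>

definition enters :: "(memory \<Rightarrow> nat \<Rightarrow> bool) \<Rightarrow> nat \<Rightarrow> bool" where
  "enters Q x \<longleftrightarrow> (\<forall>s c B. at_node s x 0 c \<longrightarrow> 2 * K * card (ds x) \<le> B \<longrightarrow>
     (\<forall>s' B'. at_node s' x 1 (c + card (ds x) - 1) \<longrightarrow> extends s s' c (ds x - {x}) (ds x) \<longrightarrow>
        ints s' ''q0'' [x] = c \<longrightarrow> B + K \<le> B' + 2 * K * card (ds x) \<longrightarrow> wp (While dfs_cond dfs_body) Q s' B') \<longrightarrow>
     wp (While dfs_cond dfs_body) Q s B)"

lemma linked_suffix: "linked nxt c (ys @ x # xs) \<Longrightarrow> linked nxt x (x # xs)"
  by (induction ys arbitrary: c) auto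

text \<open>If every child of \<open>v\<close> can be visited, the children in the rest \<open>xs\<close> of its list are visited one after the other, which numbers
the union \<open>W\<close> of their subtrees, and then \<open>v\<close> is left.\<close>

lemma dfs_children:
  assumes "xs \<noteq> []" "children N r par v = ys @ xs" "\<And>x. x \<in> set xs \<Longrightarrow> enters Q x" "v \<in> {1..N}"
    and "at_node s (hd xs) 0 c" "W = (\<Union>x\<in>set xs. ds x)" "2 * K * card W \<le> B"
    and "\<And>s' B'. at_node s' v 1 (c + card W) \<Longrightarrow> extends s s' c W W \<Longrightarrow> B \<le> B' + 2 * K * card W \<Longrightarrow>
       wp (While dfs_cond dfs_body) Q s' B'"
  shows "wp (While dfs_cond dfs_body) Q s B"
  using assms
proof (induction xs arbitrary: ys s c W B)
  case (Cons x xs)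
  define W' where "W' = (\<Union>x\<in>set xs. ds x)"
  have x: "x \<in> set (children N r par v)" using Cons.prems(2) by simp
  note xc = child[OF x]
  have sub: "set xs \<subseteq> set (children N r par v)" using Cons.prems(2) by auto
  have fin: "finite (ds x)" "finite W'" using finite_ds[OF xc(1)] sub child(1) finite_ds by (auto simp: W'_def)
  have "x \<notin> set xs" using distinct_children[of N r par v] Cons.prems(2) by auto
  have "ds x \<inter> ds y = {}" if "y \<in> set xs" for y
    by (rule siblings_disjoint[OF tree]) (use that x sub \<open>x \<notin> set xs\<close> set_children in blast)+
  then have disj: "ds x \<inter> W' = {}" by (auto simp: W'_def)
  have W: "W = ds x \<union> W'" using Cons.prems(6) by (simp add: W'_def)
  then have card: "card W = card (ds x) + card W'" using fin disj by (simp add: card_Un_disjoint)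
  have pos: "0 < card (ds x)" using fin desc_self by (metis card_gt_0_iff empty_iff)
  have B: "200 * card (ds x) + 200 * card W' \<le> B" using Cons.prems(7) by (simp add: card K_def)
  have lnk: "linked (\<lambda>v. SB [v]) (SB [x]) xs"
    using links[OF Cons.prems(4)] linked_suffix[of _ _ ys x xs] Cons.prems(2) by simp
  have at0: "at_node s x 0 c" using Cons.prems(5) by simp
  have "enters Q x" using Cons.prems(3) by simp
  then show ?case unfolding enters_def
  proof (elim allE impE)
    show "at_node s x 0 c" by (rule at0)
    show "2 * K * card (ds x) \<le> B" using B by (simp add: K_def)
    show "\<forall>s' B'. at_node s' x 1 (c + card (ds x) - 1) \<longrightarrow> extends s s' c (ds x - {x}) (ds x) \<longrightarrow>
        ints s' ''q0'' [x] = c \<longrightarrow> B + K \<le> B' + 2 * K * card (ds x) \<longrightarrow> wp (While dfs_cond dfs_body) Q s' B'"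
    proof (intro allI impI)
      fix s1 B1
      assume s1: "at_node s1 x 1 (c + card (ds x) - 1)" "extends s s1 c (ds x - {x}) (ds x)"
        "ints s1 ''q0'' [x] = c" "B + K \<le> B1 + 2 * K * card (ds x)"
      have B1: "100 + 200 * card W' \<le> B1" "B + 100 \<le> B1 + 200 * card (ds x)" using s1(4) B by (simp_all add: K_def)
      show "wp (While dfs_cond dfs_body) Q s1 B1"
      proof (rule leave_step[OF s1(1) xc(1) s1(2) refl s1(3)])
        show "K \<le> B1" using B1 by (simp add: K_def)
        fix s2 B2
        assume s2: "B1 \<le> B2 + K" "extends s s2 c (ds x) (ds x)"
          "if x = r then at_node s2 0 1 (c + card (ds x))
           else if 0 < SB [x] then at_node s2 (SB [x]) 0 (c + card (ds x)) else at_node s2 (par x) 1 (c + card (ds x))"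
        have B2: "200 * card W' \<le> B2" "B \<le> B2 + 200 * card (ds x)" using s2(1) B1 by (simp_all add: K_def)
        show "wp (While dfs_cond dfs_body) Q s2 B2"
        proof (cases xs)
          case Nil
          have "W' = {}" using Nil by (simp add: W'_def)
          then have "W = ds x" using W by simp
          moreover have "SB [x] = 0" using lnk Nil by simp
          ultimately show ?thesis
            using Cons.prems(8)[of s2 B2] s2 B2 xc by (simp add: K_def)
        next
          case xs: (Cons y zs)
          then have "0 < y" using child(1)[of y v] sub xs by simp
          moreover have "SB [x] = y" using lnk xs by simp
          ultimately have at2: "at_node s2 (hd xs) 0 (c + card (ds x))" using s2(3) xc xs by simp
          show ?thesis
          proof (rule Cons.IH[OF _ _ _ _ at2 W'_def])
            show "xs \<noteq> []" using xs by simp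
            show "children N r par v = (ys @ [x]) @ xs" using Cons.prems(2) by simp
            show "enters Q z" if "z \<in> set xs" for z using Cons.prems(3) that by simp
            show "v \<in> {1..N}" by (rule Cons.prems(4))
            show "2 * K * card W' \<le> B2" using B2 by (simp add: K_def)
            fix s3 B3
            assume s3: "at_node s3 v 1 (c + card (ds x) + card W')" "extends s2 s3 (c + card (ds x)) W' W'"
              "B2 \<le> B3 + 2 * K * card W'"
            show "wp (While dfs_cond dfs_body) Q s3 B3"
            proof (rule Cons.prems(8))
              show "at_node s3 v 1 (c + card W)" using s3(1) card by (simp add: add.assoc)
              show "extends s s3 c W W" unfolding W by (rule extends_trans[OF s2(2) s3(2) fin disj])
              show "B \<le> B3 + 2 * K * card W" using s3(3) B2 by (simp add: K_def card)
            qed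
          qed
        qed
      qed
    qed
  qed
qed simp

lemma dfs_node: "v \<in> {1..N} \<Longrightarrow> enters Q v"
proof (induction "card (ds v)" arbitrary: v rule: less_induct)
  case less
  define W where "W = (\<Union>x\<in>set (children N r par v). ds x)"
  have dv: "ds v = insert v W" unfolding W_def by (rule desc_unfold)
  have "v \<notin> W" using parent_not_desc[OF tree] by (auto simp: W_def set_children)
  then have W: "W = ds v - {v}" using dv by auto
  have fin: "finite W" using finite_ds[OF less.prems] W by simp
  have card: "card (ds v) = Suc (card W)" using fin dv \<open>v \<notin> W\<close> by simp
  have en: "enters Q x" if "x \<in> set (children N r par v)" for x
  proof (rule less.hyps)
    have "ds x \<subseteq> W" using that by (auto simp: W_def)
    then have "card (ds x) \<le> card W" by (rule card_mono[OF fin])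
    then show "card (ds x) < card (ds v)" using card by simp
    show "x \<in> {1..N}" by (rule child(1)[OF that])
  qed
  show ?case unfolding enters_def
  proof (intro allI impI)
    fix s c B
    assume s: "at_node s v 0 c" and B: "2 * K * card (ds v) \<le> B"
      and cont: "\<forall>s' B'. at_node s' v 1 (c + card (ds v) - 1) \<longrightarrow> extends s s' c (ds v - {v}) (ds v) \<longrightarrow>
        ints s' ''q0'' [v] = c \<longrightarrow> B + K \<le> B' + 2 * K * card (ds v) \<longrightarrow> wp (While dfs_cond dfs_body) Q s' B'"
    have B_ge: "200 + 200 * card W \<le> B" using B by (simp add: K_def card)
    define s0 where "s0 = iupd ''q0'' [v] c s"
    have s0: "ints s0 ''ord'' = ints s ''ord''" "ints s0 ''q'' = ints s ''q''" "ints s0 ''q0'' = (ints s ''q0'')([v] := c)"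
      by (simp_all add: s0_def)
    show "wp (While dfs_cond dfs_body) Q s B"
    proof (rule wp_While, goal_cases)
      case 1 show ?case using B_ge by (simp add: dfs_cond_def)
    next
      case 3
      then show ?case using s less.prems by (simp add: dfs_cond_def at_node_def)
    next
      case 2
      show ?case
      proof (cases "children N r par v")
        case Nil
        then have "W = {}" by (simp add: W_def)
        have "wp (While dfs_cond dfs_body) Q (iupd ''up'' [] 1 s0) B'" if "B \<le> B' + 60" for B'
        proof (rule cont[rule_format])
          show "at_node (iupd ''up'' [] 1 s0) v 1 (c + card (ds v) - 1)"
            using s \<open>W = {}\<close> card by (simp add: at_node_def st_def s0_def)
          show "extends s (iupd ''up'' [] 1 s0) c (ds v - {v}) (ds v)"
            using desc_self[of v] unfolding W[symmetric] \<open>W = {}\<close> extends_def numbered_def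
            by (auto simp: s0 bij_betw_def)
          show "ints (iupd ''up'' [] 1 s0) ''q0'' [v] = c" by (simp add: s0)
          show "B + K \<le> B' + 2 * K * card (ds v)" using B_ge that by (simp add: K_def card)
        qed
        then show ?thesis using s links[OF less.prems] Nil B_ge unfolding dfs_body_def
          by (auto simp: at_node_def st_def dfs_cond_def s0_def)
      next
        case (Cons x xs)
        have x: "x = FC [v]" "0 < x" using links[OF less.prems] Cons child(1)[of x v] by auto
        have at1: "at_node (iupd ''v'' [] x s0) (hd (children N r par v)) 0 c"
          using s Cons by (simp add: at_node_def st_def s0_def)
        have "wp (While dfs_cond dfs_body) Q (iupd ''v'' [] x s0) B'" if "B \<le> B' + 60" for B'
        proof (rule dfs_children[OF _ _ en less.prems at1 W_def])
          show "children N r par v \<noteq> []" using Cons by simp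
          show "children N r par v = [] @ children N r par v" by simp
          show "2 * K * card W \<le> B'" using B_ge that by (simp add: K_def)
          fix s' B''
          assume s': "at_node s' v 1 (c + card W)" "extends (iupd ''v'' [] x s0) s' c W W" "B' \<le> B'' + 2 * K * card W"
          show "wp (While dfs_cond dfs_body) Q s' B''"
          proof (rule cont[rule_format])
            show "at_node s' v 1 (c + card (ds v) - 1)" using s'(1) card by simp
            show "extends s s' c (ds v - {v}) (ds v)"
            proof -
              have "v \<in> ds v" by simp
              then have "\<forall>u. u \<notin> ds v \<longrightarrow> ints s' ''q0'' [u] = ints s ''q0'' [u]"
                using s'(2) W by (auto simp: extends_def s0)
              then show ?thesis using s'(2) unfolding W[symmetric] extends_def by (simp add: s0)
            qed
            show "ints s' ''q0'' [v] = c" using s'(2) \<open>v \<notin> W\<close> by (simp add: extends_def s0)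
            show "B + K \<le> B'' + 2 * K * card (ds v)" using s'(3) that by (simp add: K_def card)
          qed
        qed
        then show ?thesis using s x B_ge unfolding dfs_body_def
          by (auto simp: at_node_def st_def dfs_cond_def s0_def)
      qed
    qed
  qed
qed

end

definition postorder :: "nat \<Rightarrow> nat \<Rightarrow> (nat \<Rightarrow> nat) \<Rightarrow> (nat \<Rightarrow> nat) \<Rightarrow> (nat \<Rightarrow> nat) \<Rightarrow> bool" where
  "postorder N r par vert q \<longleftrightarrow> bij_betw vert {1..N} {1..N} \<and>
     (\<forall>p\<in>{1..N}. q p < p \<and> desc N r par (vert p) = vert ` {q p<..p})"

lemma dfs_prog:
  assumes t: "dary_tree D N r par" and s: "holds_tree s N r par k"
    and l: "\<forall>u\<in>{1..N}. linked (\<lambda>v. ints s ''sb'' [v]) (ints s ''fc'' [u]) (children N r par u)"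
    and T: "N * 200 + 20 \<le> T"
  shows "runs dfs_prog s T (\<lambda>s'. postorder N r par (\<lambda>p. ints s' ''ord'' [p]) (\<lambda>p. ints s' ''q'' [p]))"
proof -
  interpret dfs D N r par "ints s ''fc''" "ints s ''sb''" "ints s ''par''"
    by unfold_locales (use t l s in \<open>auto simp: holds_tree_def\<close>)
  define Q where "Q = (\<lambda>(s' :: memory) (B :: nat). postorder N r par (\<lambda>p. ints s' ''ord'' [p]) (\<lambda>p. ints s' ''q'' [p]))"
  have r: "r \<in> {1..N}" using t by (simp add: dary_tree_def)
  have ds: "ds r = {1..N}" by (rule desc_root[OF t])
  define s0 where "s0 = iupd ''cnt'' [] 0 (iupd ''up'' [] 0 (iupd ''v'' [] r s))"
  have "enters Q r" by (rule dfs_node[OF r])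
  then have "wp (While dfs_cond dfs_body) Q s0 (200 * N + 10)"
    unfolding enters_def
  proof (elim allE impE)
    show "at_node s0 r 0 0" using s by (simp add: at_node_def st_def s0_def holds_tree_def)
    show "2 * K * card (ds r) \<le> 200 * N + 10" by (simp add: ds K_def)
    show "\<forall>s' B'. at_node s' r 1 (0 + card (ds r) - 1) \<longrightarrow> extends s0 s' 0 (ds r - {r}) (ds r) \<longrightarrow>
        ints s' ''q0'' [r] = 0 \<longrightarrow> 200 * N + 10 + K \<le> B' + 2 * K * card (ds r) \<longrightarrow> wp (While dfs_cond dfs_body) Q s' B'"
    proof (intro allI impI)
      fix s1 B1
      assume s1: "at_node s1 r 1 (0 + card (ds r) - 1)" "extends s0 s1 0 (ds r - {r}) (ds r)"
        "ints s1 ''q0'' [r] = 0" "200 * N + 10 + K \<le> B1 + 2 * K * card (ds r)"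
      have B1: "110 \<le> B1" using s1(4) by (simp add: K_def ds)
      show "wp (While dfs_cond dfs_body) Q s1 B1"
      proof (rule leave_step[OF s1(1) r s1(2) refl s1(3)])
        show "K \<le> B1" using B1 by (simp add: K_def)
        fix s2 B2
        assume s2: "B1 \<le> B2 + K" "extends s0 s2 0 (ds r) (ds r)"
          "if r = r then at_node s2 0 1 (0 + card (ds r))
           else if 0 < ints s ''sb'' [r] then at_node s2 (ints s ''sb'' [r]) 0 (0 + card (ds r)) else at_node s2 (par r) 1 (0 + card (ds r))"
        have "numbered s2 0 N {1..N}" using s2(2) by (simp add: extends_def ds)
        moreover have "{0<..N} = {1..N}" by auto
        ultimately have "Q s2 B'" for B' by (simp add: Q_def postorder_def numbered_def)
        moreover have "10 \<le> B2" using s2(1) B1 by (simp add: K_def)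
        moreover have "ints s2 ''v'' [] = 0" using s2(3) by (simp add: at_node_def)
        ultimately show "wp (While dfs_cond dfs_body) Q s2 B2"
          by (intro wp_While) (simp_all add: dfs_cond_def)
      qed
    qed
  qed
  then have "runs dfs_prog s (200 * N + 20) (\<lambda>s'. postorder N r par (\<lambda>p. ints s' ''ord'' [p]) (\<lambda>p. ints s' ''q'' [p]))"
    using s unfolding dfs_prog_def wp_Seq wp_IWrite s0_def Q_def
    by (auto simp: holds_tree_def elim!: wp_mono)
  then show ?thesis by (rule runs_mono) (use T in auto)
qed

section \<open>The tree projection\<close>

lemma postorder_mem:
  assumes "postorder N r par vert q" "p \<in> {1..N}" "a \<in> {1..N}"
  shows "vert a \<in> desc N r par (vert p) \<longleftrightarrow> q p < a \<and> a \<le> p"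
proof -
  have "inj_on vert {1..N}" using assms(1) by (simp add: postorder_def bij_betw_def)
  moreover have "{q p<..p} \<subseteq> {1..N}" using assms(2) by auto
  ultimately have "vert a \<in> vert ` {q p<..p} \<longleftrightarrow> a \<in> {q p<..p}"
    using assms(3) by (simp add: inj_on_image_mem_iff)
  moreover have "desc N r par (vert p) = vert ` {q p<..p}" using assms by (simp add: postorder_def)
  ultimately show ?thesis by simp
qed

lemma postorder_nested:
  assumes p: "postorder N r par vert q"
  shows "nested N q"
  unfolding nested_def
proof (intro ballI conjI allI impI)
  fix a assume a: "a \<in> {1..N}"
  then show "q a < a" using p by (simp add: postorder_def)
  fix a' assume a': "q a < a' \<and> a' \<le> a"
  then have N: "a' \<in> {1..N}" using a by auto
  then have "q a' < a'" using p by (simp add: postorder_def)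
  then have S: "Suc (q a') \<in> {1..N}" "vert (Suc (q a')) \<in> desc N r par (vert a')"
    using postorder_mem[OF p N, of "Suc (q a')"] N by auto
  have "vert a' \<in> desc N r par (vert a)" using postorder_mem[OF p a N] a' by simp
  with S(2) have "vert (Suc (q a')) \<in> desc N r par (vert a)" by (auto simp: desc_def)
  with postorder_mem[OF p a S(1)] show "q a \<le> q a'" by simp
qed

lemma tree_model_feasible:
  assumes p: "postorder N r par vert q" and K: "K \<in> tree_model N r par k"
  shows "feasible q N k {a \<in> {1..N}. vert a \<in> K}" "vert ` {a \<in> {1..N}. vert a \<in> K} = K"
proof -
  note K' = K[unfolded tree_model_def]
  have b: "inj_on vert {1..N}" "vert ` {1..N} = {1..N}" using p by (simp_all add: postorder_def bij_betw_def)
  have "K \<subseteq> vert ` {1..N}" using K' unfolding b(2) by simp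
  then show im: "vert ` {a \<in> {1..N}. vert a \<in> K} = K" by blast
  have "card (vert ` {a \<in> {1..N}. vert a \<in> K}) = card {a \<in> {1..N}. vert a \<in> K}"
    by (rule card_image) (rule inj_on_subset[OF b(1)], auto)
  then have "card {a \<in> {1..N}. vert a \<in> K} \<le> k" using K' unfolding im by simp
  moreover have "vert p' \<in> K" if "vert a \<in> K" "a \<in> {1..N}" "p' \<in> {1..N}" "q p' < a" "a \<le> p'" for a p'
  proof -
    have "vert a \<in> desc N r par (vert p')" using postorder_mem[OF p that(3,2)] that by simp
    then have "vert a = vert p' \<or> (vert p', vert a) \<in> (parent_rel N r par)\<^sup>+"
      by (auto simp: desc_def rtrancl_eq_or_trancl)
    then show ?thesis using K' that(1) by auto
  qed
  ultimately show "feasible q N k {a \<in> {1..N}. vert a \<in> K}" by (auto simp: feasible_def)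
qed

text \<open>A nonempty closed set contains the root. The empty set is not a member of the tree model itself, but it is contained in
the one that consists of the root, which is available because \<open>1 \<le> k\<close>.\<close>

lemma feasible_tree_model:
  assumes t: "dary_tree D N r par" and p: "postorder N r par vert q" and X: "feasible q N k X" "1 \<le> k"
  shows "\<exists>K\<in>tree_model N r par k. vert ` X \<subseteq> K"
proof (cases "X = {}")
  case True
  have "(u, r) \<notin> (parent_rel N r par)\<^sup>+" for u by (auto simp: parent_rel_def elim: tranclE)
  then have "{r} \<in> tree_model N r par k" using t X(2) by (auto simp: tree_model_def dary_tree_def)
  with True show ?thesis by auto
next
  case False
  have b: "inj_on vert {1..N}" "vert ` {1..N} = {1..N}" using p by (simp_all add: postorder_def bij_betw_def)
  have XN: "X \<subseteq> {1..N}" "card X \<le> k" using X by (auto simp: feasible_def)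
  have closed: "u \<in> vert ` X" if uv: "v \<in> vert ` X" "v \<in> desc N r par u" "u \<in> {1..N}" for u v
  proof -
    obtain a p' where a: "a \<in> X" "v = vert a" and p': "p' \<in> {1..N}" "u = vert p'"
      using uv(1,3) b(2) by (metis imageE)
    then have "q p' < a \<and> a \<le> p'" using postorder_mem[OF p p'(1), of a] uv(2) XN by auto
    then show ?thesis using X(1) a(1) p' unfolding feasible_def by blast
  qed
  have "vert ` X \<subseteq> {1..N}" using XN b(2) by auto
  moreover have "card (vert ` X) \<le> k" using XN b(1) by (metis card_image inj_on_subset)
  moreover have "r \<in> vert ` X"
  proof -
    obtain v where v: "v \<in> vert ` X" using False by auto
    then have "v \<in> desc N r par r" using desc_root[OF t] \<open>vert ` X \<subseteq> {1..N}\<close> by auto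
    then show ?thesis using closed[OF v] t by (auto simp: dary_tree_def)
  qed
  moreover have "u \<in> vert ` X" if uv: "v \<in> vert ` X" "(u, v) \<in> (parent_rel N r par)\<^sup>+" for u v
  proof (rule closed[OF uv(1)])
    show "v \<in> desc N r par u" using uv(2) by (auto simp: desc_def)
    obtain w where "(u, w) \<in> parent_rel N r par" using uv(2) by (meson tranclD)
    then show "u \<in> {1..N}" using t by (auto simp: parent_rel_def dary_tree_def)
  qed
  ultimately have "vert ` X \<in> tree_model N r par k" by (auto simp: tree_model_def)
  then show ?thesis by blast
qed

definition table_cell_prog :: prog where
  "table_cell_prog =
     Cond (RLess (RRead ''b'' [IRead ''ord'' [V ''p'']]) (RConst 0))
       (RWrite ''F'' [V ''p'', V ''j''] (RMinus (RRead ''F'' [IMinus (V ''p'') (IConst 1), IMinus (V ''j'') (IConst 1)])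
          (RRead ''b'' [IRead ''ord'' [V ''p'']])))
       (RWrite ''F'' [V ''p'', V ''j''] (RPlus (RRead ''F'' [IMinus (V ''p'') (IConst 1), IMinus (V ''j'') (IConst 1)])
          (RRead ''b'' [IRead ''ord'' [V ''p'']]))) ;;
     Cond (RLess (RRead ''F'' [V ''p'', V ''j'']) (RRead ''F'' [IRead ''q'' [V ''p''], V ''j'']))
       (RWrite ''F'' [V ''p'', V ''j''] (RRead ''F'' [IRead ''q'' [V ''p''], V ''j'']) ;;
        IWrite ''T'' [V ''p'', V ''j''] (IConst 0))
       (IWrite ''T'' [V ''p'', V ''j''] (IConst 1))"

definition table_prog :: prog where
  "table_prog =
     For ''j'' (IConst 0) (IPlus (V ''k'') (IConst 1)) (RWrite ''F'' [IConst 0, V ''j''] (RConst 0)) ;;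
     For ''p'' (IConst 1) (IPlus (V ''N'') (IConst 1))
       (RWrite ''F'' [V ''p'', IConst 0] (RConst 0) ;;
        For ''j'' (IConst 1) (IPlus (V ''k'') (IConst 1)) table_cell_prog)"

lemma iw_table_cell_prog [simp]: "iw v table_cell_prog \<longleftrightarrow> v = ''T''"
  and rw_table_cell_prog [simp]: "rw v table_cell_prog \<longleftrightarrow> v = ''F''"
  by (auto simp: table_cell_prog_def)

lemma iw_table_prog [simp]: "iw v table_prog \<longleftrightarrow> v \<in> {''p'', ''j'', ''T''}"
  and rw_table_prog [simp]: "rw v table_prog \<longleftrightarrow> v = ''F''"
  by (auto simp: table_prog_def)

lemma table_cell_prog:
  assumes "ints s ''p'' [] = p" "ints s ''j'' [] = j" "q < p" "ints s ''q'' [p] = q" "ints s ''ord'' [p] = v"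
    "reals s ''b'' [v] = b"
  shows "runs table_cell_prog s 80 (\<lambda>s'. \<exists>f t. reals s' ''F'' = (reals s ''F'')([p, j] := f) \<and> ints s' ''T'' = (ints s ''T'')([p, j] := t) \<and>
     (if 0 < t then f = reals s ''F'' [p - 1, j - 1] + \<bar>b\<bar> \<and> reals s ''F'' [q, j] \<le> f
      else f = reals s ''F'' [q, j] \<and> reals s ''F'' [p - 1, j - 1] + \<bar>b\<bar> \<le> f))"
proof -
  have "runs table_cell_prog s 80 (\<lambda>s'. \<exists>f t. f = reals s' ''F'' [p, j] \<and> t = ints s' ''T'' [p, j] \<and>
     reals s' ''F'' = (reals s ''F'')([p, j] := f) \<and> ints s' ''T'' = (ints s ''T'')([p, j] := t) \<and>
     (if 0 < t then f = reals s ''F'' [p - 1, j - 1] + \<bar>b\<bar> \<and> reals s ''F'' [q, j] \<le> f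
      else f = reals s ''F'' [q, j] \<and> reals s ''F'' [p - 1, j - 1] + \<bar>b\<bar> \<le> f))"
    using assms unfolding table_cell_prog_def by auto
  then show ?thesis by (rule runs_mono[OF _ order_refl]) blast
qed

lemma table_prog:
  assumes N: "ints s ''N'' [] = N" and k: "ints s ''k'' [] = k" and q: "q = (\<lambda>p. ints s ''q'' [p])" "nested N q"
    and w: "\<And>p. w p = \<bar>reals s ''b'' [ints s ''ord'' [p]]\<bar>" and T: "200 * (N + 1) * (k + 1) \<le> T"
  shows "runs table_prog s T (\<lambda>s'. knapsack_table N k q w (\<lambda>p j. reals s' ''F'' [p, j]) (\<lambda>p j. ints s' ''T'' [p, j]))"
proof -
  let ?row = "For ''j'' (IConst 1) (IPlus (V ''k'') (IConst 1)) table_cell_prog"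
  have qless: "q p < p" if "1 \<le> p" "p < N + 1" for p using q(2) that by (simp add: nested_def)
  define entry where "entry = (\<lambda>F (G :: nat \<Rightarrow> nat \<Rightarrow> real) (T :: nat \<Rightarrow> nat \<Rightarrow> nat) p j.
     if 0 < T p j then G p j = F (p - 1) (j - 1) + w p \<and> F (q p) j \<le> G p j
     else G p j = F (q p) j \<and> F (p - 1) (j - 1) + w p \<le> G p j)"
  define rows where "rows = (\<lambda>n (s' :: memory). (\<forall>j<k+1. reals s' ''F'' [0, j] = 0) \<and>
     (\<forall>p\<in>{1..<n}. reals s' ''F'' [p, 0] = 0 \<and> (\<forall>j\<in>{1..<k+1}. entry (\<lambda>p j. reals s' ''F'' [p, j])
        (\<lambda>p j. reals s' ''F'' [p, j]) (\<lambda>p j. ints s' ''T'' [p, j]) p j)))"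
  have "runs table_prog s (k * 20 + N * (k * 100 + 60) + 60) (rows (N + 1))"
    unfolding table_prog_def wp_Seq
  proof (rule wp_runs[OF runs_For[where lo = 0 and hi = "k + 1" and K = 5 and
          I = "\<lambda>n s'. \<forall>j<n. reals s' ''F'' [0, j] = 0", OF _ _ _ _ _ _ order_refl]], goal_cases)
    case (5 s')
    then show ?case using k by (simp add: frame_def)
  next
    case (8 s1 B1)
    show ?case
    proof (rule runs_mono[OF runs_For[where lo = 1 and hi = "N + 1" and K = "k * 90 + 30" and I = rows, OF _ _ _ _ _ _ order_refl]], goal_cases)
      case 1
      show ?case using 8(1) by (simp add: rows_def)
    next
      case (2 p s2)
      define s2' where "s2' = rupd ''F'' [p, 0] 0 s2"
      have u: "ints s2' ''k'' [] = k" "ints s2' ''p'' [] = p" "\<And>p. ints s2' ''q'' [p] = q p"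
        "\<And>p. w p = \<bar>reals s2' ''b'' [ints s2' ''ord'' [p]]\<bar>"
        using 2 8(2) k q(1) w by (simp_all add: frame_def s2'_def)
      define J where "J = (\<lambda>n (s3 :: memory). (\<forall>p' j. p' \<noteq> p \<longrightarrow> reals s3 ''F'' [p', j] = reals s2 ''F'' [p', j] \<and>
              ints s3 ''T'' [p', j] = ints s2 ''T'' [p', j]) \<and> reals s3 ''F'' [p, 0] = 0 \<and>
              (\<forall>j\<in>{1..<n}. entry (\<lambda>p j. reals s2 ''F'' [p, j]) (\<lambda>p j. reals s3 ''F'' [p, j]) (\<lambda>p j. ints s3 ''T'' [p, j]) p j))"
      have "runs (?row) s2' (k * 90 + 20) (J (k + 1))"
      proof (rule runs_For[where lo = 1 and hi = "k + 1" and K = 80], goal_cases)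
        case 1
        show ?case by (simp add: J_def s2'_def)
      next
        case (2 j s3)
        have "runs table_cell_prog s3 80 (\<lambda>s'. \<exists>f t. reals s' ''F'' = (reals s3 ''F'')([p, j] := f) \<and>
            ints s' ''T'' = (ints s3 ''T'')([p, j] := t) \<and>
            (if 0 < t then f = reals s3 ''F'' [p - 1, j - 1] + \<bar>reals s3 ''b'' [ints s3 ''ord'' [p]]\<bar> \<and> reals s3 ''F'' [q p, j] \<le> f
             else f = reals s3 ''F'' [q p, j] \<and> reals s3 ''F'' [p - 1, j - 1] + \<bar>reals s3 ''b'' [ints s3 ''ord'' [p]]\<bar> \<le> f))"
        proof (rule table_cell_prog)
          show "ints s3 ''p'' [] = p" using 2(5) u by (simp add: frame_def)
          show "ints s3 ''q'' [p] = q p" using 2(5) u by (simp add: frame_def)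
          show "q p < p" by (rule qless) fact+
        qed (use 2 in auto)
        then show ?case
        proof (rule runs_mono[OF _ order_refl], elim exE conjE)
          fix s4 :: memory and f t
          assume a: "reals s4 ''F'' = (reals s3 ''F'')([p, j] := f)" "ints s4 ''T'' = (ints s3 ''T'')([p, j] := t)"
            "if 0 < t then f = reals s3 ''F'' [p - 1, j - 1] + \<bar>reals s3 ''b'' [ints s3 ''ord'' [p]]\<bar> \<and> reals s3 ''F'' [q p, j] \<le> f
             else f = reals s3 ''F'' [q p, j] \<and> reals s3 ''F'' [p - 1, j - 1] + \<bar>reals s3 ''b'' [ints s3 ''ord'' [p]]\<bar> \<le> f"
          have w': "\<bar>reals s3 ''b'' [ints s3 ''ord'' [p]]\<bar> = w p" using 2(5) u by (simp add: frame_def)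
          have J: "reals s3 ''F'' [p', j'] = reals s2 ''F'' [p', j']" "ints s3 ''T'' [p', j'] = ints s2 ''T'' [p', j']"
            if "p' \<noteq> p" for p' j' using 2(3) that by (simp_all add: J_def)
          have qp: "q p \<noteq> p" "p - 1 \<noteq> p" using qless[of p] \<open>1 \<le> p\<close> \<open>p < N + 1\<close> by auto
          have old: "entry (\<lambda>p j. reals s2 ''F'' [p, j]) (\<lambda>p j. reals s4 ''F'' [p, j]) (\<lambda>p j. ints s4 ''T'' [p, j]) p j'"
            if "j' \<in> {1..<j}" for j'
          proof -
            have "entry (\<lambda>p j. reals s2 ''F'' [p, j]) (\<lambda>p j. reals s3 ''F'' [p, j]) (\<lambda>p j. ints s3 ''T'' [p, j]) p j'"
              using 2(3) that by (simp add: J_def)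
            moreover have "j' \<noteq> j" using that by simp
            ultimately show ?thesis unfolding entry_def a(1,2) by (auto split: if_splits)
          qed
          have "entry (\<lambda>p j. reals s2 ''F'' [p, j]) (\<lambda>p j. reals s4 ''F'' [p, j]) (\<lambda>p j. ints s4 ''T'' [p, j]) p j"
            using a(3) unfolding w' J(1)[OF qp(1)] J(1)[OF qp(2)] by (auto simp: entry_def a(1,2) split: if_splits)
          with old have "\<forall>j'\<in>{1..<Suc j}. entry (\<lambda>p j. reals s2 ''F'' [p, j]) (\<lambda>p j. reals s4 ''F'' [p, j]) (\<lambda>p j. ints s4 ''T'' [p, j]) p j'"
            by (auto simp: less_Suc_eq)
          moreover have "reals s4 ''F'' [p, 0] = 0" using 2(1,3) by (simp add: a(1) J_def)
          ultimately show "J (Suc j) (iupd ''j'' [] (Suc j) s4)" using J by (simp add: J_def a(1,2))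
        qed
      next
        case (5 s3)
        then show ?case using u by (simp add: frame_def)
      qed simp_all
      then have "runs (?row) s2' (k * 90 + 20) (\<lambda>s3. rows (Suc p) (iupd ''p'' [] (Suc p) s3))"
      proof (rule runs_mono[OF _ order_refl])
        fix s3 assume J: "J (k + 1) s3"
        have same: "reals s3 ''F'' [p', j] = reals s2 ''F'' [p', j]" "ints s3 ''T'' [p', j] = ints s2 ''T'' [p', j]" if "p' \<noteq> p" for p' j
          using J that by (simp_all add: J_def)
        have "entry (\<lambda>p j. reals s3 ''F'' [p, j]) (\<lambda>p j. reals s3 ''F'' [p, j]) (\<lambda>p j. ints s3 ''T'' [p, j]) p' j \<and> reals s3 ''F'' [p', 0] = 0"
          if "p' \<in> {1..<Suc p}" "j \<in> {1..<k+1}" for p' j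
        proof (cases "p' = p")
          case True
          have qp: "q p \<noteq> p" "p - 1 \<noteq> p" using qless[of p] \<open>1 \<le> p\<close> \<open>p < N + 1\<close> by auto
          have "entry (\<lambda>p j. reals s2 ''F'' [p, j]) (\<lambda>p j. reals s3 ''F'' [p, j]) (\<lambda>p j. ints s3 ''T'' [p, j]) p j"
            using J that(2) by (simp add: J_def)
          then have "entry (\<lambda>p j. reals s3 ''F'' [p, j]) (\<lambda>p j. reals s3 ''F'' [p, j]) (\<lambda>p j. ints s3 ''T'' [p, j]) p j"
            unfolding entry_def same(1)[OF qp(1)] same(1)[OF qp(2)] .
          moreover have "reals s3 ''F'' [p, 0] = 0" using J by (simp add: J_def)
          ultimately show ?thesis using True by simp
        next
          case False
          have "q p' < p'" by (rule qless) (use that \<open>p < N + 1\<close> in auto)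
          then have qp: "q p' \<noteq> p" "p' - 1 \<noteq> p" using that by auto
          have "reals s2 ''F'' [p', 0] = 0 \<and> entry (\<lambda>p j. reals s2 ''F'' [p, j]) (\<lambda>p j. reals s2 ''F'' [p, j]) (\<lambda>p j. ints s2 ''T'' [p, j]) p' j"
            using 2(3) that False by (simp add: rows_def)
          then show ?thesis
            unfolding entry_def same(1)[OF qp(1)] same(1)[OF qp(2)] same[OF False] by (rule conj_commute[THEN iffD1])
        qed
        moreover have "reals s3 ''F'' [p', 0] = 0" if "p' \<in> {1..<Suc p}" for p'
          using J 2(3) that by (cases "p' = p") (auto simp: J_def rows_def)
        moreover have "\<forall>j<k+1. reals s3 ''F'' [0, j] = 0" using 2(1,3) by (simp add: rows_def same)
        ultimately show "rows (Suc p) (iupd ''p'' [] (Suc p) s3)" by (simp add: rows_def)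
      qed
      then show ?case using 2 by (auto simp: s2'_def elim: wp_mono)
    next
      case (5 s2)
      then show ?case using N 8(2) by (simp add: frame_def)
    next
      case 7
      show ?case using 8(3) by (simp add: algebra_simps)
    next
      case (8 s')
      then show ?case by simp
    qed simp_all
  qed (auto simp: less_Suc_eq)
  then show ?thesis
  proof (rule runs_mono)
    show "k * 20 + N * (k * 100 + 60) + 60 \<le> T" using T by (simp add: algebra_simps)
    fix s' assume "rows (N + 1) s'"
    moreover have "{1..<N + 1} = {1..N}" "{1..<k + 1} = {1..k}" "\<And>j. j < k + 1 \<longleftrightarrow> j \<le> k" by auto
    ultimately show "knapsack_table N k q w (\<lambda>p j. reals s' ''F'' [p, j]) (\<lambda>p j. ints s' ''T'' [p, j])"
      unfolding rows_def knapsack_table_def entry_def by (simp only: )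
  qed
qed

definition walk_prog :: prog where
  "walk_prog =
     For ''v'' (IConst 1) (IPlus (V ''N'') (IConst 1)) (RWrite ''x'' [V ''v''] (RConst 0)) ;;
     IWrite ''p'' [] (V ''N'') ;; IWrite ''j'' [] (V ''k'') ;;
     While (BAnd (ILess (IConst 0) (V ''p'')) (ILess (IConst 0) (V ''j'')))
       (Cond (ILess (IConst 0) (IRead ''T'' [V ''p'', V ''j'']))
         (RWrite ''x'' [IRead ''ord'' [V ''p'']] (RRead ''b'' [IRead ''ord'' [V ''p'']]) ;;
          IWrite ''p'' [] (IMinus (V ''p'') (IConst 1)) ;; IWrite ''j'' [] (IMinus (V ''j'') (IConst 1)))
         (IWrite ''p'' [] (IRead ''q'' [V ''p''])))"

lemma iw_walk_prog [simp]: "iw v walk_prog \<longleftrightarrow> v \<in> {''v'', ''p'', ''j''}"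
  and rw_walk_prog [simp]: "rw v walk_prog \<longleftrightarrow> v = ''x''"
  by (auto simp: walk_prog_def)

text \<open>Reading off an optimal support: every feasible set for the current entry completes the numbers taken so far to a
feasible set for the original entry.\<close>

lemma walk_prog:
  assumes N: "ints s ''N'' [] = N" and k: "ints s ''k'' [] = k"
    and q: "q = (\<lambda>p. ints s ''q'' [p])" "nested N q"
    and vert: "vert = (\<lambda>p. ints s ''ord'' [p])" "inj_on vert {1..N}"
    and F: "knapsack_table N k q w F (\<lambda>p j. ints s ''T'' [p, j])"
    and b: "b = (\<lambda>i. reals s ''b'' [i])" and T: "100 * N + 40 \<le> T"
  shows "runs walk_prog s T (\<lambda>s'. \<exists>X. feasible q N k X \<and> sum w X = F N k \<and>
     (\<forall>i\<in>{1..N}. reals s' ''x'' [i] = (if i \<in> vert ` X then b i else 0)))"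
proof -
  let ?step = "Cond (ILess (IConst 0) (IRead ''T'' [V ''p'', V ''j'']))
         (RWrite ''x'' [IRead ''ord'' [V ''p'']] (RRead ''b'' [IRead ''ord'' [V ''p'']]) ;;
          IWrite ''p'' [] (IMinus (V ''p'') (IConst 1)) ;; IWrite ''j'' [] (IMinus (V ''j'') (IConst 1)))
         (IWrite ''p'' [] (IRead ''q'' [V ''p'']))"
  define J where "J = (\<lambda>(s' :: memory) B. \<exists>p j X. ints s' ''p'' [] = p \<and> ints s' ''j'' [] = j \<and> p \<le> N \<and> j \<le> k \<and>
     X \<subseteq> {p<..N} \<and> (\<forall>i\<in>{1..N}. reals s' ''x'' [i] = (if i \<in> vert ` X then b i else 0)) \<and>
     (\<forall>K. feasible q p j K \<longrightarrow> feasible q N k (X \<union> K)) \<and> sum w X + F p j = F N k \<and> 60 * p + 10 \<le> B)"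
  have "runs walk_prog s (100 * N + 40) (\<lambda>s'. \<exists>X. feasible q N k X \<and> sum w X = F N k \<and>
     (\<forall>i\<in>{1..N}. reals s' ''x'' [i] = (if i \<in> vert ` X then b i else 0)))"
    unfolding walk_prog_def wp_Seq
  proof (rule wp_runs[OF runs_For[where lo = 1 and hi = "N + 1" and K = 4 and
          I = "\<lambda>n s'. \<forall>i\<in>{1..<n}. reals s' ''x'' [i] = 0", OF _ _ _ _ _ _ order_refl]], goal_cases)
    case (5 s')
    then show ?case using N by (simp add: frame_def)
  next
    case (8 s1 B1)
    have u1: "ints s1 ''N'' [] = N" "ints s1 ''k'' [] = k" using 8(2) N k by (simp_all add: frame_def)
    define s2 where "s2 = iupd ''j'' [] k (iupd ''p'' [] N s1)"
    have "wp (While (BAnd (ILess (IConst 0) (V ''p'')) (ILess (IConst 0) (V ''j'')))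
       (?step))
      (\<lambda>s' B. \<exists>X. feasible q N k X \<and> sum w X = F N k \<and>
     (\<forall>i\<in>{1..N}. reals s' ''x'' [i] = (if i \<in> vert ` X then b i else 0))) s2 B2" if "B1 \<le> B2 + 4" for B2
    proof (rule wp_While_invariant[where I = J])
      show "J s2 B2" unfolding J_def
        by (intro exI[of _ N] exI[of _ k] exI[of _ "{}"]) (use 8(1,3) that in \<open>auto simp: s2_def\<close>)
      fix s3 B3
      assume J3: "J s3 B3" and f: "frame (?step) s2 s3"
      have u3: "\<And>p. ints s3 ''q'' [p] = q p" "\<And>p. ints s3 ''ord'' [p] = vert p" "\<And>i. reals s3 ''b'' [i] = b i"
        "ints s3 ''T'' = ints s ''T''"
        using f 8(2) by (simp_all add: frame_def s2_def q(1) vert(1) b)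
      obtain p j X where J: "ints s3 ''p'' [] = p" "ints s3 ''j'' [] = j" "p \<le> N" "j \<le> k"
        "X \<subseteq> {p<..N}" "\<forall>i\<in>{1..N}. reals s3 ''x'' [i] = (if i \<in> vert ` X then b i else 0)"
        "\<And>K. feasible q p j K \<Longrightarrow> feasible q N k (X \<union> K)" "sum w X + F p j = F N k" "60 * p + 10 \<le> B3"
        using J3 unfolding J_def by blast
      show "1 + bcost (BAnd (ILess (IConst 0) (V ''p'')) (ILess (IConst 0) (V ''j''))) \<le> B3 \<and>
         (if bval s3 (BAnd (ILess (IConst 0) (V ''p'')) (ILess (IConst 0) (V ''j'')))
          then wp (?step) J s3
             (B3 - (1 + bcost (BAnd (ILess (IConst 0) (V ''p'')) (ILess (IConst 0) (V ''j'')))))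
          else \<exists>X. feasible q N k X \<and> sum w X = F N k \<and>
             (\<forall>i\<in>{1..N}. reals s3 ''x'' [i] = (if i \<in> vert ` X then b i else 0)))"
      proof (cases "0 < p \<and> 0 < j")
        case False
        then have "F p j = 0" using F J(3,4) by (cases "p = 0") (auto simp: knapsack_table_def)
        moreover have "feasible q N k X" using J(7)[of "{}"] by (simp add: feasible_def)
        ultimately show ?thesis using False J(1,2,6,8,9) by auto
      next
        case True
        then have pj: "p \<in> {1..N}" "j \<in> {1..k}" using J by auto
        have qp: "q p < p" using q(2) pj by (simp add: nested_def)
        have e: "if 0 < ints s ''T'' [p, j] then F p j = F (p - 1) (j - 1) + w p \<and> F (q p) j \<le> F p j
          else F p j = F (q p) j \<and> F (p - 1) (j - 1) + w p \<le> F p j"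
          using F pj unfolding knapsack_table_def by blast
        have fin: "finite X" "p \<notin> X" using J(5) by (auto dest: finite_subset)
        show ?thesis
        proof (cases "0 < ints s ''T'' [p, j]")
          case take: True
          have "J (iupd ''j'' [] (j - 1) (iupd ''p'' [] (p - 1) (rupd ''x'' [vert p] (b (vert p)) s3))) B'" if "B3 \<le> B' + 50" for B'
            unfolding J_def
          proof (rule exI[of _ "p - 1"], rule exI[of _ "j - 1"], rule exI[of _ "insert p X"], intro conjI allI impI)
            fix K assume "feasible q (p - 1) (j - 1) K"
            then have "feasible q p j (insert p K)" using pj by (intro feasible_take[OF q(2)]) auto
            from J(7)[OF this] show "feasible q N k (insert p X \<union> K)" by simp
          next
            show "sum w (insert p X) + F (p - 1) (j - 1) = F N k" using J(8) e take fin by simp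
          next
            show "insert p X \<subseteq> {p - 1<..N}"
            proof -
              have "X \<subseteq> {p - 1<..N}" by (rule order_trans[OF J(5)]) auto
              then show ?thesis using pj by auto
            qed
          next
            show "60 * (p - 1) + 10 \<le> B'" using that J(9) True by (cases p) auto
          qed (use J(1-4,6) pj in auto)
          then show ?thesis using take J(1,2,9) True u3 by auto
        next
          case skip: False
          have "J (iupd ''p'' [] (q p) s3) B'" if "B3 \<le> B' + 50" for B'
            unfolding J_def
          proof (rule exI[of _ "q p"], rule exI[of _ j], rule exI[of _ X], intro conjI allI impI)
            fix K assume "feasible q (q p) j K"
            then show "feasible q N k (X \<union> K)" by (rule J(7)[OF feasible_skip[OF q(2) pj(1)]])
          next
            show "sum w X + F (q p) j = F N k" using J(8) e skip by simp
          next
            show "X \<subseteq> {q p<..N}" by (rule order_trans[OF J(5)]) (use qp in auto)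
          next
            show "60 * q p + 10 \<le> B'" using that J(9) qp by linarith
          qed (use J(1-4,6) qp in auto)
          then show ?thesis using skip J(1,2,9) True u3 by auto
        qed
      qed
    qed
    then show ?case using 8(3) u1 by (auto simp: s2_def)
  qed (auto simp: less_Suc_eq)
  then show ?thesis by (rule runs_mono[OF _ T])
qed

definition tree_prog :: prog where
  "tree_prog = link_prog ;; dfs_prog ;; table_prog ;; walk_prog"

lemma iw_tree_prog [simp]:
    "iw v tree_prog \<longleftrightarrow> v \<in> {''v'', ''fc'', ''sb'', ''up'', ''cnt'', ''q0'', ''ord'', ''q'', ''p'', ''j'', ''T''}"
  and rw_tree_prog [simp]: "rw v tree_prog \<longleftrightarrow> v \<in> {''F'', ''x''}"
  by (auto simp: tree_prog_def)

lemma tree_prog: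
  assumes t: "dary_tree D N r par" and k: "1 \<le> k" and s: "holds_tree s N r par k"
    and b: "holds_vector s ''b'' N b" and T: "1000 * ((N + 1) * (k + 1)) \<le> T"
  shows "runs tree_prog s T (\<lambda>s'. \<exists>z. holds_vector s' ''x'' N z \<and> model_projection N (tree_model N r par k) b z)"
proof -
  note s' = s[unfolded holds_tree_def]
  have "runs tree_prog s (N * 60 + 40 + (N * 200 + 20) + 200 * (N + 1) * (k + 1) + (100 * N + 40))
    (\<lambda>s'. \<exists>z. holds_vector s' ''x'' N z \<and> model_projection N (tree_model N r par k) b z)"
    unfolding tree_prog_def wp_Seq
  proof (rule wp_runs[OF link_prog[OF t s order_refl]], goal_cases)
    case 1 show ?case by simp
  next
    case (2 s1 B1)
    have s1: "holds_tree s1 N r par k" using s 2(2) by (simp add: holds_tree_def frame_def)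
    show ?case
    proof (rule wp_runs[OF dfs_prog[OF t s1 2(1) order_refl]], goal_cases)
      case 1 show ?case using 2(3) by simp
    next
      case (2 s2 B2)
      define vert where "vert = (\<lambda>p. ints s2 ''ord'' [p])"
      define q where "q = (\<lambda>p. ints s2 ''q'' [p])"
      have po: "postorder N r par vert q" using 2(1) by (simp add: vert_def q_def)
      note nest = postorder_nested[OF po]
      have bij: "inj_on vert {1..N}" "vert ` {1..N} = {1..N}" using po by (simp_all add: postorder_def bij_betw_def)
      have u2: "ints s2 ''N'' [] = N" "ints s2 ''k'' [] = k" using s1 2(2) by (simp_all add: holds_tree_def frame_def)
      have b2: "\<forall>i\<in>{1..N}. reals s2 ''b'' [i] = b i"
        using b 2(2) \<open>frame link_prog s s1\<close> by (simp add: holds_vector_def frame_def)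
      define w where "w = (\<lambda>p. \<bar>reals s2 ''b'' [ints s2 ''ord'' [p]]\<bar>)"
      show ?case
      proof (rule wp_runs[OF table_prog[OF u2 q_def nest _ order_refl, of w]], goal_cases)
        case 1 show ?case by (simp add: w_def)
      next
        case 2 show ?case using \<open>_ \<le> B2 + _\<close> \<open>_ \<le> B1 + _\<close> by simp
      next
        case (3 s3 B3)
        define F where "F = (\<lambda>p j. reals s3 ''F'' [p, j])"
        have u3: "ints s3 ''N'' [] = N" "ints s3 ''k'' [] = k" "q = (\<lambda>p. ints s3 ''q'' [p])" "vert = (\<lambda>p. ints s3 ''ord'' [p])"
          "reals s3 ''b'' = reals s2 ''b''"
          using 3(2) u2 by (simp_all add: frame_def q_def vert_def)
        have tab: "knapsack_table N k q w F (\<lambda>p j. ints s3 ''T'' [p, j])" using 3(1) by (simp add: F_def)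
        show ?case
        proof (rule runs_mono[OF walk_prog[OF u3(1,2,3) nest u3(4) bij(1) tab refl order_refl]], goal_cases)
          case 1 show ?case using 3(3) \<open>_ \<le> B2 + _\<close> \<open>_ \<le> B1 + _\<close> by simp
        next
          case (2 s4)
          then obtain X where X: "feasible q N k X" "sum w X = F N k"
            "\<forall>i\<in>{1..N}. reals s4 ''x'' [i] = (if i \<in> vert ` X then reals s3 ''b'' [i] else 0)" by blast
          obtain K where K: "K \<in> tree_model N r par k" "vert ` X \<subseteq> K"
            using feasible_tree_model[OF t po X(1) k] by blast
          have XN: "X \<subseteq> {1..N}" using X(1) by (simp add: feasible_def)
          have wb: "w p = \<bar>b (vert p)\<bar>" if "p \<in> {1..N}" for p
          proof -
            have "vert p \<in> {1..N}" using bij that by blast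
            then show ?thesis using b2 by (simp add: w_def vert_def)
          qed
          have ws: "sum w Y = (\<Sum>i\<in>vert ` Y. \<bar>b i\<bar>)" if "Y \<subseteq> {1..N}" for Y
          proof -
            have "(\<Sum>i\<in>vert ` Y. \<bar>b i\<bar>) = (\<Sum>p\<in>Y. \<bar>b (vert p)\<bar>)"
              using sum.reindex[OF inj_on_subset[OF bij(1) that], of "\<lambda>i. \<bar>b i\<bar>"] by simp
            also have "\<dots> = sum w Y" by (rule sum.cong) (use that wb in auto)
            finally show ?thesis by simp
          qed
          have "model_projection N (tree_model N r par k) b (\<lambda>i. reals s4 ''x'' [i])"
          proof (rule model_projectionI[OF K])
            show "vert ` X \<subseteq> {1..N}" using XN bij by blast
            show "reals s4 ''x'' [i] = (if i \<in> vert ` X then b i else 0)" if "i \<in> {1..N}" for i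
              using X(3) b2 that by (simp add: u3(5))
            fix K' assume K': "K' \<in> tree_model N r par k"
            define Y where "Y = {a \<in> {1..N}. vert a \<in> K'}"
            have Y: "feasible q N k Y" "vert ` Y = K'" using tree_model_feasible[OF po K'] by (simp_all add: Y_def)
            have "(\<Sum>i\<in>K' \<inter> {1..N}. \<bar>b i\<bar>) = (\<Sum>i\<in>K'. \<bar>b i\<bar>)"
              using K' by (simp add: tree_model_def Int_absorb2)
            also have "\<dots> = sum w Y"
            proof -
              have "Y \<subseteq> {1..N}" by (auto simp: Y_def)
              then show ?thesis using ws[of Y] Y(2) by simp
            qed
            also have "\<dots> \<le> F N k" by (rule knapsack_upper[OF nest tab _ _ Y(1)]) simp_all
            also have "\<dots> = (\<Sum>i\<in>vert ` X. \<bar>b i\<bar>)" using ws[OF XN] X(2) by simp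
            finally show "(\<Sum>i\<in>K' \<inter> {1..N}. \<bar>b i\<bar>) \<le> (\<Sum>i\<in>vert ` X. \<bar>b i\<bar>)" .
          qed
          then show ?case by (auto simp: holds_vector_def)
        qed
      qed
    qed
  qed
  then show ?thesis by (rule runs_mono) (use T in \<open>simp_all add: algebra_simps\<close>)
qed

lemma groups_meet_sym: "groups_meet M G i j \<Longrightarrow> groups_meet M G j i"
  by (auto simp: groups_meet_def)

section \<open>Loopless group structures\<close>

text \<open>If every group of \<open>R\<close> met two others, a path of maximal length could be closed up to a cycle: all neighbours of its first
group lie on it, and one of them is not the second group.\<close>

lemma loopless_leaf:
  assumes l: "loopless M G" and R: "R \<subseteq> {1..M}" "R \<noteq> {}"
  shows "\<exists>u\<in>R. card {w \<in> R. groups_meet M G u w} \<le> 1"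
proof (rule ccontr)
  assume "\<not> ?thesis"
  then have two: "2 \<le> card {w \<in> R. groups_meet M G u w}" if "u \<in> R" for u
    using that by fastforce
  define path where "path = (\<lambda>js. js \<noteq> [] \<and> distinct js \<and> set js \<subseteq> R \<and>
     (\<forall>i. Suc i < length js \<longrightarrow> groups_meet M G (js ! i) (js ! Suc i)))"
  have fin: "finite R" using R(1) finite_subset by blast
  obtain u where "u \<in> R" using R by blast
  then have "path [u]" by (simp add: path_def)
  moreover have "length js \<le> card R" if "path js" for js
    using that fin by (metis card_mono distinct_card path_def)
  ultimately have "\<exists>js. path js \<and> (\<forall>js'. path js' \<longrightarrow> length js' \<le> length js)"
    using Lattices_Big.ex_has_greatest_nat[of path "[u]" length "Suc (card R)"] by (simp add: less_Suc_eq_le)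
  then obtain js where js: "path js" "\<And>js'. path js' \<Longrightarrow> length js' \<le> length js" by blast
  then obtain x xs where x: "js = x # xs" by (auto simp: path_def neq_Nil_conv)
  have nb: "w \<in> set xs" if "w \<in> R" "groups_meet M G x w" for w
  proof (rule ccontr)
    assume "w \<notin> set xs"
    moreover have "w \<noteq> x" using that by (auto simp: groups_meet_def)
    ultimately have "path (w # js)"
      using js(1) that unfolding path_def x by (auto simp: nth_Cons groups_meet_sym split: nat.split)
    then show False using js(2) by fastforce
  qed
  have "\<exists>w\<in>R. groups_meet M G x w \<and> w \<noteq> hd xs"
  proof (rule ccontr)
    assume "\<not> ?thesis"
    then have "{w \<in> R. groups_meet M G x w} \<subseteq> {hd xs}" by auto
    then have "card {w \<in> R. groups_meet M G x w} \<le> card {hd xs}" by (intro card_mono) auto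
    then show False using two[of x] js(1) by (simp add: path_def x)
  qed
  then obtain w where w: "w \<in> R" "groups_meet M G x w" "w \<noteq> hd xs" by blast
  obtain i where i: "i < length xs" "xs ! i = w" using nb[OF w(1,2)] by (metis in_set_conv_nth)
  have i0: "0 < i" using i w(3) by (cases i) (auto simp: hd_conv_nth)
  \<comment> \<open>the path up to the neighbour \<open>w\<close>, whose index in \<open>js\<close> is \<open>i + 1\<close>\<close>
  define cyc where "cyc = take (i + 2) js"
  have len: "length cyc = i + 2" using i by (simp add: cyc_def x)
  have nth: "cyc ! n = js ! n" if "n < i + 2" for n using that by (simp add: cyc_def)
  have "groups_meet M G (cyc ! n) (cyc ! (Suc n mod length cyc))" if "n < length cyc" for n
  proof (cases "Suc n = length cyc")
    case True
    then have "n = Suc i" using len by simp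
    then show ?thesis using w(2) i len by (simp add: nth x groups_meet_sym)
  next
    case False
    then have "Suc n < length js" "Suc n < i + 2" using that len i by (auto simp: x)
    then show ?thesis using js(1) len by (simp add: path_def nth)
  qed
  moreover have "distinct cyc" using js(1) by (simp add: cyc_def path_def)
  ultimately show False using l i0 len unfolding loopless_def by (metis One_nat_def Suc_leI add_Suc_right add_2_eq_Suc' numeral_3_eq_3 Suc_le_mono numeral_2_eq_2)
qed

text \<open>Three groups with a common element form a cycle of length three.\<close>

lemma loopless_two_groups:
  assumes l: "loopless M G" and "e \<in> G i" "e \<in> G j" "i \<in> {1..M}" "j \<in> {1..M}" "i \<noteq> j"
    and h: "h \<in> {1..M}" "e \<in> G h"
  shows "h = i \<or> h = j"
proof (rule ccontr)
  assume n: "\<not> ?thesis"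
  have "groups_meet M G ([i, j, h] ! n) ([i, j, h] ! (Suc n mod 3))" if "n < 3" for n
  proof -
    from that have "n = 0 \<or> n = 1 \<or> n = 2" by auto
    then show ?thesis using assms n by (auto simp: groups_meet_def)
  qed
  then have "\<forall>n<length [i, j, h]. groups_meet M G ([i, j, h] ! n) ([i, j, h] ! (Suc n mod length [i, j, h]))"
    by simp
  moreover have "distinct [i, j, h]" "3 \<le> length [i, j, h]" using assms(6) n by auto
  ultimately show False using l unfolding loopless_def by blast
qed

lemma sum_indicator_card:
  assumes "finite A"
  shows "(\<Sum>x\<in>A. if P x then 1 else 0) = card {x \<in> A. P x}"
  using assms by (simp add: sum.If_cases Int_def)

text \<open>Counting incidences by elements; this bounds the length of the input lists by \<open>2 * N\<close>.\<close>

lemma sum_group_sizes: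
  assumes g: "group_structure N M G"
  shows "(\<Sum>j\<in>{1..M}. card (G j)) \<le> 2 * N"
proof -
  have l: "loopless M G" and U: "(\<Union>j\<in>{1..M}. G j) = {1..N}" using g by (auto simp: group_structure_def)
  have sub: "G j \<subseteq> {1..N}" if "j \<in> {1..M}" for j using U that by blast
  have "(\<Sum>j\<in>{1..M}. card (G j)) = (\<Sum>j\<in>{1..M}. \<Sum>e\<in>{1..N}. if e \<in> G j then 1 else 0)"
  proof (rule sum.cong[OF refl])
    fix j assume "j \<in> {1..M}"
    then have "{e \<in> {1..N}. e \<in> G j} = G j" using sub by blast
    then show "card (G j) = (\<Sum>e\<in>{1..N}. if e \<in> G j then 1 else 0)"
      using sum_indicator_card[of "{1..N}" "\<lambda>e. e \<in> G j"] by simp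
  qed
  also have "\<dots> = (\<Sum>e\<in>{1..N}. \<Sum>j\<in>{1..M}. if e \<in> G j then 1 else 0)" by (rule sum.swap)
  also have "\<dots> = (\<Sum>e\<in>{1..N}. card {j \<in> {1..M}. e \<in> G j})"
    by (rule sum.cong[OF refl], rule sum_indicator_card) simp
  also have "\<dots> \<le> (\<Sum>e\<in>{1..N}. 2)"
  proof (rule sum_mono)
    fix e
    show "card {j \<in> {1..M}. e \<in> G j} \<le> 2"
    proof (rule ccontr)
      assume n: "\<not> card {j \<in> {1..M}. e \<in> G j} \<le> 2"
      then obtain T where "T \<subseteq> {j \<in> {1..M}. e \<in> G j}" "card T = 3"
        using obtain_subset_with_card_n[of 3 "{j \<in> {1..M}. e \<in> G j}"] by force
      then obtain a b c where "{a, b, c} \<subseteq> {j \<in> {1..M}. e \<in> G j}" "a \<noteq> b" "a \<noteq> c" "b \<noteq> c"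
        by (auto simp: card_3_iff)
      then show False using loopless_two_groups[OF l, of e a b c] by auto
    qed
  qed
  finally show ?thesis by simp
qed

section \<open>Best selections of groups\<close>

text \<open>An empty group with the number \<open>0\<close> is added. It takes the place of the neighbour for a group that meets no remaining
group, so that merging ends with a single table even if the intersection graph is disconnected.\<close>

definition real_groups :: "(nat \<Rightarrow> nat set) \<Rightarrow> nat \<Rightarrow> nat set" where
  "real_groups G = G(0 := {})"

definition coverage :: "(nat \<Rightarrow> nat set) \<Rightarrow> (nat \<Rightarrow> real) \<Rightarrow> nat set \<Rightarrow> real" where
  "coverage H c J = (\<Sum>e\<in>(\<Union>j\<in>J. H j). c e)"

text \<open>\<open>J\<close> is a selection of largest coverage among the groups in \<open>C\<close>, subject to containing \<open>v\<close> or not as \<open>sel\<close> prescribes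
and to the budget \<open>j\<close>. The group \<open>v\<close> itself is not charged to the budget: so there is a selection for every \<open>j\<close>,
including \<open>0\<close>, and no entry of a table has to stand for minus infinity.\<close>

definition best_selection :: "(nat \<Rightarrow> nat set) \<Rightarrow> (nat \<Rightarrow> real) \<Rightarrow> nat \<Rightarrow> nat set \<Rightarrow> bool \<Rightarrow> nat \<Rightarrow> nat set \<Rightarrow> real \<Rightarrow> bool" where
  "best_selection H c v C sel j J a \<longleftrightarrow> J \<subseteq> C \<and> (v \<in> J \<longleftrightarrow> sel) \<and> card (J - {v}) \<le> j \<and> a = coverage H c J \<and>
     (\<forall>J'\<subseteq>C. (v \<in> J' \<longleftrightarrow> sel) \<and> card (J' - {v}) \<le> j \<longrightarrow> coverage H c J' \<le> a)"

lemma best_selectionD: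
  assumes "best_selection H c v C sel j J a"
  shows "J \<subseteq> C" "v \<in> J \<longleftrightarrow> sel" "card (J - {v}) \<le> j" "a = coverage H c J"
    and "\<And>J'. J' \<subseteq> C \<Longrightarrow> (v \<in> J' \<longleftrightarrow> sel) \<Longrightarrow> card (J' - {v}) \<le> j \<Longrightarrow> coverage H c J' \<le> a"
  using assms unfolding best_selection_def by blast+

lemma coverage_Un:
  assumes fin: "finite C1" "finite C2" "\<And>j. finite (H j)" and J: "J1 \<subseteq> C1" "J2 \<subseteq> C2"
    and sep: "\<And>a b. a \<in> C1 \<Longrightarrow> b \<in> C2 \<Longrightarrow> H a \<inter> H b \<noteq> {} \<Longrightarrow> a = v \<and> b = u"
  shows "coverage H c (J1 \<union> J2) = coverage H c J1 + coverage H c J2 -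
     (if v \<in> J1 \<and> u \<in> J2 then (\<Sum>e\<in>H v \<inter> H u. c e) else 0)"
proof -
  have f: "finite (\<Union>j\<in>J1. H j)" "finite (\<Union>j\<in>J2. H j)"
    using fin J by (auto dest: finite_subset)
  have "(\<Union>j\<in>J1. H j) \<inter> (\<Union>j\<in>J2. H j) = (if v \<in> J1 \<and> u \<in> J2 then H v \<inter> H u else {})"
  proof (intro equalityI subsetI)
    fix e assume "e \<in> (\<Union>j\<in>J1. H j) \<inter> (\<Union>j\<in>J2. H j)"
    then obtain a b where ab: "a \<in> J1" "b \<in> J2" "e \<in> H a" "e \<in> H b" by blast
    then have "a = v \<and> b = u" using sep[of a b] J by blast
    with ab show "e \<in> (if v \<in> J1 \<and> u \<in> J2 then H v \<inter> H u else {})" by simp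
  qed (auto split: if_splits)
  moreover have "(\<Union>j\<in>J1 \<union> J2. H j) = (\<Union>j\<in>J1. H j) \<union> (\<Union>j\<in>J2. H j)" by auto
  ultimately show ?thesis using sum.union_inter[OF f, of c] by (auto simp: coverage_def)
qed

text \<open>If \<open>v\<close> and \<open>u\<close> are the only groups through which the clusters \<open>C1\<close> and \<open>C2\<close> meet, the coverage of a selection is the sum
of the coverages of its two parts, minus the overlap of \<open>v\<close> and \<open>u\<close> if both are selected. The parts can be optimized
separately once it is fixed whether \<open>u\<close> is selected (\<open>s\<close>) and how many other groups of \<open>C2\<close> are (\<open>l\<close>); selecting
\<open>u\<close> is charged to the budget of \<open>v\<close>.\<close>

lemma merge_selection:
  assumes fin: "finite C1" "finite C2" "\<And>j. finite (H j)"
    and disj: "C1 \<inter> C2 = {}" "v \<in> C1" "u \<in> C2"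
    and sep: "\<And>a b. a \<in> C1 \<Longrightarrow> b \<in> C2 \<Longrightarrow> H a \<inter> H b \<noteq> {} \<Longrightarrow> a = v \<and> b = u"
    and T1: "\<And>j. j \<le> k \<Longrightarrow> best_selection H c v C1 sel j (J1 j) (A1 j)"
    and T2: "\<And>s j. s \<le> 1 \<Longrightarrow> j \<le> k \<Longrightarrow> best_selection H c u C2 (0 < s) j (J2 s j) (A2 s j)"
    and j: "j \<le> k"
    and val: "\<And>s l. val s l = A1 (j - l - s) + A2 s l - (if sel \<and> 0 < s then (\<Sum>e\<in>H v \<inter> H u. c e) else 0)"
    and best: "bs \<le> (1::nat)" "bl + bs \<le> j" "\<And>s l. s \<le> 1 \<Longrightarrow> l + s \<le> j \<Longrightarrow> val s l \<le> val bs bl"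
  shows "best_selection H c v (C1 \<union> C2) sel j (J1 (j - bl - bs) \<union> J2 bs bl) (val bs bl)"
  unfolding best_selection_def
proof (intro conjI allI impI)
  define X where "X = J1 (j - bl - bs)"
  define Y where "Y = J2 bs bl"
  have X: "X \<subseteq> C1" "v \<in> X \<longleftrightarrow> sel" "card (X - {v}) \<le> j - bl - bs" "A1 (j - bl - bs) = coverage H c X"
    using best_selectionD(1-4)[OF T1[of "j - bl - bs"]] j by (simp_all add: X_def)
  have Y: "Y \<subseteq> C2" "u \<in> Y \<longleftrightarrow> 0 < bs" "card (Y - {u}) \<le> bl" "A2 bs bl = coverage H c Y"
    using best_selectionD(1-4)[OF T2[of bs bl]] j best(1,2) by (simp_all add: Y_def)
  have vu: "v \<notin> C2" "u \<notin> C1" using disj by auto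
  have finXY: "finite X" "finite Y" using X Y fin by (auto dest: finite_subset)
  show "J1 (j - bl - bs) \<union> J2 bs bl \<subseteq> C1 \<union> C2" using X Y by (auto simp: X_def Y_def)
  show "v \<in> J1 (j - bl - bs) \<union> J2 bs bl \<longleftrightarrow> sel" using X(2) Y(1) vu by (auto simp: X_def Y_def)
  have "X \<union> Y - {v} = (X - {v}) \<union> Y" using Y(1) vu by auto
  then have "card (X \<union> Y - {v}) \<le> card (X - {v}) + card Y" using card_Un_le by metis
  also have "card Y \<le> bl + bs"
  proof (cases "u \<in> Y")
    case True
    then have "bs = 1" "card Y = Suc (card (Y - {u}))" using Y(2) best(1) card.remove[OF finXY(2) True] by auto
    then show ?thesis using Y(3) by simp
  qed (use Y(3) in simp)
  finally show "card (J1 (j - bl - bs) \<union> J2 bs bl - {v}) \<le> j" using X(3) best(2) by (simp add: X_def Y_def)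
  show "val bs bl = coverage H c (J1 (j - bl - bs) \<union> J2 bs bl)"
    unfolding val X(4) Y(4) X_def[symmetric] Y_def[symmetric]
    using coverage_Un[where H = H and v = v and u = u and c = c, OF fin X(1) Y(1) sep] X(2) Y(2) by simp
  fix J' assume J': "J' \<subseteq> C1 \<union> C2" and p: "(v \<in> J' \<longleftrightarrow> sel) \<and> card (J' - {v}) \<le> j"
  define X' where "X' = J' \<inter> C1"
  define Y' where "Y' = J' \<inter> C2"
  have J'': "J' = X' \<union> Y'" "X' \<subseteq> C1" "Y' \<subseteq> C2" using J' by (auto simp: X'_def Y'_def)
  have finXY': "finite X'" "finite Y'" using fin by (auto simp: X'_def Y'_def)
  define s where "s = (if u \<in> Y' then 1 else 0 :: nat)"
  define l where "l = card (Y' - {u})"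
  have cY: "card Y' = l + s" using card.remove[OF finXY'(2), of u] by (auto simp: l_def s_def)
  have "J' - {v} = (X' - {v}) \<union> Y'" "(X' - {v}) \<inter> Y' = {}" using vu disj J'' by auto
  then have "card (J' - {v}) = card (X' - {v}) + card Y'" using finXY' by (simp add: card_Un_disjoint)
  with p cY have cX: "card (X' - {v}) \<le> j - l - s" "l + s \<le> j" by auto
  have "coverage H c X' \<le> A1 (j - l - s)"
    by (rule best_selectionD(5)[OF T1]) (use j cX(1) p J''(2) disj in \<open>auto simp: X'_def\<close>)
  moreover have "coverage H c Y' \<le> A2 s l"
    by (rule best_selectionD(5)[OF T2]) (use j cX(2) J''(3) in \<open>auto simp: l_def s_def\<close>)
  moreover have "v \<in> X' \<longleftrightarrow> sel" using p disj by (auto simp: X'_def)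
  ultimately have "coverage H c J' \<le> val s l"
    using coverage_Un[where H = H and v = v and u = u and c = c, OF fin J''(2,3) sep]
    by (auto simp: s_def val J''(1)[symmetric])
  also have "\<dots> \<le> val bs bl" by (rule best(3)) (use cX in \<open>auto simp: s_def\<close>)
  finally show "coverage H c J' \<le> val bs bl" .
qed

text \<open>The remaining groups \<open>R\<close>, and the group \<open>0\<close>, are the centres of disjoint clusters that exhaust all groups. A cluster
consists of its centre and the removed groups merged into it, and only its centre meets groups outside.\<close>

definition clustering :: "nat \<Rightarrow> (nat \<Rightarrow> nat set) \<Rightarrow> nat set \<Rightarrow> (nat \<Rightarrow> nat set) \<Rightarrow> bool" where
  "clustering M H R C \<longleftrightarrow> R \<subseteq> {1..M} \<and> (\<forall>v\<in>insert 0 R. v \<in> C v) \<and>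
     (\<forall>v\<in>insert 0 R. \<forall>u\<in>insert 0 R. v \<noteq> u \<longrightarrow> C v \<inter> C u = {}) \<and> (\<Union>v\<in>insert 0 R. C v) = {0..M} \<and>
     (\<forall>v\<in>insert 0 R. \<forall>a\<in>C v - {v}. \<forall>b\<in>{0..M} - C v. H a \<inter> H b = {})"

text \<open>Removing \<open>u\<close>, which meets no remaining group except possibly \<open>v\<close>, and merging its cluster into the one of \<open>v\<close>. Now \<open>u\<close> is
no longer a centre; it meets no centre but \<open>v\<close> by assumption, and no other group outside because those are not centres.\<close>

lemma clustering_merge:
  assumes C: "clustering M H R C" and H0: "H 0 = {}" and u: "u \<in> R" and v: "v \<in> insert 0 (R - {u})"
    and nb: "\<And>w. w \<in> R - {u} \<Longrightarrow> H u \<inter> H w \<noteq> {} \<Longrightarrow> w = v"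
  shows "clustering M H (R - {u}) (C(v := C v \<union> C u))"
    and "\<And>a b. a \<in> C v \<Longrightarrow> b \<in> C u \<Longrightarrow> H a \<inter> H b \<noteq> {} \<Longrightarrow> a = v \<and> b = u"
    and "C v \<inter> C u = {}"
proof -
  have C1: "R \<subseteq> {1..M}" and C2: "\<And>x. x \<in> insert 0 R \<Longrightarrow> x \<in> C x"
    and C3: "\<And>x y. x \<in> insert 0 R \<Longrightarrow> y \<in> insert 0 R \<Longrightarrow> x \<noteq> y \<Longrightarrow> C x \<inter> C y = {}"
    and C4: "(\<Union>x\<in>insert 0 R. C x) = {0..M}"
    and C5: "\<And>x a b. x \<in> insert 0 R \<Longrightarrow> a \<in> C x \<Longrightarrow> a \<noteq> x \<Longrightarrow> b \<in> {0..M} \<Longrightarrow> b \<notin> C x \<Longrightarrow> H a \<inter> H b = {}"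
  proof -
    note C' = C[unfolded clustering_def]
    show "R \<subseteq> {1..M}" using C' by (elim conjE)
    show "(\<Union>x\<in>insert 0 R. C x) = {0..M}" using C' by (elim conjE)
    show "x \<in> C x" if "x \<in> insert 0 R" for x using C' that by (elim conjE) (rule bspec)
    show "C x \<inter> C y = {}" if "x \<in> insert 0 R" "y \<in> insert 0 R" "x \<noteq> y" for x y
    proof -
      have "\<forall>v\<in>insert 0 R. \<forall>u\<in>insert 0 R. v \<noteq> u \<longrightarrow> C v \<inter> C u = {}" using C' by (elim conjE)
      then show ?thesis using that by blast
    qed
    show "H a \<inter> H b = {}" if "x \<in> insert 0 R" "a \<in> C x" "a \<noteq> x" "b \<in> {0..M}" "b \<notin> C x" for x a b
    proof -
      have "\<forall>v\<in>insert 0 R. \<forall>a\<in>C v - {v}. \<forall>b\<in>{0..M} - C v. H a \<inter> H b = {}" using C' by (elim conjE)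
      from bspec[OF bspec[OF bspec[OF this that(1)], of a], of b] show ?thesis using that(2-5) by simp
    qed
  qed
  have u': "u \<in> insert 0 R" "u \<noteq> 0" and v': "v \<in> insert 0 R" "v \<noteq> u" using u v C1 by auto
  have sub: "C x \<subseteq> {0..M}" if "x \<in> insert 0 R" for x using C4 that by blast
  show disj: "C v \<inter> C u = {}" by (rule C3) (use u' v' in auto)
  show "a = v \<and> b = u" if ab: "a \<in> C v" "b \<in> C u" "H a \<inter> H b \<noteq> {}" for a b
  proof (intro conjI; rule ccontr)
    assume "a \<noteq> v"
    moreover have "b \<in> {0..M}" "b \<notin> C v" using sub[OF u'(1)] disj ab(2) by blast+
    ultimately show False using C5[OF v'(1) ab(1)] ab(3) by blast
  next
    assume "b \<noteq> u"
    moreover have "a \<in> {0..M}" "a \<notin> C u" using sub[OF v'(1)] disj ab(1) by blast+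
    ultimately show False using C5[OF u'(1) ab(2)] ab(3) by blast
  qed
  have eq: "insert 0 (R - {u}) = insert 0 R - {u}" using u' by auto
  define C' where "C' = C(v := C v \<union> C u)"
  have C': "C' v = C v \<union> C u" "\<And>x. x \<noteq> v \<Longrightarrow> C' x = C x" by (simp_all add: C'_def)
  have out: "H a \<inter> H b = {}" if x: "x \<in> insert 0 R - {u}" and a: "a \<in> C' x" "a \<noteq> x" and b: "b \<in> {0..M}" "b \<notin> C' x" for x a b
  proof (cases "x = v \<and> a \<in> C u")
    case False
    then have "a \<in> C x" "b \<notin> C x" using a b C' by (auto split: if_splits simp: C'_def)
    then show ?thesis using C5[of x a b] x a b by auto
  next
    case True
    then have bn: "b \<notin> C u" "b \<notin> C v" using b C' by auto
    show ?thesis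
    proof (cases "a = u")
      case False
      then show ?thesis using C5[OF u'(1), of a b] True b bn by auto
    next
      case au: True
      obtain y where y: "y \<in> insert 0 R" "b \<in> C y" using C4 b(1) by blast
      then have yn: "y \<noteq> u" "y \<noteq> v" using bn by auto
      have uy: "u \<notin> C y" using C3[OF u'(1) y(1)] C2[OF u'(1)] yn by auto
      show ?thesis
      proof (cases "b = y")
        case False
        moreover have "u \<in> {0..M}" using sub[OF u'(1)] C2[OF u'(1)] by blast
        ultimately have "H b \<inter> H u = {}" using C5[OF y(1,2) _ _ uy] by blast
        then show ?thesis by (simp add: au Int_commute)
      next
        case yb: True
        show ?thesis
        proof (cases "y = 0")
          case True
          then show ?thesis using yb H0 by simp
        next
          case False
          then have "y \<in> R - {u}" using y yn by auto
          then show ?thesis using nb[of y] yn by (auto simp: au yb)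
        qed
      qed
    qed
  qed
  have "x \<in> C' x" if "x \<in> insert 0 R - {u}" for x using C2[of x] that by (auto simp: C'_def)
  moreover have "C' x \<inter> C' y = {}" if "x \<in> insert 0 R - {u}" "y \<in> insert 0 R - {u}" "x \<noteq> y" for x y
    using C3[of x y] C3[of u y] C3[of x u] that u' by (auto simp: C'_def)
  moreover have "(\<Union>x\<in>insert 0 R - {u}. C' x) = {0..M}"
  proof -
    have "(\<Union>x\<in>insert 0 R - {u}. C' x) = C' v \<union> (\<Union>x\<in>insert 0 R - {u} - {v}. C' x)"
      using v' by blast
    also have "(\<Union>x\<in>insert 0 R - {u} - {v}. C' x) = (\<Union>x\<in>insert 0 R - {u} - {v}. C x)"
      using C'(2) by (intro SUP_cong) auto
    also have "C' v \<union> \<dots> = (\<Union>x\<in>insert 0 R. C x)" unfolding C'(1) using u'(1) v'(1) by blast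
    finally show ?thesis using C4 by simp
  qed
  moreover have "R - {u} \<subseteq> {1..M}" using C1 by blast
  moreover have "\<forall>x\<in>insert 0 R - {u}. \<forall>a\<in>C' x - {x}. \<forall>b\<in>{0..M} - C' x. H a \<inter> H b = {}"
    by (intro ballI out) auto
  ultimately have "clustering M H (R - {u}) C'"
    unfolding clustering_def eq by simp
  then show "clustering M H (R - {u}) (C(v := C v \<union> C u))" by (simp add: C'_def)
qed

section \<open>Weights and overlaps of groups\<close>

definition overlap_data :: "nat \<Rightarrow> (nat \<Rightarrow> nat set) \<Rightarrow> (nat \<Rightarrow> real) \<Rightarrow> memory \<Rightarrow> bool" where
  "overlap_data M H c s \<longleftrightarrow> (\<forall>a\<le>M. reals s ''wt'' [a] = sum c (H a)) \<and>
     (\<forall>a\<le>M. \<forall>b\<le>M. a \<noteq> b \<longrightarrow> reals s ''W'' [a, b] = sum c (H a \<inter> H b) \<and>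
        ints s ''adj'' [a, b] = (if H a \<inter> H b = {} then 0 else 1)) \<and>
     (\<forall>a\<le>M. ints s ''adj'' [a, a] = 0)"

text \<open>\<open>own[e]\<close> is some group known to contain \<open>e\<close>, and \<open>0\<close> as long as none is.\<close>

definition owners :: "nat \<Rightarrow> nat \<Rightarrow> (nat \<Rightarrow> nat set) \<Rightarrow> memory \<Rightarrow> bool" where
  "owners N M H s \<longleftrightarrow> (\<forall>e\<in>{1..N}. ints s ''own'' [e] \<le> M \<and>
     (if ints s ''own'' [e] = 0 then \<forall>a\<le>M. e \<notin> H a else e \<in> H (ints s ''own'' [e])))"

lemma overlap_data_cong: "(\<And>a. a \<le> M \<Longrightarrow> H a = H' a) \<Longrightarrow> overlap_data M H c s \<longleftrightarrow> overlap_data M H' c s"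
  by (simp add: overlap_data_def)

lemma owners_cong:
  assumes "\<And>a. a \<le> M \<Longrightarrow> H a = H' a"
  shows "owners N M H s \<longleftrightarrow> owners N M H' s"
  unfolding owners_def
proof (intro ball_cong conj_cong refl)
  fix e assume "ints s ''own'' [e] \<le> M"
  from assms[OF this] show "(if ints s ''own'' [e] = 0 then \<forall>a\<le>M. e \<notin> H a else e \<in> H (ints s ''own'' [e])) =
    (if ints s ''own'' [e] = 0 then \<forall>a\<le>M. e \<notin> H' a else e \<in> H' (ints s ''own'' [e]))"
    using assms by auto
qed

lemma overlap_data_iupd [simp]: "a \<noteq> ''adj'' \<Longrightarrow> overlap_data M H c (iupd a is x s) \<longleftrightarrow> overlap_data M H c s"
  and owners_iupd [simp]: "a \<noteq> ''own'' \<Longrightarrow> owners N M H (iupd a is x s) \<longleftrightarrow> owners N M H s"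
  by (simp_all add: overlap_data_def owners_def)

definition elem_prog :: prog where
  "elem_prog =
     IWrite ''e'' [] (IRead ''grp'' [V ''g'', V ''l'']) ;;
     Cond (RLess (RRead ''b'' [V ''e'']) (RConst 0))
       (RWrite ''t'' [] (RMinus (RConst 0) (RRead ''b'' [V ''e''])))
       (RWrite ''t'' [] (RRead ''b'' [V ''e''])) ;;
     RWrite ''wt'' [V ''g''] (RPlus (RRead ''wt'' [V ''g'']) (RRead ''t'' [])) ;;
     IWrite ''a'' [] (IRead ''own'' [V ''e'']) ;;
     Cond (ILess (IConst 0) (V ''a''))
       (RWrite ''W'' [V ''a'', V ''g''] (RPlus (RRead ''W'' [V ''a'', V ''g'']) (RRead ''t'' [])) ;;
        RWrite ''W'' [V ''g'', V ''a''] (RPlus (RRead ''W'' [V ''g'', V ''a'']) (RRead ''t'' [])) ;;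
        IWrite ''adj'' [V ''a'', V ''g''] (IConst 1) ;;
        IWrite ''adj'' [V ''g'', V ''a''] (IConst 1))
       (IWrite ''own'' [V ''e''] (V ''g''))"

lemma iw_elem_prog [simp]: "iw v elem_prog \<longleftrightarrow> v \<in> {''e'', ''a'', ''adj'', ''own''}"
  and rw_elem_prog [simp]: "rw v elem_prog \<longleftrightarrow> v \<in> {''t'', ''wt'', ''W''}"
  by (auto simp: elem_prog_def)

lemma overlap_insert_new:
  assumes "overlap_data M H c s" "\<And>a. a \<le> M \<Longrightarrow> e \<notin> H a" "finite (H g)" "g \<le> M"
    and "reals s' ''wt'' = (reals s ''wt'')([g] := reals s ''wt'' [g] + c e)"
    and "reals s' ''W'' = reals s ''W''" "ints s' ''adj'' = ints s ''adj''"
  shows "overlap_data M (H(g := insert e (H g))) c s'"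
proof -
  have "(H(g := insert e (H g))) a \<inter> (H(g := insert e (H g))) b = H a \<inter> H b"
    if "a \<le> M" "b \<le> M" "a \<noteq> b" for a b
    using assms(2) that by auto
  then show ?thesis using assms by (simp add: overlap_data_def)
qed

text \<open>At most one earlier group contains the new element, so a single overlap grows.\<close>

lemma overlap_insert_shared:
  assumes d: "overlap_data M H c s" and fin: "\<And>a. finite (H a)" and g: "g \<le> M" "e \<notin> H g"
    and h: "e \<in> H h" "h \<le> M" "\<And>a. a \<le> M \<Longrightarrow> a \<noteq> g \<Longrightarrow> e \<in> H a \<Longrightarrow> a = h"
    and "reals s' ''wt'' = (reals s ''wt'')([g] := reals s ''wt'' [g] + c e)"
    and "reals s' ''W'' = (reals s ''W'')([h, g] := reals s ''W'' [h, g] + c e, [g, h] := reals s ''W'' [g, h] + c e)"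
    and "ints s' ''adj'' = (ints s ''adj'')([h, g] := 1, [g, h] := 1)"
  shows "overlap_data M (H(g := insert e (H g))) c s'"
proof -
  define H' where "H' = H(g := insert e (H g))"
  have og: "h \<noteq> g" using h(1) g(2) by auto
  have cap: "H' a \<inter> H' b = (if {a, b} = {h, g} then insert e (H a \<inter> H b) else H a \<inter> H b)"
    if "a \<le> M" "b \<le> M" "a \<noteq> b" for a b
  proof (cases "{a, b} = {h, g}")
    case True
    then consider "a = h" "b = g" | "a = g" "b = h" by (auto simp: doubleton_eq_iff)
    then show ?thesis
    proof cases
      case 1
      have "H' a = H a" "H' b = insert e (H b)" "e \<in> H a" using 1 og h(1) by (simp_all add: H'_def)
      then show ?thesis unfolding if_P[OF True] by simp
    next
      case 2
      have "H' b = H b" "H' a = insert e (H a)" "e \<in> H b" using 2 og h(1) by (simp_all add: H'_def)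
      then show ?thesis unfolding if_P[OF True] by simp
    qed
  next
    case False
    consider "a = g" | "b = g" | "a \<noteq> g" "b \<noteq> g" by blast
    then show ?thesis
    proof cases
      case 1
      then have "b \<noteq> g" "b \<noteq> h" using that(3) False by auto
      then have "e \<notin> H b" using h(3)[OF that(2)] by blast
      moreover have "H' b = H b" "H' a = insert e (H a)" using 1 \<open>b \<noteq> g\<close> by (simp_all add: H'_def)
      ultimately show ?thesis unfolding if_not_P[OF False] by simp
    next
      case 2
      then have "a \<noteq> g" "a \<noteq> h" using that(3) False by auto
      then have "e \<notin> H a" using h(3)[OF that(1)] by blast
      moreover have "H' a = H a" "H' b = insert e (H b)" using 2 \<open>a \<noteq> g\<close> by (simp_all add: H'_def)
      ultimately show ?thesis unfolding if_not_P[OF False] by simp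
    next
      case 3
      then show ?thesis unfolding if_not_P[OF False] by (simp add: H'_def)
    qed
  qed
  have "reals s' ''W'' [a, b] = sum c (H' a \<inter> H' b) \<and> ints s' ''adj'' [a, b] = (if H' a \<inter> H' b = {} then 0 else 1)"
    if ab: "a \<le> M" "b \<le> M" "a \<noteq> b" for a b
  proof -
    have old: "reals s ''W'' [a, b] = sum c (H a \<inter> H b)" "ints s ''adj'' [a, b] = (if H a \<inter> H b = {} then 0 else 1)"
      using d ab by (simp_all add: overlap_data_def)
    show ?thesis
    proof (cases "{a, b} = {h, g}")
      case True
      then have "a = h \<and> b = g \<or> a = g \<and> b = h" by (auto simp: doubleton_eq_iff)
      moreover have "e \<notin> H a \<inter> H b" using True g(2) by (auto simp: doubleton_eq_iff)
      ultimately show ?thesis unfolding cap[OF ab] if_P[OF True] using old og fin assms(9,10) by auto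
    next
      case False
      then have "[a, b] \<noteq> [h, g]" "[a, b] \<noteq> [g, h]" by auto
      then show ?thesis unfolding cap[OF ab] if_not_P[OF False] using old by (simp only: assms(9,10) fun_upd_apply if_False)
    qed
  qed
  moreover have "reals s' ''wt'' [a] = sum c (H' a)" if "a \<le> M" for a
    using d that assms(8) fin g(2) by (simp add: overlap_data_def H'_def)
  moreover have "ints s' ''adj'' [a, a] = 0" if "a \<le> M" for a
    using d that assms(10) og by (auto simp: overlap_data_def)
  ultimately show ?thesis unfolding overlap_data_def H'_def[symmetric] by blast
qed

lemma elem_prog:
  assumes d: "overlap_data M H c s" and ow: "owners N M H s" and fin: "\<And>a. finite (H a)"
    and g: "ints s ''g'' [] = g" "g \<le> M" "0 < g" and l: "ints s ''l'' [] = l" and e: "ints s ''grp'' [g, l] = e"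
    and eN: "e \<in> {1..N}" "e \<notin> H g" and H0: "H 0 = {}"
    and two: "\<And>a a'. a \<le> M \<Longrightarrow> a' \<le> M \<Longrightarrow> a \<noteq> g \<Longrightarrow> a' \<noteq> g \<Longrightarrow> e \<in> H a \<Longrightarrow> e \<in> H a' \<Longrightarrow> a = a'"
    and c: "c e = \<bar>reals s ''b'' [e]\<bar>"
  shows "runs elem_prog s 100 (\<lambda>s'. overlap_data M (H(g := insert e (H g))) c s' \<and> owners N M (H(g := insert e (H g))) s')"
proof (cases "ints s ''own'' [e] = 0")
  case True
  then have none: "e \<notin> H a" if "a \<le> M" for a using ow eN that by (auto simp: owners_def)
  have "owners N M (H(g := insert e (H g))) s'" if "ints s' ''own'' = (ints s ''own'')([e] := g)" for s'
    using ow that g(2,3) by (auto simp: owners_def)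
  moreover note overlap_insert_new[OF d none fin g(2)]
  ultimately show ?thesis using True c g l e unfolding elem_prog_def by (auto simp: abs_if)
next
  case False
  define o' where "o' = ints s ''own'' [e]"
  have o': "o' \<le> M" "e \<in> H o'" "o' \<noteq> 0" using ow eN False by (auto simp: owners_def o'_def)
  have og: "o' \<noteq> g" using o'(2) eN(2) by auto
  have un: "a = o'" if "a \<le> M" "a \<noteq> g" "e \<in> H a" for a using two[of a o'] that o' og by auto
  have "owners N M (H(g := insert e (H g))) s'" if "ints s' ''own'' = ints s ''own''" for s'
    using ow that g(2,3) False by (auto simp: owners_def)
  moreover note overlap_insert_shared[OF d fin g(2) eN(2) o'(2,1) un]
  ultimately show ?thesis using c g l e o'(3) og unfolding elem_prog_def by (auto simp: abs_if o'_def[symmetric])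
qed

definition clear_prog :: prog where
  "clear_prog =
     For ''e'' (IConst 1) (IPlus (V ''N'') (IConst 1)) (IWrite ''own'' [V ''e''] (IConst 0)) ;;
     For ''a'' (IConst 0) (IPlus (V ''M'') (IConst 1))
       (RWrite ''wt'' [V ''a''] (RConst 0) ;; IWrite ''deg'' [V ''a''] (IConst 0) ;; IWrite ''al'' [V ''a''] (IConst 1) ;;
        For ''c'' (IConst 0) (IPlus (V ''M'') (IConst 1))
          (RWrite ''W'' [V ''a'', V ''c''] (RConst 0) ;; IWrite ''adj'' [V ''a'', V ''c''] (IConst 0)))"

definition overlap_prog :: prog where
  "overlap_prog =
     For ''g'' (IConst 1) (IPlus (V ''M'') (IConst 1)) (For ''l'' (IConst 0) (IRead ''gsize'' [V ''g'']) elem_prog)"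

definition degree_prog :: prog where
  "degree_prog =
     For ''a'' (IConst 1) (IPlus (V ''M'') (IConst 1))
       (For ''c'' (IConst 1) (IPlus (V ''M'') (IConst 1))
          (IWrite ''deg'' [V ''a''] (IPlus (IRead ''deg'' [V ''a'']) (IRead ''adj'' [V ''a'', V ''c'']))))"

lemma iw_clear_prog [simp]: "iw v clear_prog \<longleftrightarrow> v \<in> {''e'', ''own'', ''a'', ''deg'', ''al'', ''c'', ''adj''}"
  and rw_clear_prog [simp]: "rw v clear_prog \<longleftrightarrow> v \<in> {''wt'', ''W''}"
  and iw_overlap_prog [simp]: "iw v overlap_prog \<longleftrightarrow> v \<in> {''g'', ''l'', ''e'', ''a'', ''adj'', ''own''}"
  and rw_overlap_prog [simp]: "rw v overlap_prog \<longleftrightarrow> v \<in> {''t'', ''wt'', ''W''}"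
  and iw_degree_prog [simp]: "iw v degree_prog \<longleftrightarrow> v \<in> {''a'', ''c'', ''deg''}"
  and rw_degree_prog [simp]: "\<not> rw v degree_prog"
  by (auto simp: clear_prog_def overlap_prog_def degree_prog_def)

lemma clear_prog:
  assumes N: "ints s ''N'' [] = N" and M: "ints s ''M'' [] = M" and T: "30 * N + (M + 1) * (30 * M + 100) + 30 \<le> T"
  shows "runs clear_prog s T (\<lambda>s'. overlap_data M (\<lambda>_. {}) c s' \<and> owners N M (\<lambda>_. {}) s' \<and>
     (\<forall>a\<le>M. ints s' ''deg'' [a] = 0 \<and> ints s' ''al'' [a] = 1))"
proof -
  let ?row = "For ''c'' (IConst 0) (IPlus (V ''M'') (IConst 1))
          (RWrite ''W'' [V ''a'', V ''c''] (RConst 0) ;; IWrite ''adj'' [V ''a'', V ''c''] (IConst 0))"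
  define I where "I = (\<lambda>n (s' :: memory). \<forall>a<n. reals s' ''wt'' [a] = 0 \<and> ints s' ''deg'' [a] = 0 \<and> ints s' ''al'' [a] = 1 \<and>
     (\<forall>c<M+1. reals s' ''W'' [a, c] = 0 \<and> ints s' ''adj'' [a, c] = 0))"
  have "runs clear_prog s (30 * N + (M + 1) * (30 * M + 100) + 30) (\<lambda>s'. owners N M (\<lambda>_. {}) s' \<and> I (M + 1) s')"
    unfolding clear_prog_def wp_Seq
  proof (rule wp_runs[OF runs_For[where lo = 1 and hi = "N + 1" and K = 4 and
          I = "\<lambda>n s'. \<forall>e\<in>{1..<n}. ints s' ''own'' [e] = 0", OF _ _ _ _ _ _ order_refl]], goal_cases)
    case (5 s')
    then show ?case using N by (simp add: frame_def)
  next
    case (8 s1 B1)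
    show ?case
    proof (rule runs_mono[OF runs_For[where lo = 0 and hi = "M + 1" and K = "(M + 1) * 25 + 30" and I = I, OF _ _ _ _ _ _ order_refl]], goal_cases)
      case 1
      show ?case by (simp add: I_def)
    next
      case (2 a s2)
      define s2' where "s2' = iupd ''al'' [a] 1 (iupd ''deg'' [a] 0 (rupd ''wt'' [a] 0 s2))"
      have u: "ints s2' ''M'' [] = M" "ints s2' ''a'' [] = a" using 2 8(2) M by (simp_all add: frame_def s2'_def)
      have "runs (?row) s2' ((M + 1) * 25 + 10)
          (\<lambda>s'. I a s' \<and> (\<forall>c<M+1. reals s' ''W'' [a, c] = 0 \<and> ints s' ''adj'' [a, c] = 0))"
      proof (rule runs_For[where lo = 0 and hi = "M + 1" and K = 12 and I = "\<lambda>n s'. I a s' \<and> (\<forall>c<n. reals s' ''W'' [a, c] = 0 \<and> ints s' ''adj'' [a, c] = 0)"], goal_cases)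
        case 1
        show ?case using 2(3) by (simp add: I_def s2'_def)
      next
        case (2 c s3)
        then have "ints s3 ''a'' [] = a" using u by (simp add: frame_def)
        with 2 show ?case by (auto simp: less_Suc_eq I_def)
      next
        case (5 s3)
        then show ?case using u by (simp add: frame_def)
      qed simp_all
      then have "runs (?row) s2' ((M + 1) * 25 + 10)
          (\<lambda>s'. I (Suc a) (iupd ''a'' [] (Suc a) s'))"
        by (rule runs_mono[OF _ order_refl]) (auto simp: I_def less_Suc_eq frame_def s2'_def)
      then show ?case using 2 by (auto simp: s2'_def elim!: wp_mono)
    next
      case (5 s2)
      then show ?case using M 8(2) by (simp add: frame_def)
    next
      case 7
      show ?case using 8(3) by (simp add: algebra_simps)
    next
      case (8 s2)
      have "ints s2 ''own'' = ints s1 ''own''" using 8(2) by (simp add: frame_def)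
      then show ?case using 8(1) \<open>\<forall>e\<in>{1..<N+1}. _ e\<close> by (simp add: owners_def)
    qed simp_all
  qed (auto simp: less_Suc_eq)
  then show ?thesis
    by (rule runs_mono[OF _ T]) (auto simp: I_def overlap_data_def)
qed

text \<open>The groups are read one after the other. After \<open>l\<close> entries of group \<open>g\<close>, the data describe the structure
\<open>part g l\<close>, in which group \<open>g\<close> is cut off and the later ones are still empty.\<close>

lemma overlap_prog:
  assumes gs: "group_structure N M G" and h: "holds_groups s N M G k"
    and d: "overlap_data M (\<lambda>_. {}) c s" "owners N M (\<lambda>_. {}) s"
    and c: "\<And>e. e \<in> {1..N} \<Longrightarrow> c e = \<bar>reals s ''b'' [e]\<bar>" and T: "300 * N + 30 * M + 30 \<le> T"
  shows "runs overlap_prog s T (\<lambda>s'. overlap_data M (real_groups G) c s')"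
proof -
  note h' = h[unfolded holds_groups_def]
  have l: "loopless M G" and U: "(\<Union>j\<in>{1..M}. G j) = {1..N}" using gs by (auto simp: group_structure_def)
  have sub: "G j \<subseteq> {1..N}" if "j \<in> {1..M}" for j using U that by blast
  define grp where "grp = ints s ''grp''"
  define part where "part = (\<lambda>g l a. if a = 0 then {} else if a < g then G a else if a = g then (\<lambda>l. grp [g, l]) ` {0..<l} else ({} :: nat set))"
  have bij: "bij_betw (\<lambda>l. grp [g, l]) {0..<card (G g)} (G g)" if "g \<in> {1..M}" for g
    using h' that by (simp add: grp_def)
  have part_sub: "part g l a \<subseteq> G a" if "a \<le> M" "l \<le> card (G g)" for g l a
  proof
    fix e assume e: "e \<in> part g l a"
    then consider "0 < a" "a < g" "e \<in> G a" | l' where "0 < a" "a = g" "l' < l" "e = grp [g, l']"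
      by (auto simp: part_def split: if_splits)
    then show "e \<in> G a"
    proof cases
      case 2
      then show ?thesis using bij_betw_apply[OF bij[of g], of l'] that by simp
    qed
  qed
  have part_fin: "a \<le> M \<Longrightarrow> finite (part g l a)" for g l a
    using finite_subset[OF sub[of a] finite_atLeastAtMost] by (auto simp: part_def)
  have "runs overlap_prog s ((\<Sum>g\<in>{1..<M + 1}. (card (G g) * 120 + 10) + 10) + 10)
      (\<lambda>s'. overlap_data M (part (M + 1) 0) c s' \<and> owners N M (part (M + 1) 0) s')"
    unfolding overlap_prog_def
  proof (rule runs_For_sum[where lo = 1 and hi = "M + 1" and K = "\<lambda>g. card (G g) * 120 + 10"], goal_cases)
    case 1
    have "part 1 0 = (\<lambda>_. {})" by (rule ext) (simp add: part_def)
    then show ?case using d by (auto simp: overlap_data_def owners_def split: if_splits)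
  next
    case (2 g s1)
    have g: "g \<in> {1..M}" using 2 by auto
    have u1: "ints s1 ''gsize'' [g] = card (G g)" "ints s1 ''grp'' = grp" "reals s1 ''b'' = reals s ''b''"
      using 2 h' g by (simp_all add: frame_def grp_def)
    have "runs (For ''l'' (IConst 0) (IRead ''gsize'' [V ''g'']) elem_prog) s1 (card (G g) * 120 + 10)
       (\<lambda>s'. overlap_data M (part g (card (G g))) c s' \<and> owners N M (part g (card (G g))) s')"
    proof (rule runs_For[where lo = 0 and hi = "card (G g)" and K = 100], goal_cases)
      case 1
      show ?case using 2(3) by (simp add: overlap_data_def owners_def)
    next
      case (2 l s2)
      define e where "e = grp [g, l]"
      have u2: "ints s2 ''g'' [] = g" "ints s2 ''grp'' = grp" "reals s2 ''b'' = reals s ''b''"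
        using 2 \<open>ints s1 ''g'' [] = g\<close> u1 by (simp_all add: frame_def)
      have eG: "e \<in> G g" using bij_betw_apply[OF bij[OF g], of l] 2 by (simp add: e_def)
      have new: "e \<notin> part g l g"
      proof
        assume "e \<in> part g l g"
        then obtain l' where "l' < l" "grp [g, l] = grp [g, l']" using g by (auto simp: part_def e_def)
        with inj_onD[OF bij_betw_imp_inj_on[OF bij[OF g]], of l l'] \<open>l < card (G g)\<close> show False by fastforce
      qed
      have "runs elem_prog s2 100 (\<lambda>s'. overlap_data M ((\<lambda>a. if a \<le> M then part g l a else {})(g := insert e ((\<lambda>a. if a \<le> M then part g l a else {}) g))) c s' \<and>
         owners N M ((\<lambda>a. if a \<le> M then part g l a else {})(g := insert e ((\<lambda>a. if a \<le> M then part g l a else {}) g))) s')"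
      proof (rule elem_prog[OF _ _ _ u2(1) _ _ 2(4)])
        show "overlap_data M (\<lambda>a. if a \<le> M then part g l a else {}) c s2"
          using 2(3) by (simp add: overlap_data_def)
        show "owners N M (\<lambda>a. if a \<le> M then part g l a else {}) s2"
          using 2(3) by (simp add: owners_def)
        show "finite (if a \<le> M then part g l a else {})" for a using part_fin by simp
        show "ints s2 ''grp'' [g, l] = e" by (simp add: u2 e_def)
        show "e \<in> {1..N}" using sub[OF g] eG by blast
        show "e \<notin> (if g \<le> M then part g l g else {})" using new by simp
        show "(if 0 \<le> M then part g l 0 else {}) = {}" by (simp add: part_def)
        show "c e = \<bar>reals s2 ''b'' [e]\<bar>" using c[of e] sub[OF g] eG u2(3) by auto
        fix a a' assume a: "a \<le> M" "a' \<le> M" "a \<noteq> g" "a' \<noteq> g" "e \<in> (if a \<le> M then part g l a else {})" "e \<in> (if a' \<le> M then part g l a' else {})"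
        then have "e \<in> G a" "e \<in> G a'" using part_sub[of a l g] part_sub[of a' l g] 2(2) by auto
        moreover have "a \<noteq> 0" "a' \<noteq> 0" using a by (auto simp: part_def split: if_splits)
        ultimately show "a = a'" using loopless_two_groups[OF l, of e g a a'] eG a g by auto
      qed (use g in auto)
      then show ?case
      proof (rule runs_mono[OF _ order_refl])
        fix s'
        define Q where "Q = (\<lambda>a. if a \<le> M then part g l a else {})(g := insert e ((\<lambda>a. if a \<le> M then part g l a else {}) g))"
        assume "overlap_data M ((\<lambda>a. if a \<le> M then part g l a else {})(g := insert e ((\<lambda>a. if a \<le> M then part g l a else {}) g))) c s' \<and>
          owners N M ((\<lambda>a. if a \<le> M then part g l a else {})(g := insert e ((\<lambda>a. if a \<le> M then part g l a else {}) g))) s'"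
        then have Q: "overlap_data M Q c s'" "owners N M Q s'" by (simp_all add: Q_def)
        have eq: "Q a = part g (Suc l) a" if "a \<le> M" for a
          using that g by (auto simp: Q_def part_def e_def atLeast0_lessThan_Suc)
        have "overlap_data M (part g (Suc l)) c s'" using Q(1) overlap_data_cong[of M Q "part g (Suc l)"] eq by simp
        moreover have "owners N M (part g (Suc l)) s'" using Q(2) owners_cong[of M Q "part g (Suc l)"] eq by simp
        ultimately show "overlap_data M (part g (Suc l)) c (iupd ''l'' [] (Suc l) s') \<and> owners N M (part g (Suc l)) (iupd ''l'' [] (Suc l) s')"
          by (simp add: overlap_data_def owners_def)
      qed
    next
      case (5 s2)
      then show ?case using u1 \<open>ints s1 ''g'' [] = g\<close> by (simp add: frame_def)
    qed simp_all
    moreover have "part g (card (G g)) = part (Suc g) 0"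
      using bij[OF g] by (auto simp: part_def bij_betw_def fun_eq_iff less_Suc_eq)
    ultimately show ?case by simp
  next
    case (5 s1)
    then show ?case using h' by (simp add: frame_def)
  qed simp_all
  moreover have "overlap_data M (part (M + 1) 0) c s' \<longleftrightarrow> overlap_data M (real_groups G) c s'" for s'
    by (rule overlap_data_cong) (auto simp: part_def real_groups_def)
  moreover have "(\<Sum>g\<in>{1..<M + 1}. (card (G g) * 120 + 10) + 10) + 10 \<le> T"
  proof -
    have "{1..<M + 1} = {1..M}" by auto
    then have "(\<Sum>g\<in>{1..<M + 1}. (card (G g) * 120 + 10) + 10) = (\<Sum>g\<in>{1..M}. card (G g)) * 120 + M * 20"
      by (simp add: sum.distrib sum_distrib_right)
    then show ?thesis using sum_group_sizes[OF gs] T by simp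
  qed
  ultimately show ?thesis by (auto elim!: runs_mono)
qed

lemma degree_prog:
  assumes M: "ints s ''M'' [] = M" and z: "\<And>a. a \<le> M \<Longrightarrow> ints s ''deg'' [a] = 0" and T: "M * (30 * M + 30) + 30 \<le> T"
  shows "runs degree_prog s T (\<lambda>s'. \<forall>a\<in>{1..M}. ints s' ''deg'' [a] = (\<Sum>c\<in>{1..M}. ints s ''adj'' [a, c]))"
proof -
  have "runs degree_prog s (M * (30 * M + 30) + 30) (\<lambda>s'. \<forall>a\<in>{1..M}. ints s' ''deg'' [a] = (if a < M + 1 then \<Sum>c\<in>{1..<M + 1}. ints s ''adj'' [a, c] else 0))"
    unfolding degree_prog_def
  proof (rule runs_For[where lo = 1 and hi = "M + 1" and K = "M * 25 + 10" and
      I = "\<lambda>n s'. \<forall>a\<in>{1..M}. ints s' ''deg'' [a] = (if a < n then \<Sum>c\<in>{1..<M + 1}. ints s ''adj'' [a, c] else 0)"], goal_cases)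
    case 1
    show ?case using z by simp
  next
    case (2 a s1)
    have u1: "ints s1 ''adj'' = ints s ''adj''" "ints s1 ''M'' [] = M" using 2 M by (simp_all add: frame_def)
    show ?case
    proof (rule runs_mono[OF runs_For[where lo = 1 and hi = "M + 1" and K = 14 and
        I = "\<lambda>n s'. \<forall>a'\<in>{1..M}. ints s' ''deg'' [a'] = (if a' < a then \<Sum>c\<in>{1..<M + 1}. ints s ''adj'' [a', c] else
           if a' = a then \<Sum>c\<in>{1..<n}. ints s ''adj'' [a', c] else 0)", OF _ _ _ _ _ _ order_refl]], goal_cases)
      case 1
      show ?case using 2(3) by simp
    next
      case (2 c s2)
      have "ints s2 ''adj'' = ints s ''adj''" "ints s2 ''a'' [] = a" using 2 u1 \<open>ints s1 ''a'' [] = a\<close> by (simp_all add: frame_def)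
      then show ?case using 2 \<open>1 \<le> a\<close> \<open>a < M + 1\<close> by auto
    next
      case (5 s2)
      then show ?case using u1 by (simp add: frame_def)
    next
      case (8 s2)
      then show ?case by auto
    qed simp_all
  next
    case (5 s1)
    then show ?case using M by (simp add: frame_def)
  next
    case 7
    show ?case by (simp add: algebra_simps)
  qed simp_all
  moreover have "{1..<M + 1} = {1..M}" by auto
  ultimately show ?thesis by (elim runs_mono[OF _ T]) auto
qed

section \<open>Tables of best selections\<close>

text \<open>For a cluster that consists of the centre \<open>v\<close> alone, the best selection is empty or \<open>v\<close>. The second index of \<open>A\<close> and \<open>S\<close>
says whether the centre is selected, and \<open>S\<close> stores the selections as characteristic vectors.\<close>

definition init_prog :: prog where
  "init_prog =
     For ''v'' (IConst 0) (IPlus (V ''M'') (IConst 1))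
       (For ''j'' (IConst 0) (IPlus (V ''k'') (IConst 1))
         (RWrite ''A'' [V ''v'', IConst 0, V ''j''] (RConst 0) ;;
          RWrite ''A'' [V ''v'', IConst 1, V ''j''] (RRead ''wt'' [V ''v'']) ;;
          For ''u'' (IConst 0) (IPlus (V ''M'') (IConst 1))
            (IWrite ''S'' [V ''v'', IConst 0, V ''j'', V ''u''] (IConst 0) ;;
             IWrite ''S'' [V ''v'', IConst 1, V ''j'', V ''u''] (IConst 0)) ;;
          IWrite ''S'' [V ''v'', IConst 1, V ''j'', V ''v''] (IConst 1)))"

lemma iw_init_prog [simp]: "iw v init_prog \<longleftrightarrow> v \<in> {''v'', ''j'', ''u'', ''S''}"
  and rw_init_prog [simp]: "rw v init_prog \<longleftrightarrow> v = ''A''"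
  by (auto simp: init_prog_def)

lemma init_prog:
  assumes M: "ints s ''M'' [] = M" and k: "ints s ''k'' [] = k" and w: "\<And>v. v \<le> M \<Longrightarrow> reals s ''wt'' [v] = w v"
    and T: "60 * (M + 2) * (M + 2) * (k + 2) \<le> T"
  shows "runs init_prog s T (\<lambda>s'. \<forall>v\<le>M. \<forall>j\<le>k. reals s' ''A'' [v, 0, j] = 0 \<and> reals s' ''A'' [v, 1, j] = w v \<and>
     (\<forall>u\<le>M. ints s' ''S'' [v, 0, j, u] = 0 \<and> ints s' ''S'' [v, 1, j, u] = (if u = v then 1 else 0)))"
proof -
  let ?clear = "For ''u'' (IConst 0) (IPlus (V ''M'') (IConst 1))
            (IWrite ''S'' [V ''v'', IConst 0, V ''j'', V ''u''] (IConst 0) ;;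
             IWrite ''S'' [V ''v'', IConst 1, V ''j'', V ''u''] (IConst 0))"
  define cell where "cell = (\<lambda>(s' :: memory) v j. reals s' ''A'' [v, 0, j] = 0 \<and> reals s' ''A'' [v, 1, j] = w v \<and>
     (\<forall>u<M+1. ints s' ''S'' [v, 0, j, u] = 0 \<and> ints s' ''S'' [v, 1, j, u] = (if u = v then 1 else 0)))"
  define KJ where "KJ = (M + 1) * 30 + 60"
  define KV where "KV = (k + 1) * (KJ + 10) + 10"
  have "runs init_prog s ((M + 1) * (KV + 10) + 10) (\<lambda>s'. \<forall>v<M+1. \<forall>j<k+1. cell s' v j)"
    unfolding init_prog_def
  proof (rule runs_For[where lo = 0 and hi = "M + 1" and K = KV], goal_cases)
    case (2 v s1)
    have u1: "ints s1 ''k'' [] = k" "ints s1 ''M'' [] = M" "reals s1 ''wt'' [v] = w v"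
      using 2 M k w[of v] by (simp_all add: frame_def)
    have "runs (For ''j'' (IConst 0) (IPlus (V ''k'') (IConst 1))
         (RWrite ''A'' [V ''v'', IConst 0, V ''j''] (RConst 0) ;;
          RWrite ''A'' [V ''v'', IConst 1, V ''j''] (RRead ''wt'' [V ''v'']) ;;
          ?clear ;;
          IWrite ''S'' [V ''v'', IConst 1, V ''j'', V ''v''] (IConst 1))) s1 KV
        (\<lambda>s'. (\<forall>v'<v. \<forall>j<k+1. cell s' v' j) \<and> (\<forall>j<k+1. cell s' v j))"
    proof (rule runs_For[where lo = 0 and hi = "k + 1" and K = KJ and
        I = "\<lambda>n s'. (\<forall>v'<v. \<forall>j<k+1. cell s' v' j) \<and> (\<forall>j<n. cell s' v j)"], goal_cases)
      case 1
      show ?case using 2(3) by (simp add: cell_def)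
    next
      case (2 j s2)
      have u2: "ints s2 ''v'' [] = v" "ints s2 ''M'' [] = M" "reals s2 ''wt'' [v] = w v"
        using 2 u1 \<open>ints s1 ''v'' [] = v\<close> by (simp_all add: frame_def)
      define s2' where "s2' = rupd ''A'' [v, 1, j] (w v) (rupd ''A'' [v, 0, j] 0 s2)"
      have u2': "ints s2' ''v'' [] = v" "ints s2' ''M'' [] = M" "ints s2' ''j'' [] = j" using u2 2(4) by (simp_all add: s2'_def)
      have "runs (?clear) s2' ((M + 1) * 30 + 10)
          (\<lambda>s'. (\<forall>v' j'. [v', j'] \<noteq> [v, j] \<longrightarrow> (\<forall>q u. ints s' ''S'' [v', q, j', u] = ints s2 ''S'' [v', q, j', u])) \<and>
             (\<forall>u<M+1. ints s' ''S'' [v, 0, j, u] = 0 \<and> ints s' ''S'' [v, 1, j, u] = 0))"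
      proof (rule runs_For[where lo = 0 and hi = "M + 1" and K = 16 and
            I = "\<lambda>n s'. (\<forall>v' j'. [v', j'] \<noteq> [v, j] \<longrightarrow> (\<forall>q u. ints s' ''S'' [v', q, j', u] = ints s2 ''S'' [v', q, j', u])) \<and>
             (\<forall>u<n. ints s' ''S'' [v, 0, j, u] = 0 \<and> ints s' ''S'' [v, 1, j, u] = 0)"], goal_cases)
        case 1
        show ?case by (simp add: s2'_def)
      next
        case (2 u s3)
        then have "ints s3 ''v'' [] = v" "ints s3 ''j'' [] = j" using u2' by (simp_all add: frame_def)
        with 2 show ?case by (auto simp: less_Suc_eq)
      next
        case (5 s3)
        then show ?case using u2' by (simp add: frame_def)
      qed simp_all
      then have "wp (?clear)
          (wp (IWrite ''S'' [V ''v'', IConst 1, V ''j'', V ''v''] (IConst 1))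
             (\<lambda>s' _. (\<forall>v'<v. \<forall>j'<k+1. cell (iupd ''j'' [] (Suc j) s') v' j') \<and> (\<forall>j'<Suc j. cell (iupd ''j'' [] (Suc j) s') v j'))) s2' B"
        if B: "(M + 1) * 30 + 30 \<le> B" for B
      proof (rule wp_runs, goal_cases)
        case 1 show ?case using that by simp
      next
        case (2 s4 B4)
        have u4: "ints s4 ''v'' [] = v" "ints s4 ''j'' [] = j" using 2(2) u2' by (simp_all add: frame_def)
        have A4: "reals s4 ''A'' = (reals s2 ''A'')([v, 0, j] := 0, [v, 1, j] := w v)"
          using 2(2) by (simp add: frame_def s2'_def)
        have S4: "ints s4 ''S'' [v', q, j', u] = ints s2 ''S'' [v', q, j', u]" if "v' \<noteq> v \<or> j' \<noteq> j" for v' q j' u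
          using 2(1) that by auto
        have c1: "cell (iupd ''j'' [] (Suc j) (iupd ''S'' [v, 1, j, v] 1 s4)) v' j'" if "cell s2 v' j'" "v' \<noteq> v \<or> j' \<noteq> j" for v' j'
          using that S4[OF that(2)] by (auto simp: cell_def A4)
        have c2: "cell (iupd ''j'' [] (Suc j) (iupd ''S'' [v, 1, j, v] 1 s4)) v j"
          using 2(1) by (simp add: cell_def A4)
        have "\<forall>v'<v. \<forall>j<k+1. cell s2 v' j" "\<forall>j'<j. cell s2 v j'"
          using \<open>(\<forall>v'<v. \<forall>j<k+1. cell s2 v' j) \<and> (\<forall>j'<j. cell s2 v j')\<close> by blast+
        then have "(\<forall>v'<v. \<forall>j'<k+1. cell (iupd ''j'' [] (Suc j) (iupd ''S'' [v, 1, j, v] 1 s4)) v' j') \<and>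
          (\<forall>j'<Suc j. cell (iupd ''j'' [] (Suc j) (iupd ''S'' [v, 1, j, v] 1 s4)) v j')"
          using c1 c2 by (simp add: less_Suc_eq)
        then show ?case using 2(3) B u4 by auto
      qed
      then show ?case using u2 \<open>ints s2 ''j'' [] = j\<close> by (simp add: s2'_def KJ_def)
    next
      case (5 s2)
      then show ?case using u1 by (simp add: frame_def)
    next
      case 7
      show ?case by (simp add: KV_def algebra_simps)
    qed simp_all
    then show ?case by (elim runs_mono) (simp_all add: cell_def less_Suc_eq)
  next
    case (5 s1)
    then show ?case using M by (simp add: frame_def)
  next
    case 7
    show ?case by (simp add: algebra_simps)
  qed simp_all
  moreover have "(M + 1) * (KV + 10) + 10 \<le> T" using T by (simp add: KV_def KJ_def algebra_simps)
  ultimately show ?thesis by (elim runs_mono) (simp_all add: cell_def less_Suc_eq_le)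
qed

text \<open>The loop over the number \<open>l\<close> of groups, besides its centre \<open>c\<close>, that the merged cluster may use. If \<open>c\<close> is selected as
well then \<open>l + 1\<close> groups are charged, which is possible only for \<open>l < j\<close>.\<close>

definition split_prog :: prog where
  "split_prog =
     For ''l'' (IConst 0) (IPlus (V ''j'') (IConst 1))
       (RWrite ''t'' [] (RPlus (RRead ''A'' [V ''v'', V ''s'', IMinus (V ''j'') (V ''l'')]) (RRead ''A'' [V ''c'', IConst 0, V ''l''])) ;;
        Cond (RLess (RRead ''best'' []) (RRead ''t'' []))
          (RWrite ''best'' [] (RRead ''t'' []) ;; IWrite ''bl'' [] (V ''l'') ;; IWrite ''bs'' [] (IConst 0)) Skip ;;
        Cond (ILess (V ''l'') (V ''j''))
          (RWrite ''t'' [] (RMinus (RPlus (RRead ''A'' [V ''v'', V ''s'', IMinus (IMinus (V ''j'') (V ''l'')) (IConst 1)])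
             (RRead ''A'' [V ''c'', IConst 1, V ''l''])) (RRead ''pen'' [])) ;;
           Cond (RLess (RRead ''best'' []) (RRead ''t'' []))
             (RWrite ''best'' [] (RRead ''t'' []) ;; IWrite ''bl'' [] (V ''l'') ;; IWrite ''bs'' [] (IConst 1)) Skip)
          Skip)"

text \<open>The union of two disjoint selections. Entries are tested for being positive only, so adding them is enough.\<close>

definition copy_prog :: prog where
  "copy_prog =
     For ''u'' (IConst 0) (IPlus (V ''M'') (IConst 1))
       (IWrite ''S'' [V ''v'', V ''s'', V ''j'', V ''u'']
          (IPlus (IRead ''S'' [V ''v'', V ''s'', IMinus (IMinus (V ''j'') (V ''bl'')) (V ''bs''), V ''u''])
             (IRead ''S'' [V ''c'', V ''bs'', V ''bl'', V ''u''])))"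

definition cluster_cell_prog :: prog where
  "cluster_cell_prog =
     Cond (ILess (IConst 0) (V ''s'')) (RWrite ''pen'' [] (RRead ''W'' [V ''v'', V ''c''])) (RWrite ''pen'' [] (RConst 0)) ;;
     RWrite ''best'' [] (RPlus (RRead ''A'' [V ''v'', V ''s'', V ''j'']) (RRead ''A'' [V ''c'', IConst 0, IConst 0])) ;;
     IWrite ''bl'' [] (IConst 0) ;; IWrite ''bs'' [] (IConst 0) ;;
     split_prog ;;
     RWrite ''A'' [V ''v'', V ''s'', V ''j''] (RRead ''best'' []) ;;
     copy_prog"

lemma iw_split_prog [simp]: "iw v split_prog \<longleftrightarrow> v \<in> {''bl'', ''bs'', ''l''}"
  and rw_split_prog [simp]: "rw v split_prog \<longleftrightarrow> v \<in> {''best'', ''t''}"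
  and iw_copy_prog [simp]: "iw v copy_prog \<longleftrightarrow> v \<in> {''u'', ''S''}"
  and rw_copy_prog [simp]: "\<not> rw v copy_prog"
  by (auto simp: split_prog_def copy_prog_def)

lemma iw_cluster_cell_prog [simp]: "iw v cluster_cell_prog \<longleftrightarrow> v \<in> {''bl'', ''bs'', ''l'', ''u'', ''S''}"
  and rw_cluster_cell_prog [simp]: "rw v cluster_cell_prog \<longleftrightarrow> v \<in> {''pen'', ''best'', ''t'', ''A''}"
  by (auto simp: cluster_cell_prog_def)

lemma cluster_cell_prog:
  assumes i: "ints s ''v'' [] = v" "ints s ''c'' [] = c" "ints s ''s'' [] = sl" "ints s ''j'' [] = j" "ints s ''M'' [] = M"
    and vc: "v \<noteq> c"
    and val: "\<And>q l. val q l = reals s ''A'' [v, sl, j - l - q] + reals s ''A'' [c, q, l] - (if 0 < sl \<and> 0 < q then reals s ''W'' [v, c] else 0)"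
    and T: "120 * (j + 1) + 60 * (M + 1) + 100 \<le> T"
  shows "runs cluster_cell_prog s T (\<lambda>s'. \<exists>bs bl. bs \<le> 1 \<and> bl + bs \<le> j \<and> (\<forall>q l. q \<le> 1 \<and> l + q \<le> j \<longrightarrow> val q l \<le> val bs bl) \<and>
     reals s' ''A'' = (reals s ''A'')([v, sl, j] := val bs bl) \<and>
     (\<forall>w q i u. ints s' ''S'' [w, q, i, u] = (if w = v \<and> q = sl \<and> i = j \<and> u < M + 1
        then ints s ''S'' [v, sl, j - bl - bs, u] + ints s ''S'' [c, bs, bl, u] else ints s ''S'' [w, q, i, u])))"
proof -
  define Post where "Post = (\<lambda>(s' :: memory). \<exists>bs bl. bs \<le> 1 \<and> bl + bs \<le> j \<and> (\<forall>q l. q \<le> 1 \<and> l + q \<le> j \<longrightarrow> val q l \<le> val bs bl) \<and>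
     reals s' ''A'' = (reals s ''A'')([v, sl, j] := val bs bl) \<and>
     (\<forall>w q i u. ints s' ''S'' [w, q, i, u] = (if w = v \<and> q = sl \<and> i = j \<and> u < M + 1
        then ints s ''S'' [v, sl, j - bl - bs, u] + ints s ''S'' [c, bs, bl, u] else ints s ''S'' [w, q, i, u])))"
  define I where "I = (\<lambda>n (s' :: memory). ints s' ''bs'' [] \<le> 1 \<and> ints s' ''bl'' [] + ints s' ''bs'' [] \<le> j \<and>
     reals s' ''best'' [] = val (ints s' ''bs'' []) (ints s' ''bl'' []) \<and>
     (\<forall>q l. q \<le> 1 \<and> l < n \<and> l + q \<le> j \<longrightarrow> val q l \<le> reals s' ''best'' []))"
  define pen where "pen = (if 0 < sl then reals s ''W'' [v, c] else 0)"
  define s1 where "s1 = iupd ''bs'' [] 0 (iupd ''bl'' [] 0 (rupd ''best'' [] (val 0 0) (rupd ''pen'' [] pen s)))"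
  have ch: "runs split_prog s1 (120 * (j + 1) + 20) (I (j + 1))"
    unfolding split_prog_def
  proof (rule runs_For[where lo = 0 and hi = "j + 1" and K = 100 and I = I], goal_cases)
    case 1
    show ?case by (simp add: I_def s1_def)
  next
    case (2 l s2)
    have u: "ints s2 ''v'' [] = v" "ints s2 ''c'' [] = c" "ints s2 ''s'' [] = sl" "ints s2 ''j'' [] = j"
      "reals s2 ''A'' = reals s ''A''" "reals s2 ''pen'' [] = pen" "ints s2 ''l'' [] = l"
      using 2 i by (simp_all add: frame_def s1_def)
    have v0: "val 0 l = reals s ''A'' [v, sl, j - l] + reals s ''A'' [c, 0, l]"
      and v1: "val (Suc 0) l = reals s ''A'' [v, sl, j - Suc l] + reals s ''A'' [c, Suc 0, l] - pen"
      by (simp_all add: val pen_def)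
    have ext: "val q l' \<le> x"
      if that': "\<And>q l'. q \<le> 1 \<Longrightarrow> l' < l \<Longrightarrow> l' + q \<le> j \<Longrightarrow> val q l' \<le> x" "val 0 l \<le> x" "l < j \<Longrightarrow> val (Suc 0) l \<le> x"
         "q \<le> 1 \<and> l' < Suc l \<and> l' + q \<le> j" for x q l'
    proof -
      consider "l' < l" | "l' = l" "q = 0" | "l' = l" "q = 1" "l < j" using that'(4) by linarith
      then show "val q l' \<le> x"
      proof cases
        case 1
        then show ?thesis using that'(1,4) by blast
      qed (use that'(2,3) in auto)
    qed
    define best where "best = reals s2 ''best'' []"
    have I1: "ints s2 ''bs'' [] \<le> 1" "ints s2 ''bl'' [] + ints s2 ''bs'' [] \<le> j" "best = val (ints s2 ''bs'' []) (ints s2 ''bl'' [])"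
      and I2: "\<And>q l'. q \<le> 1 \<Longrightarrow> l' < l \<Longrightarrow> l' + q \<le> j \<Longrightarrow> val q l' \<le> best"
      using 2(3) by (auto simp: I_def best_def)
    have J: "I (Suc l) s'" if "ints s' ''bs'' [] \<le> 1" "ints s' ''bl'' [] + ints s' ''bs'' [] \<le> j"
        "reals s' ''best'' [] = val (ints s' ''bs'' []) (ints s' ''bl'' [])" "best \<le> reals s' ''best'' []"
        "val 0 l \<le> reals s' ''best'' []" "l < j \<Longrightarrow> val (Suc 0) l \<le> reals s' ''best'' []" for s'
      unfolding I_def using that ext[of "reals s' ''best'' []"] I2 by (blast intro: order_trans)
    show ?case
      using I1(1,2) v0 v1 \<open>l < j + 1\<close>
      by (auto simp: u not_less I1(3)[symmetric] simp flip: best_def intro!: J)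
  next
    case (5 s2)
    then show ?case using i by (simp add: frame_def s1_def)
  qed simp_all
  have cp: "runs copy_prog s3 (60 * (M + 1) + 20) (\<lambda>s'. \<forall>w q i u. ints s' ''S'' [w, q, i, u] = (if w = v \<and> q = sl \<and> i = j \<and> u < M + 1
        then ints s ''S'' [v, sl, j - bl - bs, u] + ints s ''S'' [c, bs, bl, u] else ints s ''S'' [w, q, i, u]))"
    if u: "ints s3 ''v'' [] = v" "ints s3 ''c'' [] = c" "ints s3 ''s'' [] = sl" "ints s3 ''j'' [] = j" "ints s3 ''M'' [] = M"
      "ints s3 ''bs'' [] = bs" "ints s3 ''bl'' [] = bl" "ints s3 ''S'' = ints s ''S''" for s3 bs bl
    unfolding copy_prog_def
  proof (rule runs_For[where lo = 0 and hi = "M + 1" and K = 40 and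
       I = "\<lambda>n s'. \<forall>w q i u. ints s' ''S'' [w, q, i, u] = (if w = v \<and> q = sl \<and> i = j \<and> u < n
        then ints s ''S'' [v, sl, j - bl - bs, u] + ints s ''S'' [c, bs, bl, u] else ints s ''S'' [w, q, i, u])"], goal_cases)
    case 1
    show ?case by (simp add: u)
  next
    case (2 n s4)
    have u4: "ints s4 ''v'' [] = v" "ints s4 ''c'' [] = c" "ints s4 ''s'' [] = sl" "ints s4 ''j'' [] = j"
      "ints s4 ''bs'' [] = bs" "ints s4 ''bl'' [] = bl"
      using 2 u by (simp_all add: frame_def)
    have "ints s4 ''S'' [v, sl, j - bl - bs, n] = ints s ''S'' [v, sl, j - bl - bs, n]"
      "ints s4 ''S'' [c, bs, bl, n] = ints s ''S'' [c, bs, bl, n]"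
      using 2(3) vc by simp_all
    then show ?case using 2(3,4) by (simp add: u4 less_Suc_eq)
  next
    case (5 s4)
    then show ?case using u by (simp add: frame_def)
  qed simp_all
  have main: "wp (split_prog ;; RWrite ''A'' [V ''v'', V ''s'', V ''j''] (RRead ''best'' []) ;; copy_prog) (\<lambda>s' _. Post s') s1 B"
    if B: "120 * (j + 1) + 60 * (M + 1) + 60 \<le> B" for B
    unfolding wp_Seq
  proof (rule wp_runs[OF ch], goal_cases)
    case 1
    show ?case using B by simp
  next
    case (2 s2 B2)
    define bs where "bs = ints s2 ''bs'' []"
    define bl where "bl = ints s2 ''bl'' []"
    have u: "ints s2 ''v'' [] = v" "ints s2 ''c'' [] = c" "ints s2 ''s'' [] = sl" "ints s2 ''j'' [] = j" "ints s2 ''M'' [] = M"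
      "ints s2 ''S'' = ints s ''S''" "reals s2 ''A'' = reals s ''A''"
      using 2(2) i by (simp_all add: frame_def s1_def)
    have best: "bs \<le> 1" "bl + bs \<le> j" "reals s2 ''best'' [] = val bs bl" "\<forall>q l. q \<le> 1 \<and> l + q \<le> j \<longrightarrow> val q l \<le> val bs bl"
      using 2(1) by (auto simp: I_def bs_def bl_def)
    define s3 where "s3 = rupd ''A'' [v, sl, j] (val bs bl) s2"
    have "runs copy_prog s3 B3 Post" if "B2 \<le> B3 + 10" for B3
    proof (rule runs_mono[OF cp[of s3 bs bl]], goal_cases)
      case 9
      show ?case using B 2(3) that by simp
    next
      case (10 s')
      have "reals s' ''A'' = (reals s ''A'')([v, sl, j] := val bs bl)"
        using 10(2) u by (simp add: frame_def s3_def)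
      with 10(1) best show ?case unfolding Post_def by blast
    qed (simp_all add: s3_def u bs_def bl_def)
    moreover have "10 \<le> B2" using 2(3) B by simp
    ultimately show ?case by (simp add: u best(3) s3_def)
  qed
  have v00: "val 0 0 = reals s ''A'' [v, sl, j] + reals s ''A'' [c, 0, 0]" by (simp add: val)
  have "runs cluster_cell_prog s (120 * (j + 1) + 60 * (M + 1) + 100) Post"
    using i main unfolding cluster_cell_prog_def by (auto simp: s1_def pen_def v00)
  then show ?thesis unfolding Post_def by (rule runs_mono[OF _ T])
qed

definition selected :: "nat \<Rightarrow> memory \<Rightarrow> nat \<Rightarrow> nat \<Rightarrow> nat \<Rightarrow> nat set" where
  "selected M s v q j = {u \<in> {0..M}. 0 < ints s ''S'' [v, q, j, u]}"

definition table_ok :: "nat \<Rightarrow> (nat \<Rightarrow> nat set) \<Rightarrow> (nat \<Rightarrow> real) \<Rightarrow> nat \<Rightarrow> memory \<Rightarrow> nat \<Rightarrow> nat set \<Rightarrow> bool" where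
  "table_ok M H w k s v C \<longleftrightarrow> (\<forall>q\<le>1. \<forall>j\<le>k. best_selection H w v C (0 < q) j (selected M s v q j) (reals s ''A'' [v, q, j]))"

text \<open>The budgets \<open>j\<close> are treated in descending order. An entry depends on entries of \<open>v\<close> with budget at most \<open>j\<close>, so the
table of \<open>v\<close> can be overwritten in place.\<close>

definition cluster_merge_prog :: prog where
  "cluster_merge_prog =
     For ''s'' (IConst 0) (IConst 2)
       (For ''i'' (IConst 0) (IPlus (V ''k'') (IConst 1))
          (IWrite ''j'' [] (IMinus (V ''k'') (V ''i'')) ;; cluster_cell_prog))"

lemma iw_cluster_merge_prog [simp]: "iw v cluster_merge_prog \<longleftrightarrow> v \<in> {''s'', ''i'', ''j'', ''bl'', ''bs'', ''l'', ''u'', ''S''}"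
  and rw_cluster_merge_prog [simp]: "rw v cluster_merge_prog \<longleftrightarrow> v \<in> {''pen'', ''best'', ''t'', ''A''}"
  by (auto simp: cluster_merge_prog_def)

lemma cluster_merge_prog:
  assumes i: "ints s ''v'' [] = v" "ints s ''c'' [] = c" "ints s ''M'' [] = M" "ints s ''k'' [] = k"
    and fin: "finite C1" "finite C2" "\<And>j. finite (H j)"
    and disj: "C1 \<inter> C2 = {}" "v \<in> C1" "c \<in> C2"
    and sep: "\<And>a b. a \<in> C1 \<Longrightarrow> b \<in> C2 \<Longrightarrow> H a \<inter> H b \<noteq> {} \<Longrightarrow> a = v \<and> b = c"
    and tab: "table_ok M H w k s v C1" "table_ok M H w k s c C2" and W: "reals s ''W'' [v, c] = sum w (H v \<inter> H c)"
    and T: "2 * (k + 1) * (120 * (k + 1) + 60 * (M + 1) + 150) + 100 \<le> T"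
  shows "runs cluster_merge_prog s T (\<lambda>s'. table_ok M H w k s' v (C1 \<union> C2) \<and>
     (\<forall>x q j. x \<noteq> v \<and> j \<le> k \<longrightarrow> reals s' ''A'' [x, q, j] = reals s ''A'' [x, q, j] \<and>
        (\<forall>u. ints s' ''S'' [x, q, j, u] = ints s ''S'' [x, q, j, u])))"
proof -
  have vc: "v \<noteq> c" using disj by auto
  define same where "same = (\<lambda>(s' :: memory) x q j. reals s' ''A'' [x, q, j] = reals s ''A'' [x, q, j] \<and>
        (\<forall>u. ints s' ''S'' [x, q, j, u] = ints s ''S'' [x, q, j, u]))"
  define new where "new = (\<lambda>(s' :: memory) q j. best_selection H w v (C1 \<union> C2) (0 < q) j (selected M s' v q j) (reals s' ''A'' [v, q, j]))"
  define I where "I = (\<lambda>(d :: nat \<Rightarrow> nat \<Rightarrow> bool) s'. (\<forall>x q j. j \<le> k \<and> \<not> (x = v \<and> d q j) \<longrightarrow> same s' x q j) \<and>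
     (\<forall>q j. q \<le> 1 \<and> j \<le> k \<and> d q j \<longrightarrow> new s' q j))"
  have I_cong: "I d' s'" if "I d s'" "\<And>q j. j \<le> k \<Longrightarrow> d' q j \<longleftrightarrow> d q j" for d d' s'
    using that(1) unfolding I_def by (simp add: that(2) cong: conj_cong)
  have I_mem: "I d s'' \<longleftrightarrow> I d s'" if "ints s'' ''S'' = ints s' ''S''" "reals s'' ''A'' = reals s' ''A''" for d s' s''
    unfolding I_def same_def new_def selected_def that ..
  define KC where "KC = 120 * (k + 1) + 60 * (M + 1) + 120"
  define KI where "KI = (k + 1) * (KC + 10) + 10"
  have "runs cluster_merge_prog s (2 * (KI + 10) + 10) (I (\<lambda>q j. q < 2))"
    unfolding cluster_merge_prog_def
  proof (rule runs_For[where lo = 0 and hi = 2 and K = KI and I = "\<lambda>n. I (\<lambda>q j. q < n)"], goal_cases)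
    case 1
    show ?case by (simp add: I_def same_def)
  next
    case (2 sl s1)
    have u1: "ints s1 ''v'' [] = v" "ints s1 ''c'' [] = c" "ints s1 ''M'' [] = M" "ints s1 ''k'' [] = k" "reals s1 ''W'' = reals s ''W''"
      using 2 i by (simp_all add: frame_def)
    \<comment> \<open>the entries that have already been replaced after \<open>n\<close> steps of the inner loop\<close>
    define d where "d = (\<lambda>n q j. q < sl \<or> q = sl \<and> k < j + n)"
    have "runs (For ''i'' (IConst 0) (IPlus (V ''k'') (IConst 1))
          (IWrite ''j'' [] (IMinus (V ''k'') (V ''i'')) ;; cluster_cell_prog)) s1 KI (I (d (k + 1)))"
    proof (rule runs_For[where lo = 0 and hi = "k + 1" and K = KC and I = "\<lambda>n. I (d n)"], goal_cases)
      case 1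
      have "I (d 0) s1" by (rule I_cong[OF 2(3)]) (auto simp: d_def)
      then show ?case by (simp add: I_mem[of "iupd ''i'' [] 0 s1" s1])
    next
      case (2 n s3)
      define j where "j = k - n"
      define s3' where "s3' = iupd ''j'' [] j s3"
      have u3: "ints s3' ''v'' [] = v" "ints s3' ''c'' [] = c" "ints s3' ''M'' [] = M" "ints s3' ''s'' [] = sl" "ints s3' ''j'' [] = j"
        "reals s3' ''W'' = reals s ''W''" "ints s3 ''k'' [] = k"
        "ints s3' ''S'' = ints s3 ''S''" "reals s3' ''A'' = reals s3 ''A''"
        using 2 u1 \<open>ints s1 ''s'' [] = sl\<close> by (simp_all add: frame_def s3'_def)
      have n: "j \<le> k" "j + n = k" using 2(2) by (simp_all add: j_def)
      have old: "same s3 x q j'" if "j' \<le> k" "\<not> (x = v \<and> d n q j')" for x q j'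
        using 2(3) that unfolding I_def by blast
      define val where "val = (\<lambda>q l. reals s ''A'' [v, sl, j - l - q] + reals s ''A'' [c, q, l] -
         (if 0 < sl \<and> 0 < q then sum w (H v \<inter> H c) else 0))"
      define val3 where "val3 = (\<lambda>q l. reals s3' ''A'' [v, sl, j - l - q] + reals s3' ''A'' [c, q, l] -
         (if 0 < sl \<and> 0 < q then reals s3' ''W'' [v, c] else 0))"
      have dn: "\<not> d n sl j'" if "j' \<le> j" for j' using that n by (simp add: d_def)
      have val: "val3 q l = val q l" if "l + q \<le> j" for q l
      proof -
        have "same s3 v sl (j - l - q)" by (rule old) (use n dn[of "j - l - q"] in auto)
        moreover have "same s3 c q l" by (rule old) (use n that vc in auto)
        ultimately show ?thesis by (simp add: val_def val3_def u3 same_def W)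
      qed
      have sel: "selected M s3 v sl (j - l) = selected M s v sl (j - l)" "l \<le> k \<Longrightarrow> selected M s3 c q l = selected M s c q l" for q l
        using old[of "j - l" v sl] old[of l c q] dn[of "j - l"] n vc by (auto simp: selected_def same_def)
      have "runs cluster_cell_prog s3' (120 * (j + 1) + 60 * (M + 1) + 100) (\<lambda>s'. \<exists>bs bl. bs \<le> 1 \<and> bl + bs \<le> j \<and> (\<forall>q l. q \<le> 1 \<and> l + q \<le> j \<longrightarrow> val3 q l \<le> val3 bs bl) \<and>
         reals s' ''A'' = (reals s3' ''A'')([v, sl, j] := val3 bs bl) \<and>
         (\<forall>w q i u. ints s' ''S'' [w, q, i, u] = (if w = v \<and> q = sl \<and> i = j \<and> u < M + 1
            then ints s3' ''S'' [v, sl, j - bl - bs, u] + ints s3' ''S'' [c, bs, bl, u] else ints s3' ''S'' [w, q, i, u])))"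
        by (rule cluster_cell_prog[OF u3(1,2,4,5,3) vc val3_def[THEN fun_cong, THEN fun_cong] order_refl])
      then have "runs cluster_cell_prog s3' (KC - 10) (I (d (Suc n)))"
      proof (rule runs_mono)
        show "120 * (j + 1) + 60 * (M + 1) + 100 \<le> KC - 10" using n by (simp add: KC_def)
        fix s4 :: memory
        assume "\<exists>bs bl. bs \<le> 1 \<and> bl + bs \<le> j \<and> (\<forall>q l. q \<le> 1 \<and> l + q \<le> j \<longrightarrow> val3 q l \<le> val3 bs bl) \<and>
         reals s4 ''A'' = (reals s3' ''A'')([v, sl, j] := val3 bs bl) \<and>
         (\<forall>w q i u. ints s4 ''S'' [w, q, i, u] = (if w = v \<and> q = sl \<and> i = j \<and> u < M + 1
            then ints s3' ''S'' [v, sl, j - bl - bs, u] + ints s3' ''S'' [c, bs, bl, u] else ints s3' ''S'' [w, q, i, u]))"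
        then obtain bs bl where b: "bs \<le> 1" "bl + bs \<le> j" "\<And>q l. q \<le> 1 \<Longrightarrow> l + q \<le> j \<Longrightarrow> val3 q l \<le> val3 bs bl"
          and A4: "reals s4 ''A'' = (reals s3 ''A'')([v, sl, j] := val3 bs bl)"
          and S4: "\<And>x q i u. ints s4 ''S'' [x, q, i, u] = (if x = v \<and> q = sl \<and> i = j \<and> u < M + 1
            then ints s3 ''S'' [v, sl, j - bl - bs, u] + ints s3 ''S'' [c, bs, bl, u] else ints s3 ''S'' [x, q, i, u])"
          unfolding u3 by blast
        have "best_selection H w v (C1 \<union> C2) (0 < sl) j (selected M s v sl (j - bl - bs) \<union> selected M s c bs bl) (val bs bl)"
        proof (rule merge_selection[OF fin disj sep])
          show "best_selection H w v C1 (0 < sl) j (selected M s v sl j) (reals s ''A'' [v, sl, j])" if "j \<le> k" for j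
            using tab(1) that \<open>sl < 2\<close> by (simp add: table_ok_def)
          show "best_selection H w c C2 (0 < q) j (selected M s c q j) (reals s ''A'' [c, q, j])" if "q \<le> 1" "j \<le> k" for q j
            using tab(2) that by (simp add: table_ok_def)
          show "val q l \<le> val bs bl" if "q \<le> 1" "l + q \<le> j" for q l
            using b(3)[OF that] val[OF that(2)] val[OF b(2)] by simp
        qed (use n b in \<open>simp_all add: val_def\<close>)
        moreover have "selected M s4 v sl j = selected M s v sl (j - bl - bs) \<union> selected M s c bs bl"
        proof -
          have "selected M s4 v sl j = selected M s3 v sl (j - bl - bs) \<union> selected M s3 c bs bl"
            by (auto simp: selected_def S4 less_Suc_eq_le)
          then show ?thesis using sel(1)[of "bl + bs"] sel(2)[of bl bs] b(2) n by simp
        qed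
        ultimately have new4: "new s4 sl j" using val[OF b(2)] by (simp add: new_def A4)
        have keep: "reals s4 ''A'' [x, q, j'] = reals s3 ''A'' [x, q, j'] \<and> (\<forall>u. ints s4 ''S'' [x, q, j', u] = ints s3 ''S'' [x, q, j', u])"
          if "\<not> (x = v \<and> q = sl \<and> j' = j)" for x q j'
          using that by (auto simp: A4 S4)
        have dS: "d (Suc n) q j' \<longleftrightarrow> d n q j' \<or> q = sl \<and> j' = j" if "j' \<le> k" for q j'
          using that n by (auto simp: d_def)
        show "I (d (Suc n)) s4"
          unfolding I_def
        proof (intro conjI allI impI)
          fix x q j' assume a: "j' \<le> k \<and> \<not> (x = v \<and> d (Suc n) q j')"
          then have "\<not> (x = v \<and> q = sl \<and> j' = j)" "\<not> (x = v \<and> d n q j')" using dS by auto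
          then show "same s4 x q j'" using old[of j' x q] keep[of x q j'] a by (simp add: same_def)
        next
          fix q j' assume a: "q \<le> 1 \<and> j' \<le> k \<and> d (Suc n) q j'"
          show "new s4 q j'"
          proof (cases "q = sl \<and> j' = j")
            case False
            then have "d n q j'" using a dS by auto
            then have "new s3 q j'" using 2(3) a unfolding I_def by blast
            then show ?thesis using keep[of v q j'] False by (simp add: new_def selected_def)
          qed (use new4 in simp)
        qed
      qed
      then have "runs cluster_cell_prog s3' (KC - 10) (\<lambda>s''. I (d (Suc n)) (iupd ''i'' [] (Suc n) s''))"
        by (rule runs_mono[OF _ order_refl]) (simp add: I_mem[of "iupd ''i'' [] (Suc n) _"])
      then show ?case using u3(7) 2(4) by (auto simp: s3'_def j_def KC_def elim!: wp_mono)
    next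
      case (5 s3)
      then show ?case using u1 by (simp add: frame_def)
    next
      case 7
      show ?case by (simp add: KI_def algebra_simps)
    qed simp_all
    then show ?case
    proof (rule runs_mono[OF _ order_refl])
      fix s' assume "I (d (k + 1)) s'"
      then have "I (\<lambda>q j. q < Suc sl) s'" by (rule I_cong) (auto simp: d_def)
      then show "I (\<lambda>q j. q < Suc sl) (iupd ''s'' [] (Suc sl) s')" by (simp add: I_mem[of "iupd ''s'' [] (Suc sl) s'" s'])
    qed
  qed simp_all
  moreover have "2 * (KI + 10) + 10 \<le> T" using T by (simp add: KI_def KC_def algebra_simps)
  ultimately show ?thesis
  proof (rule runs_mono)
    fix s' assume I: "I (\<lambda>q j. q < 2) s'"
    then have "new s' q j" if "q \<le> 1" "j \<le> k" for q j using that unfolding I_def by simp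
    then have "table_ok M H w k s' v (C1 \<union> C2)" by (simp add: table_ok_def new_def)
    moreover have "same s' x q j" if "x \<noteq> v" "j \<le> k" for x q j using I that unfolding I_def by blast
    ultimately show "table_ok M H w k s' v (C1 \<union> C2) \<and>
     (\<forall>x q j. x \<noteq> v \<and> j \<le> k \<longrightarrow> reals s' ''A'' [x, q, j] = reals s ''A'' [x, q, j] \<and>
        (\<forall>u. ints s' ''S'' [x, q, j, u] = ints s ''S'' [x, q, j, u]))"
      unfolding same_def by blast
  qed
qed

section \<open>Elimination of groups\<close>

definition leaf_prog :: prog where
  "leaf_prog =
     IWrite ''c'' [] (IConst 0) ;;
     For ''u'' (IConst 1) (IPlus (V ''M'') (IConst 1))
       (Cond (BAnd (ILess (IConst 0) (IRead ''al'' [V ''u''])) (ILess (IRead ''deg'' [V ''u'']) (IConst 2)))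
          (IWrite ''c'' [] (V ''u'')) Skip)"

definition detach_prog :: prog where
  "detach_prog =
     IWrite ''al'' [V ''c''] (IConst 0) ;;
     IWrite ''v'' [] (IConst 0) ;;
     For ''u'' (IConst 1) (IPlus (V ''M'') (IConst 1))
       (Cond (BAnd (ILess (IConst 0) (IRead ''al'' [V ''u''])) (ILess (IConst 0) (IRead ''adj'' [V ''c'', V ''u''])))
          (IWrite ''v'' [] (V ''u'') ;;
           IWrite ''deg'' [V ''u''] (IMinus (IRead ''deg'' [V ''u'']) (IConst 1))) Skip)"

lemma iw_leaf_prog [simp]: "iw v leaf_prog \<longleftrightarrow> v \<in> {''c'', ''u''}"
  and rw_leaf_prog [simp]: "\<not> rw v leaf_prog"
  and iw_detach_prog [simp]: "iw v detach_prog \<longleftrightarrow> v \<in> {''al'', ''v'', ''u'', ''deg''}"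
  and rw_detach_prog [simp]: "\<not> rw v detach_prog"
  by (auto simp: leaf_prog_def detach_prog_def)

lemma leaf_prog:
  assumes M: "ints s ''M'' [] = M" and R: "R \<subseteq> {1..M}" "\<And>u. u \<in> {1..M} \<Longrightarrow> 0 < ints s ''al'' [u] \<longleftrightarrow> u \<in> R"
    and leaf: "\<exists>u\<in>R. ints s ''deg'' [u] < 2" and T: "40 * M + 20 \<le> T"
  shows "runs leaf_prog s T (\<lambda>s'. ints s' ''c'' [] \<in> R \<and> ints s ''deg'' [ints s' ''c'' []] < 2)"
proof -
  define good where "good = (\<lambda>u. u \<in> R \<and> ints s ''deg'' [u] < 2)"
  have "runs leaf_prog s (40 * M + 20) (\<lambda>s'. (if \<exists>u\<in>{1..<M + 1}. good u then good (ints s' ''c'' []) else True))"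
    unfolding leaf_prog_def wp_Seq wp_IWrite
  proof (intro conjI, goal_cases)
    case 1 show ?case by simp
  next
    case 2
    show ?case
    proof (rule runs_For[where lo = 1 and hi = "M + 1" and K = 20 and
        I = "\<lambda>n s'. if \<exists>u\<in>{1..<n}. good u then good (ints s' ''c'' []) else True"], goal_cases)
      case (2 u s1)
      have "ints s1 ''al'' [u] = ints s ''al'' [u]" "ints s1 ''deg'' [u] = ints s ''deg'' [u]"
        using 2(5) by (simp_all add: frame_def)
      moreover have "(0 < ints s ''al'' [u] \<and> ints s ''deg'' [u] < 2) = good u" using R(2)[of u] 2 by (auto simp: good_def)
      moreover have "(\<exists>u'\<in>{1..<Suc u}. good u') = (good u \<or> (\<exists>u'\<in>{1..<u}. good u'))" using 2(1) by (auto simp: less_Suc_eq)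
      ultimately show ?case using 2(3,4) by (auto split: if_splits)
    next
      case (5 s1)
      then show ?case using M by (simp add: frame_def)
    qed simp_all
  qed
  then show ?thesis
  proof (rule runs_mono[OF _ T])
    fix s' assume a: "if \<exists>u\<in>{1..<M + 1}. good u then good (ints s' ''c'' []) else True"
    obtain u where u: "u \<in> R" "ints s ''deg'' [u] < 2" using leaf by blast
    then have "u \<in> {1..<M + 1}" "good u" using R(1) by (auto simp: good_def)
    then have "\<exists>u\<in>{1..<M + 1}. good u" by blast
    with a show "ints s' ''c'' [] \<in> R \<and> ints s ''deg'' [ints s' ''c'' []] < 2" by (simp add: good_def)
  qed
qed

lemma detach_prog:
  assumes M: "ints s ''M'' [] = M" and R: "R \<subseteq> {1..M}" "\<And>u. u \<in> {1..M} \<Longrightarrow> 0 < ints s ''al'' [u] \<longleftrightarrow> u \<in> R"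
    and c: "ints s ''c'' [] = c" "c \<in> R"
    and uniq: "\<And>x y. x \<in> R \<Longrightarrow> y \<in> R \<Longrightarrow> 0 < ints s ''adj'' [c, x] \<Longrightarrow> 0 < ints s ''adj'' [c, y] \<Longrightarrow> x = y"
    and T: "40 * M + 30 \<le> T"
  shows "runs detach_prog s T (\<lambda>s'. ints s' ''v'' [] \<in> insert 0 (R - {c}) \<and>
     (\<forall>u\<in>{1..M}. 0 < ints s' ''al'' [u] \<longleftrightarrow> u \<in> R - {c}) \<and>
     (\<forall>x\<in>R - {c}. 0 < ints s ''adj'' [c, x] \<longrightarrow> x = ints s' ''v'' []) \<and>
     (\<forall>x\<in>R - {c}. ints s' ''deg'' [x] = ints s ''deg'' [x] - (if 0 < ints s ''adj'' [c, x] then 1 else 0)))"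
proof -
  let ?loop = "For ''u'' (IConst 1) (IPlus (V ''M'') (IConst 1))
       (Cond (BAnd (ILess (IConst 0) (IRead ''al'' [V ''u''])) (ILess (IConst 0) (IRead ''adj'' [V ''c'', V ''u''])))
          (IWrite ''v'' [] (V ''u'') ;;
           IWrite ''deg'' [V ''u''] (IMinus (IRead ''deg'' [V ''u'']) (IConst 1))) Skip)"
  define adj where "adj = (\<lambda>x. 0 < ints s ''adj'' [c, x])"
  define I where "I = (\<lambda>n (s' :: memory). ints s' ''v'' [] \<in> insert 0 (R - {c}) \<and>
     (\<forall>x\<in>R - {c}. x < n \<and> adj x \<longrightarrow> x = ints s' ''v'' []) \<and>
     (\<forall>x\<in>R - {c}. ints s' ''deg'' [x] = ints s ''deg'' [x] - (if x < n \<and> adj x then 1 else 0)))"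
  have c0: "c \<in> {1..M}" using c R by auto
  have "runs detach_prog s (40 * M + 30) (\<lambda>s'. I (M + 1) s' \<and> ints s' ''al'' = (ints s ''al'')([c] := 0))"
    unfolding detach_prog_def wp_Seq wp_IWrite
  proof (intro conjI, goal_cases)
    case 1 show ?case by simp
  next
    case 2 show ?case by simp
  next
    case 3
    define s1 where "s1 = iupd ''v'' [] 0 (iupd ''al'' [c] 0 s)"
    have "runs (?loop) s1 (20 + 40 * M) (I (M + 1))"
    proof (rule runs_For[where lo = 1 and hi = "M + 1" and K = 30 and I = I], goal_cases)
      case 1
      show ?case using R(1) by (auto simp: I_def s1_def)
    next
      case (2 u s2)
      have u: "ints s2 ''al'' [u] = ints (iupd ''al'' [c] 0 s) ''al'' [u]" "ints s2 ''adj'' = ints s ''adj''" "ints s2 ''c'' [] = c"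
        using 2(5) c by (simp_all add: frame_def s1_def)
      have al: "0 < ints (iupd ''al'' [c] 0 s) ''al'' [u] \<longleftrightarrow> u \<in> R - {c}" using R(2)[of u] 2 by auto
      have b: "(0 < ints s2 ''al'' [u] \<and> 0 < ints s2 ''adj'' [c, u]) \<longleftrightarrow> u \<in> R - {c} \<and> adj u"
        unfolding u al adj_def by simp
      have I: "ints s2 ''v'' [] \<in> insert 0 (R - {c})" "\<And>x. x \<in> R - {c} \<Longrightarrow> x < u \<Longrightarrow> adj x \<Longrightarrow> x = ints s2 ''v'' []"
        "\<And>x. x \<in> R - {c} \<Longrightarrow> ints s2 ''deg'' [x] = ints s ''deg'' [x] - (if x < u \<and> adj x then 1 else 0)"
        using 2(3) by (auto simp: I_def)
      show ?case
      proof (cases "u \<in> R - {c} \<and> adj u")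
        case True
        have "I (Suc u) (iupd ''u'' [] (Suc u) (iupd ''deg'' [u] (ints s2 ''deg'' [u] - 1) (iupd ''v'' [] u s2)))"
          unfolding I_def
        proof (intro conjI ballI impI)
          fix x assume x: "x \<in> R - {c}"
          { assume "x < Suc u \<and> adj x"
            then have "x = u" using uniq[of x u] x True by (auto simp: adj_def)
            then show "x = ints (iupd ''u'' [] (Suc u) (iupd ''deg'' [u] (ints s2 ''deg'' [u] - 1) (iupd ''v'' [] u s2))) ''v'' []"
              by simp }
          show "ints (iupd ''u'' [] (Suc u) (iupd ''deg'' [u] (ints s2 ''deg'' [u] - 1) (iupd ''v'' [] u s2))) ''deg'' [x] =
            ints s ''deg'' [x] - (if x < Suc u \<and> adj x then 1 else 0)"
            using I(3)[OF x] True by (auto simp: less_Suc_eq)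
        qed (use True in simp)
        then show ?thesis using b True 2(4) u(3) by simp
      next
        case False
        have "I (Suc u) (iupd ''u'' [] (Suc u) s2)"
          unfolding I_def
        proof (intro conjI ballI impI)
          fix x assume x: "x \<in> R - {c}"
          { assume "x < Suc u \<and> adj x"
            then have "x < u" using x False by (auto simp: less_Suc_eq)
            with I(2)[OF x] \<open>x < Suc u \<and> adj x\<close> show "x = ints (iupd ''u'' [] (Suc u) s2) ''v'' []" by simp }
          have "(x < Suc u \<and> adj x) = (x < u \<and> adj x)" using x False by (auto simp: less_Suc_eq)
          with I(3)[OF x] show "ints (iupd ''u'' [] (Suc u) s2) ''deg'' [x] = ints s ''deg'' [x] - (if x < Suc u \<and> adj x then 1 else 0)"
            by simp
        qed (use I(1) in simp)
        then show ?thesis using b False 2(4) u(3) by auto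
      qed
    next
      case (5 s2)
      then show ?case using M by (simp add: frame_def s1_def)
    qed simp_all
    then have "runs (?loop) s1 B
         (\<lambda>s'. I (M + 1) s' \<and> ints s' ''al'' = (ints s ''al'')([c] := 0))" if "20 + 40 * M \<le> B" for B
      using that by (rule runs_mono) (auto simp: s1_def frame_def)
    then show ?case using c by (simp add: s1_def)
  qed
  then show ?thesis
  proof (rule runs_mono[OF _ T])
    fix s' assume a: "I (M + 1) s' \<and> ints s' ''al'' = (ints s ''al'')([c] := 0)"
    have lt: "x < M + 1" if "x \<in> R - {c}" for x using that R(1) by auto
    have "\<forall>u\<in>{1..M}. 0 < ints s' ''al'' [u] \<longleftrightarrow> u \<in> R - {c}" using a R(2) by auto
    with a lt show "ints s' ''v'' [] \<in> insert 0 (R - {c}) \<and>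
     (\<forall>u\<in>{1..M}. 0 < ints s' ''al'' [u] \<longleftrightarrow> u \<in> R - {c}) \<and>
     (\<forall>x\<in>R - {c}. 0 < ints s ''adj'' [c, x] \<longrightarrow> x = ints s' ''v'' []) \<and>
     (\<forall>x\<in>R - {c}. ints s' ''deg'' [x] = ints s ''deg'' [x] - (if 0 < ints s ''adj'' [c, x] then 1 else 0))"
      unfolding I_def adj_def by simp
  qed
qed

text \<open>The invariant of the elimination with remaining groups \<open>R\<close>: \<open>deg\<close> counts the remaining neighbours of a remaining group,
and the tables belong to some clustering with the centres \<open>R\<close> and \<open>0\<close>.\<close>

definition elim_inv :: "nat \<Rightarrow> (nat \<Rightarrow> nat set) \<Rightarrow> (nat \<Rightarrow> real) \<Rightarrow> nat \<Rightarrow> nat set \<Rightarrow> memory \<Rightarrow> bool" where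
  "elim_inv M H w k R s \<longleftrightarrow> overlap_data M H w s \<and> (\<forall>u\<in>{1..M}. 0 < ints s ''al'' [u] \<longleftrightarrow> u \<in> R) \<and>
     (\<forall>u\<in>R. ints s ''deg'' [u] = card {x \<in> R. 0 < ints s ''adj'' [u, x]}) \<and>
     (\<exists>C. clustering M H R C \<and> (\<forall>v\<in>insert 0 R. table_ok M H w k s v (C v)))"

definition elim_prog :: prog where
  "elim_prog = leaf_prog ;; detach_prog ;; cluster_merge_prog"

lemma iw_elim_prog [simp]:
    "iw v elim_prog \<longleftrightarrow> v \<in> {''c'', ''u'', ''al'', ''v'', ''deg'', ''s'', ''i'', ''j'', ''bl'', ''bs'', ''l'', ''S''}"
  and rw_elim_prog [simp]: "rw v elim_prog \<longleftrightarrow> v \<in> {''pen'', ''best'', ''t'', ''A''}"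
  by (auto simp: elim_prog_def)

text \<open>The selected group \<open>c\<close> has at most one remaining neighbour. If it has none, it is merged into the empty group \<open>0\<close>, whose
overlaps are all zero.\<close>

lemma elim_prog:
  assumes M: "ints s ''M'' [] = M" and k: "ints s ''k'' [] = k" and inv: "elim_inv M H w k R s"
    and H: "H 0 = {}" "\<And>j. finite (H j)" and leaf: "\<exists>u\<in>R. card {x \<in> R. 0 < ints s ''adj'' [u, x]} \<le> 1"
    and T: "80 * M + 2 * (k + 1) * (120 * (k + 1) + 60 * (M + 1) + 150) + 150 \<le> T"
  shows "runs elim_prog s T (\<lambda>s'. \<exists>u\<in>R. elim_inv M H w k (R - {u}) s')"
proof -
  have ov: "overlap_data M H w s" and al: "\<And>u. u \<in> {1..M} \<Longrightarrow> 0 < ints s ''al'' [u] \<longleftrightarrow> u \<in> R"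
    and deg: "\<And>u. u \<in> R \<Longrightarrow> ints s ''deg'' [u] = card {x \<in> R. 0 < ints s ''adj'' [u, x]}"
    using inv by (simp_all add: elim_inv_def)
  obtain C where C: "clustering M H R C" and tab: "\<And>v. v \<in> insert 0 R \<Longrightarrow> table_ok M H w k s v (C v)"
    using inv unfolding elim_inv_def by blast
  have R: "R \<subseteq> {1..M}" using C unfolding clustering_def by (elim conjE)
  have fin: "finite R" using R finite_subset by blast
  have Csub: "C x \<subseteq> {0..M}" "x \<in> C x" if "x \<in> insert 0 R" for x
  proof -
    have "(\<Union>v\<in>insert 0 R. C v) = {0..M}" using C unfolding clustering_def by (elim conjE)
    moreover have "\<forall>v\<in>insert 0 R. v \<in> C v" using C unfolding clustering_def by (elim conjE)
    ultimately show "C x \<subseteq> {0..M}" "x \<in> C x" using that by (blast, blast)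
  qed
  have adj: "ints s ''adj'' [a, b] = (if H a \<inter> H b = {} then 0 else 1)" "reals s ''W'' [a, b] = sum w (H a \<inter> H b)"
    if "a \<le> M" "b \<le> M" "a \<noteq> b" for a b using ov that by (auto simp: overlap_data_def)
  have adj0: "ints s ''adj'' [a, a] = 0" if "a \<le> M" for a using ov that by (simp add: overlap_data_def)
  have leaf': "\<exists>u\<in>R. ints s ''deg'' [u] < 2"
  proof -
    obtain u where "u \<in> R" "card {x \<in> R. 0 < ints s ''adj'' [u, x]} \<le> 1" using leaf by blast
    then show ?thesis using deg[of u] by (intro bexI[of _ u], simp_all)
  qed
  have leaf_ok: "runs leaf_prog s (40 * M + 20) (\<lambda>s'. ints s' ''c'' [] \<in> R \<and> ints s ''deg'' [ints s' ''c'' []] < 2)"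
    by (rule leaf_prog[OF M R _ leaf' order_refl]) (rule al)
  show ?thesis unfolding elim_prog_def wp_Seq
  proof (rule wp_runs[OF leaf_ok], goal_cases)
    case 1 show ?case using T by simp
  next
    case (2 s1 B1)
    note 3 = 2
    define c where "c = ints s1 ''c'' []"
    have c: "c \<in> R" "ints s ''deg'' [c] < 2" using 3(1) by (simp_all add: c_def)
    have u1: "ints s1 ''M'' [] = M" "ints s1 ''al'' = ints s ''al''" "ints s1 ''adj'' = ints s ''adj''" "ints s1 ''deg'' = ints s ''deg''"
      using 3(2) M by (simp_all add: frame_def)
    have uniq: "x = y" if "x \<in> R" "y \<in> R" "0 < ints s1 ''adj'' [c, x]" "0 < ints s1 ''adj'' [c, y]" for x y
    proof -
      have "card {x \<in> R. 0 < ints s ''adj'' [c, x]} \<le> Suc 0" using deg[OF c(1)] c(2) by simp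
      moreover have "x \<in> {x \<in> R. 0 < ints s ''adj'' [c, x]}" "y \<in> {x \<in> R. 0 < ints s ''adj'' [c, x]}"
        using that u1 by simp_all
      ultimately show ?thesis using fin card_le_Suc0_iff_eq[of "{x \<in> R. 0 < ints s ''adj'' [c, x]}"] by simp
    qed
    have al1: "0 < ints s1 ''al'' [u] \<longleftrightarrow> u \<in> R" if "u \<in> {1..M}" for u using al[OF that] u1 by simp
    have detach_ok: "runs detach_prog s1 (40 * M + 30) (\<lambda>s'. ints s' ''v'' [] \<in> insert 0 (R - {c}) \<and>
       (\<forall>u\<in>{1..M}. 0 < ints s' ''al'' [u] \<longleftrightarrow> u \<in> R - {c}) \<and>
       (\<forall>x\<in>R - {c}. 0 < ints s1 ''adj'' [c, x] \<longrightarrow> x = ints s' ''v'' []) \<and>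
       (\<forall>x\<in>R - {c}. ints s' ''deg'' [x] = ints s1 ''deg'' [x] - (if 0 < ints s1 ''adj'' [c, x] then 1 else 0)))"
      by (rule detach_prog[OF u1(1) R _ c_def[symmetric] c(1) _ order_refl]) (fact al1, rule uniq)
    show ?case
    proof (rule wp_runs[OF detach_ok], goal_cases)
      case 1 show ?case using T \<open>_ \<le> B1 + _\<close> by simp
    next
      case (2 s2 B2)
      note 7 = 2
      define v where "v = ints s2 ''v'' []"
      have v: "v \<in> insert 0 (R - {c})" and al2: "\<And>u. u \<in> {1..M} \<Longrightarrow> 0 < ints s2 ''al'' [u] \<longleftrightarrow> u \<in> R - {c}"
        and v_nb: "\<And>x. x \<in> R - {c} \<Longrightarrow> 0 < ints s ''adj'' [c, x] \<Longrightarrow> x = v"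
        and deg2: "\<And>x. x \<in> R - {c} \<Longrightarrow> ints s2 ''deg'' [x] = ints s ''deg'' [x] - (if 0 < ints s ''adj'' [c, x] then 1 else 0)"
        using 7(1) by (auto simp: v_def u1)
      have u2: "ints s2 ''v'' [] = v" "ints s2 ''c'' [] = c" "ints s2 ''M'' [] = M" "ints s2 ''k'' [] = k"
        "ints s2 ''adj'' = ints s ''adj''" "reals s2 ''W'' = reals s ''W''" "ints s2 ''S'' = ints s ''S''" "reals s2 ''A'' = reals s ''A''"
        "reals s2 ''wt'' = reals s ''wt''"
        using 7(2) 3(2) u1 M k by (simp_all add: frame_def v_def c_def)
      have v': "v \<in> insert 0 R" "v \<noteq> c" "v \<le> M" "c \<le> M" using v c R by auto
      have nb: "x = v" if "x \<in> R - {c}" "H c \<inter> H x \<noteq> {}" for x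
      proof (rule v_nb[OF that(1)])
        have "c \<le> M" "x \<le> M" "c \<noteq> x" using that R c by auto
        then show "0 < ints s ''adj'' [c, x]" using adj(1)[of c x] that(2) by simp
      qed
      have cm1: "clustering M H (R - {c}) (C(v := C v \<union> C c))"
        by (rule clustering_merge(1)[OF C H(1) c(1) v]) (rule nb)
      have cm2: "a = v \<and> b = c" if "a \<in> C v" "b \<in> C c" "H a \<inter> H b \<noteq> {}" for a b
        by (rule clustering_merge(2)[OF C H(1) c(1) v _ that]) (rule nb)
      have cm3: "C v \<inter> C c = {}"
        by (rule clustering_merge(3)[OF C H(1) c(1) v]) (rule nb)
      have tab2: "table_ok M H w k s2 x (C x)" if "x \<in> insert 0 R" for x
        using tab[OF that] by (simp add: table_ok_def selected_def u2)
      have fC: "finite (C v)" "finite (C c)"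
        using finite_subset[OF Csub(1)[OF v'(1)]] finite_subset[OF Csub(1)[of c]] c(1) by simp_all
      have cR: "c \<in> insert 0 R" using c(1) by simp
      have "runs cluster_merge_prog s2 (2 * (k + 1) * (120 * (k + 1) + 60 * (M + 1) + 150) + 100) (\<lambda>s'. table_ok M H w k s' v (C v \<union> C c) \<and>
         (\<forall>x q j. x \<noteq> v \<and> j \<le> k \<longrightarrow> reals s' ''A'' [x, q, j] = reals s2 ''A'' [x, q, j] \<and>
            (\<forall>u. ints s' ''S'' [x, q, j, u] = ints s2 ''S'' [x, q, j, u])))"
        by (rule cluster_merge_prog[OF u2(1-4) fC H(2) cm3 Csub(2)[OF v'(1)] Csub(2)[OF cR] _ tab2[OF v'(1)] tab2[OF cR] _ order_refl])
          (fact cm2, use adj(2)[OF v'(3,4,2)] u2 in simp)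
      then show ?case
      proof (rule runs_mono, goal_cases)
        case 1
        show ?case using T 3(3) 7(3) by simp
      next
        case (2 s3)
        note 13 = 2
        have u3: "ints s3 ''adj'' = ints s ''adj''" "ints s3 ''al'' = ints s2 ''al''" "ints s3 ''deg'' = ints s2 ''deg''"
          "reals s3 ''W'' = reals s ''W''" "reals s3 ''wt'' = reals s ''wt''"
          using 13(2) u2 by (simp_all add: frame_def)
        have "overlap_data M H w s3" using ov by (simp add: overlap_data_def u3)
        moreover have "\<forall>u\<in>{1..M}. 0 < ints s3 ''al'' [u] \<longleftrightarrow> u \<in> R - {c}" using al2 u3 by simp
        moreover have "\<forall>u\<in>R - {c}. ints s3 ''deg'' [u] = card {x \<in> R - {c}. 0 < ints s3 ''adj'' [u, x]}"
        proof
          fix u assume u: "u \<in> R - {c}"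
          then have uc: "u \<le> M" "c \<le> M" "u \<noteq> c" using R c by auto
          have sym: "ints s ''adj'' [u, c] = ints s ''adj'' [c, u]" using adj(1)[of u c] adj(1)[of c u] uc by (simp add: Int_commute)
          have eq: "{x \<in> R - {c}. 0 < ints s ''adj'' [u, x]} = {x \<in> R. 0 < ints s ''adj'' [u, x]} - {c}" by auto
          have "card ({x \<in> R. 0 < ints s ''adj'' [u, x]} - {c}) =
            card {x \<in> R. 0 < ints s ''adj'' [u, x]} - (if 0 < ints s ''adj'' [c, u] then 1 else 0)"
            using fin c(1) by (simp add: card_Diff_singleton_if sym)
          then show "ints s3 ''deg'' [u] = card {x \<in> R - {c}. 0 < ints s3 ''adj'' [u, x]}"
            using deg2[OF u] deg[of u] u eq by (simp add: u3)
        qed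
        moreover have "\<forall>x\<in>insert 0 (R - {c}). table_ok M H w k s3 x ((C(v := C v \<union> C c)) x)"
        proof
          fix x assume x: "x \<in> insert 0 (R - {c})"
          show "table_ok M H w k s3 x ((C(v := C v \<union> C c)) x)"
          proof (cases "x = v")
            case True
            then show ?thesis using 13(1) by simp
          next
            case False
            have "table_ok M H w k s2 x (C x)" by (rule tab2) (use x in auto)
            then show ?thesis using 13(1) False by (simp add: table_ok_def selected_def)
          qed
        qed
        ultimately have "elim_inv M H w k (R - {c}) s3" using cm1 unfolding elim_inv_def by blast
        then show ?case using c(1) by blast
      qed
    qed
  qed
qed

section \<open>The group projection\<close>

definition output_prog :: prog where
  "output_prog =
     For ''e'' (IConst 1) (IPlus (V ''N'') (IConst 1)) (RWrite ''x'' [V ''e''] (RConst 0)) ;;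
     For ''g'' (IConst 1) (IPlus (V ''M'') (IConst 1))
       (Cond (ILess (IConst 0) (IRead ''S'' [IConst 0, IConst 0, V ''k'', V ''g'']))
          (For ''l'' (IConst 0) (IRead ''gsize'' [V ''g''])
             (RWrite ''x'' [IRead ''grp'' [V ''g'', V ''l'']] (RRead ''b'' [IRead ''grp'' [V ''g'', V ''l'']])))
          Skip)"

lemma iw_output_prog [simp]: "iw v output_prog \<longleftrightarrow> v \<in> {''e'', ''g'', ''l''}"
  and rw_output_prog [simp]: "rw v output_prog \<longleftrightarrow> v = ''x''"
  by (auto simp: output_prog_def)

lemma output_prog:
  assumes gs: "group_structure N M G" and h: "holds_groups s N M G k"
    and b: "b = (\<lambda>i. reals s ''b'' [i])" and T: "200 * N + 50 * M + 50 \<le> T"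
  shows "runs output_prog s T (\<lambda>s'. \<forall>i\<in>{1..N}. reals s' ''x'' [i] =
     (if i \<in> (\<Union>g\<in>{g \<in> {1..M}. 0 < ints s ''S'' [0, 0, k, g]}. G g) then b i else 0))"
proof -
  note h' = h[unfolded holds_groups_def]
  define J where "J = {g \<in> {1..M}. 0 < ints s ''S'' [0, 0, k, g]}"
  have bij: "bij_betw (\<lambda>l. ints s ''grp'' [g, l]) {0..<card (G g)} (G g)" if "g \<in> {1..M}" for g
    using h' that by simp
  have "runs output_prog s (N * 15 + (\<Sum>g\<in>{1..<M + 1}. (card (G g) * 30 + 25) + 10) + 30)
      (\<lambda>s'. \<forall>i\<in>{1..N}. reals s' ''x'' [i] = (if i \<in> (\<Union>g\<in>J \<inter> {1..<M + 1}. G g) then b i else 0))"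
    unfolding output_prog_def wp_Seq
  proof (rule wp_runs[OF runs_For[where lo = 1 and hi = "N + 1" and K = 4 and
          I = "\<lambda>n s'. \<forall>i\<in>{1..<n}. reals s' ''x'' [i] = 0", OF _ _ _ _ _ _ order_refl]], goal_cases)
    case (5 s')
    then show ?case using h' by (simp add: frame_def)
  next
    case (8 s1 B1)
    show ?case
    proof (rule runs_For_sum[where lo = 1 and hi = "M + 1" and K = "\<lambda>g. card (G g) * 30 + 25" and
        I = "\<lambda>n s'. \<forall>i\<in>{1..N}. reals s' ''x'' [i] = (if i \<in> (\<Union>g\<in>J \<inter> {1..<n}. G g) then b i else 0)"], goal_cases)
      case 1
      show ?case using 8(1) by auto
    next
      case (2 g s2)
      have g: "g \<in> {1..M}" using 2 by auto
      have u2: "ints s2 ''S'' = ints s ''S''" "ints s2 ''k'' [] = k" "ints s2 ''gsize'' [g] = card (G g)"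
        "ints s2 ''grp'' = ints s ''grp''" "reals s2 ''b'' = reals s ''b''"
        using 2 8(2) h' g by (simp_all add: frame_def)
      show ?case
      proof (cases "g \<in> J")
        case False
        have "J \<inter> {1..<Suc g} = J \<inter> {1..<g}" using False by (auto simp: less_Suc_eq)
        moreover have "\<not> 0 < ints s ''S'' [0, 0, k, g]" using False g by (simp add: J_def)
        ultimately show ?thesis using 2(3,4) u2 by simp
      next
        case True
        have ins: "J \<inter> {1..<Suc g} = insert g (J \<inter> {1..<g})" using True g by (auto simp: less_Suc_eq)
        have "runs (For ''l'' (IConst 0) (IRead ''gsize'' [V ''g''])
             (RWrite ''x'' [IRead ''grp'' [V ''g'', V ''l'']] (RRead ''b'' [IRead ''grp'' [V ''g'', V ''l'']]))) s2 B
           (\<lambda>s'. \<forall>i\<in>{1..N}. reals s' ''x'' [i] = (if i \<in> (\<Union>g\<in>J \<inter> {1..<Suc g}. G g) then b i else 0))"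
          if B: "card (G g) * 30 + 10 \<le> B" for B
        proof (rule runs_mono[OF runs_For[where lo = 0 and hi = "card (G g)" and K = 15 and
             I = "\<lambda>n s'. \<forall>i\<in>{1..N}. reals s' ''x'' [i] =
                (if i \<in> (\<Union>g\<in>J \<inter> {1..<g}. G g) \<union> (\<lambda>l. ints s ''grp'' [g, l]) ` {0..<n} then b i else 0)",
             OF _ _ _ _ _ _ order_refl]], goal_cases)
          case 1
          show ?case using 2(3) by simp
        next
          case (2 l s3)
          have "ints s3 ''grp'' = ints s ''grp''" "ints s3 ''g'' [] = g" "\<And>i. reals s3 ''b'' [i] = b i"
            using 2 u2 \<open>ints s2 ''g'' [] = g\<close> by (simp_all add: frame_def b)
          then show ?case using 2(3,4) by (auto simp: atLeast0_lessThan_Suc)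
        next
          case (5 s3)
          then show ?case using u2 \<open>ints s2 ''g'' [] = g\<close> by (simp add: frame_def)
        next
          case 7
          show ?case using B by simp
        next
          case (8 s3)
          have "(\<lambda>l. ints s ''grp'' [g, l]) ` {0..<card (G g)} = G g" using bij[OF g] by (simp add: bij_betw_def)
          then show ?case using 8(1) unfolding ins by (simp add: Un_commute)
        qed simp_all
        moreover have "0 < ints s ''S'' [0, 0, k, g]" using True by (simp add: J_def)
        ultimately show ?thesis using 2(4) u2 by simp
      qed
    next
      case (5 s2)
      then show ?case using 8(2) h' by (simp add: frame_def)
    next
      case 7
      show ?case using 8(3) by (simp add: algebra_simps)
    qed simp_all
  qed (auto simp: less_Suc_eq)
  moreover have "J \<inter> {1..<M + 1} = J" by (auto simp: J_def)
  moreover have "N * 15 + (\<Sum>g\<in>{1..<M + 1}. (card (G g) * 30 + 25) + 10) + 30 \<le> T"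
  proof -
    have "{1..<M + 1} = {1..M}" by auto
    then have "(\<Sum>g\<in>{1..<M + 1}. (card (G g) * 30 + 25) + 10) = (\<Sum>g\<in>{1..M}. card (G g)) * 30 + M * 35"
      by (simp add: sum.distrib sum_distrib_right)
    then show ?thesis using sum_group_sizes[OF gs] T by simp
  qed
  ultimately show ?thesis unfolding J_def[symmetric] by (auto elim!: runs_mono)
qed

definition group_prog :: prog where
  "group_prog = clear_prog ;; overlap_prog ;; degree_prog ;; init_prog ;;
     For ''p'' (IConst 1) (IPlus (V ''M'') (IConst 1)) elim_prog ;; output_prog"

lemma iw_group_prog [simp]:
    "iw v group_prog \<longleftrightarrow> v \<in> {''e'', ''own'', ''a'', ''deg'', ''al'', ''c'', ''adj'', ''g'', ''l'', ''v'', ''j'', ''u'', ''S'',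
       ''p'', ''s'', ''i'', ''bl'', ''bs''}"
  and rw_group_prog [simp]: "rw v group_prog \<longleftrightarrow> v \<in> {''wt'', ''W'', ''t'', ''A'', ''pen'', ''best'', ''x''}"
  by (auto simp: group_prog_def)

lemma elim_inv_iupd [simp]:
  assumes "a \<notin> {''al'', ''deg'', ''adj'', ''S''}"
  shows "elim_inv M H w k R (iupd a is x s) \<longleftrightarrow> elim_inv M H w k R s"
proof -
  have "ints (iupd a is x s) c = ints s c" if "c \<in> {''al'', ''deg'', ''adj'', ''S''}" for c
    using assms that by auto
  then have "ints (iupd a is x s) ''al'' = ints s ''al''" "ints (iupd a is x s) ''deg'' = ints s ''deg''"
    "ints (iupd a is x s) ''adj'' = ints s ''adj''" "ints (iupd a is x s) ''S'' = ints s ''S''" by blast+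
  then show ?thesis
    unfolding elim_inv_def table_ok_def selected_def overlap_data_def by (simp only: reals_iupd)
qed

lemma group_prog:
  assumes gs: "group_structure N M G" and k: "1 \<le> k" and s: "holds_groups s N M G k"
    and b: "holds_vector s ''b'' N b" and T: "3000 * ((M + 1) * (k + 1) * (M + k + 1) + N) \<le> T"
  shows "runs group_prog s T (\<lambda>s'. \<exists>z. holds_vector s' ''x'' N z \<and> model_projection N (group_model M G k) b z)"
proof -
  note s' = s[unfolded holds_groups_def]
  have loop: "loopless M G" and U: "(\<Union>j\<in>{1..M}. G j) = {1..N}" using gs by (auto simp: group_structure_def)
  define H where "H = real_groups G"
  define w where "w = (\<lambda>e. \<bar>reals s ''b'' [e]\<bar>)"
  define KE where "KE = 80 * M + 2 * (k + 1) * (120 * (k + 1) + 60 * (M + 1) + 150) + 150"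
  define c1 where "c1 = 30 * N + (M + 1) * (30 * M + 100) + 30"
  define c2 where "c2 = 300 * N + 30 * M + 30"
  define c3 where "c3 = M * (30 * M + 30) + 30"
  define c4 where "c4 = 60 * (M + 2) * (M + 2) * (k + 2)"
  define c5 where "c5 = M * (KE + 10) + 10"
  define c6 where "c6 = 200 * N + 50 * M + 50"
  have H0: "H 0 = {}" by (simp add: H_def real_groups_def)
  have HG: "H j = G j" if "j \<in> {1..M}" for j using that by (simp add: H_def real_groups_def)
  have sub: "G j \<subseteq> {1..N}" if "j \<in> {1..M}" for j using U that by blast
  \<comment> \<open>\<open>G\<close> is arbitrary outside \<open>{1..M}\<close>; cutting it off makes all groups finite\<close>
  define H' where "H' = (\<lambda>j. if j \<le> M then H j else {})"
  have H': "H' 0 = {}" "\<And>j. finite (H' j)" "\<And>j. j \<in> {1..M} \<Longrightarrow> H' j = G j"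
  proof -
    show "H' 0 = {}" using H0 by (simp add: H'_def)
    show eq: "H' j = G j" if "j \<in> {1..M}" for j using that HG by (simp add: H'_def)
    show "finite (H' j)" for j
    proof (cases "j \<in> {1..M}")
      case True
      then show ?thesis using eq finite_subset[OF sub] by simp
    next
      case False
      then have "j = 0 \<or> \<not> j \<le> M" by auto
      then show ?thesis using H0 by (auto simp: H'_def)
    qed
  qed
  have ovH: "overlap_data M H c s1 \<longleftrightarrow> overlap_data M H' c s1" for c s1
    by (rule overlap_data_cong) (simp add: H'_def)
  have "runs group_prog s (c1 + c2 + c3 + c4 + c5 + c6) (\<lambda>s'. \<exists>z. holds_vector s' ''x'' N z \<and> model_projection N (group_model M G k) b z)"
    unfolding group_prog_def wp_Seq
  proof (rule wp_runs[OF clear_prog[where c = w and N = N and M = M, OF _ _ order_refl]], goal_cases)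
    case 1 show ?case using s' by simp
  next
    case 2 show ?case using s' by simp
  next
    case 3 show ?case by (simp add: c1_def)
  next
    case (4 s1 B1)
    have B1: "c2 + c3 + c4 + c5 + c6 \<le> B1" using 4(3) by (simp add: c1_def)
    have h1: "holds_groups s1 N M G k" using s 4(2) by (simp add: holds_groups_def frame_def)
    have b1: "reals s1 ''b'' = reals s ''b''" using 4(2) by (simp add: frame_def)
    have o1: "overlap_data M (\<lambda>_. {}) w s1" "owners N M (\<lambda>_. {}) s1" using 4(1) by simp_all
    show ?case
    proof (rule wp_runs[OF overlap_prog[OF gs h1 o1 _ order_refl]], goal_cases)
      case (1 e) show ?case by (simp add: w_def b1)
    next
      case 2 show ?case using B1 by (simp add: c2_def)
    next
      case (3 s2 B2)
      have B2: "c3 + c4 + c5 + c6 \<le> B2" using 3(3) B1 by (simp add: c2_def)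
      have o2: "overlap_data M H' w s2" using 3(1) ovH by (simp add: H_def)
      have i2: "ints s2 ''M'' [] = M" "\<And>a. a \<le> M \<Longrightarrow> ints s2 ''deg'' [a] = 0" "\<And>a. a \<le> M \<Longrightarrow> ints s2 ''al'' [a] = 1"
        using 3(2) 4(1) h1 by (simp_all add: frame_def holds_groups_def)
      show ?case
      proof (rule wp_runs[OF degree_prog[OF i2(1,2) order_refl]], goal_cases)
        case 1 then show ?case by simp
      next
        case 2 show ?case using B2 by (simp add: c3_def)
      next
        case (3 s3 B3)
        have B3: "c4 + c5 + c6 \<le> B3" using 3(3) B2 by (simp add: c3_def)
        have h3: "holds_groups s3 N M G k" and b3: "reals s3 ''b'' = reals s ''b''" and al3: "ints s3 ''al'' = ints s2 ''al''"
          and adj3: "ints s3 ''adj'' = ints s2 ''adj''"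
          using h1 b1 3(2) \<open>frame overlap_prog s1 s2\<close> by (simp_all add: holds_groups_def frame_def)
        have o3: "overlap_data M H' w s3" using o2 3(2) by (simp add: overlap_data_def frame_def)
        have i3: "ints s3 ''M'' [] = M" "ints s3 ''k'' [] = k" using h3 by (simp_all add: holds_groups_def)
        have wt3: "reals s3 ''wt'' [v] = sum w (H' v)" if "v \<le> M" for v using o3 that by (simp add: overlap_data_def)
        show ?case
        proof (rule wp_runs[OF init_prog[OF i3 wt3 order_refl]], goal_cases)
          case (1 v) then show ?case by simp
        next
          case 2 show ?case using B3 by (simp add: c4_def)
        next
          case (3 s4 B4)
          have B4: "c5 + c6 \<le> B4" using 3(3) B3 by (simp add: c4_def)
          have h4: "holds_groups s4 N M G k" and b4: "reals s4 ''b'' = reals s ''b''" and al4: "ints s4 ''al'' = ints s2 ''al''"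
            and adj4: "ints s4 ''adj'' = ints s2 ''adj''" and deg4: "ints s4 ''deg'' = ints s3 ''deg''"
            using h3 b3 al3 adj3 3(2) by (simp_all add: holds_groups_def frame_def)
          have o4: "overlap_data M H' w s4" using o3 3(2) by (simp add: overlap_data_def frame_def)
          have adj: "ints s4 ''adj'' [a, c] = (if a \<noteq> c \<and> H' a \<inter> H' c \<noteq> {} then 1 else 0)" if "a \<le> M" "c \<le> M" for a c
            using o4 that by (cases "a = c") (simp_all add: overlap_data_def)
          have inv4: "elim_inv M H' w k {1..M} s4"
            unfolding elim_inv_def
          proof (intro conjI ballI)
            show "overlap_data M H' w s4" by (rule o4)
            show "0 < ints s4 ''al'' [u] \<longleftrightarrow> u \<in> {1..M}" if "u \<in> {1..M}" for u using that i2(3)[of u] by (simp add: al4)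
            fix a assume a: "a \<in> {1..M}"
            have "ints s4 ''deg'' [a] = (\<Sum>c\<in>{1..M}. ints s4 ''adj'' [a, c])"
              using \<open>\<forall>a\<in>{1..M}. ints s3 ''deg'' [a] = _ a\<close> a by (simp add: deg4 adj4)
            also have "\<dots> = (\<Sum>c\<in>{1..M}. if 0 < ints s4 ''adj'' [a, c] then 1 else 0)"
              by (rule sum.cong) (use adj a in auto)
            also have "\<dots> = card {c \<in> {1..M}. 0 < ints s4 ''adj'' [a, c]}" by (rule sum_indicator_card) simp
            finally show "ints s4 ''deg'' [a] = card {c \<in> {1..M}. 0 < ints s4 ''adj'' [a, c]}" .
          next
            have "clustering M H' {1..M} (\<lambda>v. {v})" by (auto simp: clustering_def)
            moreover have "table_ok M H' w k s4 v {v}" if "v \<in> insert 0 {1..M}" for v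
              unfolding table_ok_def
            proof (intro allI impI)
              fix q j :: nat assume q: "q \<le> 1" and j: "j \<le> k"
              have v: "v \<le> M" using that by auto
              have cell: "reals s4 ''A'' [v, 0, j] = 0" "reals s4 ''A'' [v, 1, j] = sum w (H' v)"
                "\<And>u. u \<le> M \<Longrightarrow> ints s4 ''S'' [v, 0, j, u] = 0" "\<And>u. u \<le> M \<Longrightarrow> ints s4 ''S'' [v, 1, j, u] = (if u = v then 1 else 0)"
                using 3(1) v j by blast+
              have sel: "selected M s4 v q j = (if 0 < q then {v} else {})"
              proof (cases "q = 0")
                case False
                then have "q = 1" using q by simp
                then show ?thesis using cell(4) v by (auto simp: selected_def split: if_splits)
              qed (use cell(3) in \<open>auto simp: selected_def\<close>)
              have A: "reals s4 ''A'' [v, q, j] = coverage H' w (if 0 < q then {v} else {})"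
                using cell(1,2) q by (cases "q = 0") (auto simp: coverage_def le_Suc_eq)
              have "J' = (if 0 < q then {v} else {})" if "J' \<subseteq> {v}" "v \<in> J' \<longleftrightarrow> 0 < q" for J' using that by auto
              then show "best_selection H' w v {v} (0 < q) j (selected M s4 v q j) (reals s4 ''A'' [v, q, j])"
                unfolding best_selection_def sel A by auto
            qed
            ultimately show "\<exists>C. clustering M H' {1..M} C \<and> (\<forall>v\<in>insert 0 {1..M}. table_ok M H' w k s4 v (C v))"
              by (intro exI[of _ "\<lambda>v. {v}"]) blast
          qed
          have elims: "runs (For ''p'' (IConst 1) (IPlus (V ''M'') (IConst 1)) elim_prog) s4 c5 (\<lambda>s'. \<exists>R. R \<subseteq> {1..M} \<and> card R + (M + 1) = M + 1 \<and> elim_inv M H' w k R s')"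
          proof (rule runs_For[where lo = 1 and hi = "M + 1" and K = KE and
              I = "\<lambda>n s'. \<exists>R. R \<subseteq> {1..M} \<and> card R + n = M + 1 \<and> elim_inv M H' w k R s'"], goal_cases)
            case 1
            have "elim_inv M H' w k {1..M} (iupd ''p'' [] 1 s4)"
              using inv4 by simp
            then show ?case by (intro exI[of _ "{1..M}"]) simp
          next
            case (2 n s5)
            from 2(3) obtain R where R: "R \<subseteq> {1..M}" "card R + n = M + 1" "elim_inv M H' w k R s5" by blast
            have i5: "ints s5 ''M'' [] = M" "ints s5 ''k'' [] = k" "ints s5 ''adj'' = ints s4 ''adj''"
              using 2(5) h4 by (simp_all add: frame_def holds_groups_def)
            have Rn: "R \<noteq> {}" using R(2) 2(2) by auto
            have fin: "finite R" using R(1) finite_subset by blast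
            obtain u where u: "u \<in> R" "card {x \<in> R. groups_meet M G u x} \<le> 1" using loopless_leaf[OF loop R(1) Rn] by blast
            have "{x \<in> R. 0 < ints s5 ''adj'' [u, x]} = {x \<in> R. groups_meet M G u x}"
            proof (rule Collect_cong, rule conj_cong[OF refl])
              fix x assume x: "x \<in> R"
              have xu: "x \<in> {1..M}" "u \<in> {1..M}" using x u R(1) by auto
              then have "0 < ints s4 ''adj'' [u, x] \<longleftrightarrow> u \<noteq> x \<and> H' u \<inter> H' x \<noteq> {}" using adj[of u x] by auto
              then show "0 < ints s5 ''adj'' [u, x] \<longleftrightarrow> groups_meet M G u x"
                using xu H'(3) by (simp add: i5 groups_meet_def)
            qed
            then have leaf: "\<exists>u\<in>R. card {x \<in> R. 0 < ints s5 ''adj'' [u, x]} \<le> 1"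
              using u by (intro bexI[of _ u], simp_all)
            have "runs elim_prog s5 KE (\<lambda>s'. \<exists>u\<in>R. elim_inv M H' w k (R - {u}) s')"
              by (rule elim_prog[OF i5(1,2) R(3) H'(1,2) leaf]) (simp add: KE_def)
            then show ?case
            proof (rule runs_mono[OF _ order_refl])
              fix s6 :: memory assume "\<exists>u\<in>R. elim_inv M H' w k (R - {u}) s6"
              then obtain u where u: "u \<in> R" "elim_inv M H' w k (R - {u}) s6" by blast
              have "elim_inv M H' w k (R - {u}) (iupd ''p'' [] (Suc n) s6)"
                using u(2) by simp
              moreover have "R - {u} \<subseteq> {1..M}" using R(1) by blast
              moreover have "card (R - {u}) + Suc n = M + 1" using R(2) card.remove[OF fin u(1)] by linarith
              ultimately show "\<exists>R. R \<subseteq> {1..M} \<and> card R + Suc n = M + 1 \<and> elim_inv M H' w k R (iupd ''p'' [] (Suc n) s6)"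
                by (intro exI[of _ "R - {u}"] conjI)
            qed
          next
            case (5 s5)
            then show ?case using h4 by (simp add: frame_def holds_groups_def)
          next
            case 7
            show ?case by (simp add: c5_def algebra_simps)
          qed simp_all
          show ?case
          proof (rule wp_runs[OF elims], goal_cases)
            case 1 show ?case using B4 by simp
          next
            case (2 s5 B5)
            have B5: "c6 \<le> B5" using 2(3) B4 by simp
            have h5: "holds_groups s5 N M G k" and b5: "reals s5 ''b'' = reals s ''b''"
              using h4 b4 2(2) by (simp_all add: holds_groups_def frame_def)
            obtain R where R: "R \<subseteq> {1..M}" "card R = 0" "elim_inv M H' w k R s5" using 2(1) by auto
            have "R = {}" using R(1,2) finite_subset[OF R(1)] by simp
            then obtain C where C: "clustering M H' {} C" "table_ok M H' w k s5 0 (C 0)"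
              using R(3) unfolding elim_inv_def by blast
            \<comment> \<open>all groups have been merged into the cluster of the empty group \<open>0\<close>\<close>
            have "C 0 = {0..M}" using C(1) unfolding clustering_def by simp
            define J where "J = selected M s5 0 0 k"
            have best: "best_selection H' w 0 {0..M} False k J (reals s5 ''A'' [0, 0, k])"
              using C(2)[unfolded table_ok_def \<open>C 0 = {0..M}\<close>, rule_format, of 0 k] by (simp add: J_def)
            note bD = best_selectionD[OF best]
            have J: "J \<subseteq> {1..M}" "card J \<le> k"
            proof -
              have "x \<noteq> 0" if "x \<in> J" for x using bD(2) that by metis
              then show "J \<subseteq> {1..M}" using bD(1) by (auto simp: Suc_le_eq)
              show "card J \<le> k" using bD(2,3) by simp
            qed
            have cov: "coverage H' w J' = (\<Sum>i\<in>(\<Union>j\<in>J'. G j). \<bar>reals s ''b'' [i]\<bar>)" if "J' \<subseteq> {1..M}" for J'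
            proof -
              have "(\<Union>j\<in>J'. H' j) = (\<Union>j\<in>J'. G j)" using that H'(3) by (intro SUP_cong) auto
              then show ?thesis by (simp add: coverage_def w_def)
            qed
            have out: "runs output_prog s5 c6 (\<lambda>s'. \<forall>i\<in>{1..N}. reals s' ''x'' [i] =
               (if i \<in> (\<Union>g\<in>{g \<in> {1..M}. 0 < ints s5 ''S'' [0, 0, k, g]}. G g) then (\<lambda>i. reals s5 ''b'' [i]) i else 0))"
              by (rule output_prog[OF gs h5 refl]) (simp add: c6_def)
            show ?case
            proof (rule runs_mono[OF out B5])
              fix s6 :: memory assume x: "\<forall>i\<in>{1..N}. reals s6 ''x'' [i] =
               (if i \<in> (\<Union>g\<in>{g \<in> {1..M}. 0 < ints s5 ''S'' [0, 0, k, g]}. G g) then (\<lambda>i. reals s5 ''b'' [i]) i else 0)"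
              have Jeq: "{g \<in> {1..M}. 0 < ints s5 ''S'' [0, 0, k, g]} = J"
                using J(1) by (auto simp: J_def selected_def)
              have bb: "reals s ''b'' [i] = b i" if "i \<in> {1..N}" for i using b that by (simp add: holds_vector_def)
              have UJ: "(\<Union>j\<in>J'. G j) \<subseteq> {1..N}" if "J' \<subseteq> {1..M}" for J' using sub that by blast
              have "model_projection N (group_model M G k) b (\<lambda>i. reals s6 ''x'' [i])"
              proof (rule model_projectionI)
                show "(\<Union>j\<in>J. G j) \<in> group_model M G k" using J by (auto simp: group_model_def)
                show "(\<Union>j\<in>J. G j) \<subseteq> (\<Union>j\<in>J. G j)" by simp
                show "(\<Union>j\<in>J. G j) \<subseteq> {1..N}" by (rule UJ[OF J(1)])
                show "reals s6 ''x'' [i] = (if i \<in> (\<Union>j\<in>J. G j) then b i else 0)" if "i \<in> {1..N}" for i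
                  using bspec[OF x that] bb[OF that] unfolding Jeq b5 by simp
                fix K' assume "K' \<in> group_model M G k"
                then obtain J' where J': "J' \<subseteq> {1..M}" "card J' \<le> k" "K' = (\<Union>j\<in>J'. G j)" by (auto simp: group_model_def)
                have z: "0 \<notin> J'" using J'(1) by auto
                have "(\<Sum>i\<in>K' \<inter> {1..N}. \<bar>b i\<bar>) = (\<Sum>i\<in>K'. \<bar>reals s ''b'' [i]\<bar>)"
                  by (rule sum.cong) (use UJ[OF J'(1)] J'(3) bb in auto)
                also have "\<dots> = coverage H' w J'" using cov[OF J'(1)] J'(3) by simp
                also have "\<dots> \<le> reals s5 ''A'' [0, 0, k]"
                  by (rule bD(5)) (use J' z in auto)
                also have "\<dots> = coverage H' w J" by (rule bD(4))
                also have "\<dots> = (\<Sum>i\<in>(\<Union>j\<in>J. G j). \<bar>reals s ''b'' [i]\<bar>)" by (rule cov[OF J(1)])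
                also have "\<dots> = (\<Sum>i\<in>(\<Union>j\<in>J. G j). \<bar>b i\<bar>)"
                  by (rule sum.cong) (use UJ[OF J(1)] bb in auto)
                finally show "(\<Sum>i\<in>K' \<inter> {1..N}. \<bar>b i\<bar>) \<le> (\<Sum>i\<in>(\<Union>j\<in>J. G j). \<bar>b i\<bar>)" .
              qed
              then show "\<exists>z. holds_vector s6 ''x'' N z \<and> model_projection N (group_model M G k) b z"
                by (auto simp: holds_vector_def)
            qed
          qed
        qed
      qed
    qed
  qed
  moreover have "c1 + c2 + c3 + c4 + c5 + c6 \<le> 3000 * ((M + 1) * (k + 1) * (M + k + 1) + N)"
    by (simp add: c1_def c2_def c3_def c4_def c5_def c6_def KE_def algebra_simps)
  ultimately show ?thesis using T by (elim runs_mono) simp_all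
qed

section \<open>The MEIHT loop\<close>

text \<open>The main loop for arbitrary subroutines with time bounds \<open>Tm\<close> and \<open>Tp\<close>. The predicate \<open>holds_input\<close> stands for the data that
the subroutines read and must not destroy.\<close>

lemma meiht_prog_runs:
  assumes s: "holds_input s"
    and med: "\<And>s x. holds_input s \<Longrightarrow> holds_vector s ''x'' N x \<Longrightarrow> runs med s Tm (\<lambda>s'. holds_vector s' ''b'' N (median_step N \<Gamma> y x))"
    and proj: "\<And>s b. holds_input s \<Longrightarrow> holds_vector s ''b'' N b \<Longrightarrow>
        runs proj s Tp (\<lambda>s'. \<exists>z. holds_vector s' ''x'' N z \<and> model_projection N \<M> b z)"
    and pres: "\<And>s s'. holds_input s \<Longrightarrow> frame med s s' \<Longrightarrow> holds_input s'" "\<And>s s'. holds_input s \<Longrightarrow> frame proj s s' \<Longrightarrow> holds_input s'"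
      "\<And>s v. holds_input s \<Longrightarrow> holds_input (iupd ''i'' [] v s)" "\<And>s v. holds_input s \<Longrightarrow> holds_input (iupd ''iter'' [] v s)"
      "\<And>s is v. holds_input s \<Longrightarrow> holds_input (rupd ''x'' is v s)"
    and iw: "\<not> iw ''iter'' med" "\<not> iw ''iter'' proj"
    and Nn: "\<And>s. holds_input s \<Longrightarrow> ints s ''N'' [] = N \<and> ints s ''n'' [] = n"
  shows "\<exists>t \<le> 20 * N + n * (Tm + Tp + 20) + 30. runs_meiht med proj N \<M> \<Gamma> y n s t"
proof -
  let ?iteration = "med ;; proj ;; IWrite ''iter'' [] (IMinus (IRead ''iter'' []) (IConst 1))"
  define Q where "Q = (\<lambda>s'. \<exists>X. meiht_iterates N \<M> \<Gamma> y n X \<and> holds_vector s' ''x'' N (X n))"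
  define Z where "Z = (\<lambda>s' B. holds_input s' \<and> ints s' ''i'' [] \<le> N \<and> (\<forall>i\<in>{1..N}. ints s' ''i'' [] < i \<longrightarrow> reals s' ''x'' [i] = 0) \<and>
     ints s' ''i'' [] * 20 + n * (Tm + Tp + 20) + 20 \<le> B)"
  define J where "J = (\<lambda>s' B. \<exists>l X. holds_input s' \<and> l \<le> n \<and> ints s' ''iter'' [] = n - l \<and> meiht_iterates N \<M> \<Gamma> y l X \<and>
     holds_vector s' ''x'' N (X l) \<and> (n - l) * (Tm + Tp + 20) + 5 \<le> B)"
  have loop: "wp (While (ILess (IConst 0) (IRead ''iter'' []))
       (?iteration)) (\<lambda>s' _. Q s') s1 B1"
    if "J s1 B1" for s1 B1
    using that
  proof (rule wp_While_invariant)
    fix s2 B2 assume "J s2 B2"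
    then obtain l X where l: "holds_input s2" "l \<le> n" "ints s2 ''iter'' [] = n - l" "meiht_iterates N \<M> \<Gamma> y l X"
      "holds_vector s2 ''x'' N (X l)" "(n - l) * (Tm + Tp + 20) + 5 \<le> B2" unfolding J_def by blast
    show "1 + bcost (ILess (IConst 0) (IRead ''iter'' [])) \<le> B2 \<and>
      (if bval s2 (ILess (IConst 0) (IRead ''iter'' []))
       then wp (?iteration) J s2
         (B2 - (1 + bcost (ILess (IConst 0) (IRead ''iter'' [])))) else Q s2)"
    proof (cases "l < n")
      case False
      then show ?thesis using l by (auto simp: Q_def)
    next
      case True
      then have "n - l = Suc (n - Suc l)" by simp
      then have B2: "Tm + Tp + 20 + (n - Suc l) * (Tm + Tp + 20) + 5 \<le> B2" using l(6) by simp
      have "wp (?iteration) J s2 B3" if "B2 \<le> B3 + 4" for B3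
        unfolding wp_Seq
      proof (rule wp_runs[OF med[OF l(1,5)]], goal_cases)
        case 1 show ?case using B2 that by simp
      next
        case (2 s4 B4)
        have i4: "holds_input s4" "ints s4 ''iter'' [] = n - l" using pres(1)[OF l(1) 2(2)] frame_ints[OF 2(2) iw(1)] l(3) by simp_all
        show ?case
        proof (rule wp_runs[OF proj[OF i4(1) 2(1)]], goal_cases)
          case 1 show ?case using B2 that 2(3) by simp
        next
          case (2 s5 B5)
          then obtain z where z: "holds_vector s5 ''x'' N z" "model_projection N \<M> (median_step N \<Gamma> y (X l)) z" by blast
          have i5: "holds_input s5" "ints s5 ''iter'' [] = n - l" using pres(2)[OF i4(1) 2(2)] frame_ints[OF 2(2) iw(2)] i4(2) by simp_all
          have "meiht_iterates N \<M> \<Gamma> y (Suc l) (X(Suc l := z))"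
            using l(4) z(2) by (auto simp: meiht_iterates_def less_Suc_eq)
          then have "J (iupd ''iter'' [] (n - Suc l) s5) B'" if "B5 \<le> B' + 5" for B'
            unfolding J_def using pres(4)[OF i5(1)] True z(1) that B2 \<open>B2 \<le> B3 + 4\<close> \<open>_ \<le> B4 + _\<close> \<open>_ \<le> B5 + _\<close>
            by (intro exI[of _ "Suc l"] exI[of _ "X(Suc l := z)"]) (auto simp: holds_vector_def)
          moreover have "5 \<le> B5" using B2 that \<open>_ \<le> B4 + _\<close> \<open>_ \<le> B5 + _\<close> by simp
          ultimately show ?case using i5(2) by simp
        qed
      qed
      then show ?thesis using True l(3) B2 by (auto simp del: wp_Seq)
    qed
  qed
  have init: "wp (While (ILess (IConst 0) (IRead ''i'' []))
       (RWrite ''x'' [IRead ''i'' []] (RConst 0) ;; IWrite ''i'' [] (IMinus (IRead ''i'' []) (IConst 1))))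
       (\<lambda>s' B'. holds_input s' \<and> (\<forall>i\<in>{1..N}. reals s' ''x'' [i] = 0) \<and> n * (Tm + Tp + 20) + 10 \<le> B') s1 B1" if "Z s1 B1" for s1 B1
    using that
  proof (rule wp_While_invariant)
    fix s2 B2 assume Z: "Z s2 B2"
    define i where "i = ints s2 ''i'' []"
    have z: "holds_input s2" "ints s2 ''i'' [] = i" "i \<le> N" "\<forall>i'\<in>{1..N}. i < i' \<longrightarrow> reals s2 ''x'' [i'] = 0" "i * 20 + n * (Tm + Tp + 20) + 20 \<le> B2"
      using Z by (simp_all add: Z_def i_def)
    show "1 + bcost (ILess (IConst 0) (IRead ''i'' [])) \<le> B2 \<and>
      (if bval s2 (ILess (IConst 0) (IRead ''i'' []))
       then wp (RWrite ''x'' [IRead ''i'' []] (RConst 0) ;; IWrite ''i'' [] (IMinus (IRead ''i'' []) (IConst 1))) Z s2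
         (B2 - (1 + bcost (ILess (IConst 0) (IRead ''i'' []))))
       else holds_input s2 \<and> (\<forall>i\<in>{1..N}. reals s2 ''x'' [i] = 0) \<and> n * (Tm + Tp + 20) + 10 \<le> B2 - (1 + bcost (ILess (IConst 0) (IRead ''i'' []))))"
    proof (cases i)
      case 0
      then show ?thesis using z by auto
    next
      case (Suc i')
      have "Z (iupd ''i'' [] i' (rupd ''x'' [i] 0 s2)) B'" if "B2 \<le> B' + 20" for B'
        unfolding Z_def using pres(3)[OF pres(5)[OF z(1)]] z(3-5) that Suc by (auto simp: less_Suc_eq)
      then show ?thesis using z(2,5) Suc by auto
    qed
  qed
  have "runs (meiht_prog med proj) s (20 * N + n * (Tm + Tp + 20) + 30) Q"
    unfolding meiht_prog_def wp_Seq[of "IWrite a es e" for a es e] wp_Seq[of "While b p" for b p] wp_IWrite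
  proof (intro conjI, goal_cases)
    case 1 show ?case by simp
  next
    case 2
    have "Z (iupd ''i'' [] N s) (28 + (20 * N + n * (Tm + Tp + 20)))"
      using pres(3)[OF s] by (simp add: Z_def)
    note init[OF this]
    moreover have "wp (IWrite ''iter'' [] (IRead ''n'' [])) (wp (While (ILess (IConst 0) (IRead ''iter'' []))
         (?iteration)) (\<lambda>s' _. Q s')) s1 B1"
      if "holds_input s1 \<and> (\<forall>i\<in>{1..N}. reals s1 ''x'' [i] = 0) \<and> n * (Tm + Tp + 20) + 10 \<le> B1" for s1 B1
    proof -
      have "J (iupd ''iter'' [] n s1) B'" if "B1 \<le> B' + 2" for B'
        unfolding J_def using pres(4) \<open>holds_input s1 \<and> _\<close> that
        by (intro exI[of _ 0] exI[of _ "\<lambda>_ _. 0"]) (auto simp: meiht_iterates_def holds_vector_def)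
      then have "J (iupd ''iter'' [] n s1) (B1 - 2)" using that by simp
      from loop[OF this] show ?thesis using Nn[of s1] that by (simp del: wp_Seq)
    qed
    ultimately show ?case
      using Nn[OF s] by (simp del: wp_Seq) (erule wp_mono, simp_all del: wp_Seq)
  qed
  then obtain t s' where "exec (meiht_prog med proj) s t s'" "t \<le> 20 * N + n * (Tm + Tp + 20) + 30" "Q s'"
    unfolding wp_def by blast
  then show ?thesis unfolding runs_meiht_def Q_def by blast
qed

section \<open>Asymptotic estimates\<close>

text \<open>With \<open>d \<le> C l / ln l\<close> and \<open>ln l \<ge> \<beta>\<close>, the logarithm of \<open>d\<close> is at most \<open>ln l\<close> up to a constant, and this factor cancels
against the denominator: \<open>d ln d = O(l)\<close>.\<close>

lemma sort_cost_log:
  fixes d :: nat and C \<beta> l :: real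
  assumes d: "1 \<le> d" "real d \<le> C * l / ln l" and C: "0 \<le> C" and l: "1 < l" "\<beta> \<le> ln l" "0 < \<beta>"
  defines "K \<equiv> max 1 (C / \<beta>)"
  shows "real ((d + 1) * (nat \<lceil>log 2 d\<rceil> + 1)) \<le> (2 / ln 2 * (K * ln K + C) + 4 * K) * l"
proof -
  have K: "1 \<le> K" "C / \<beta> \<le> K" by (simp_all add: K_def)
  have lnl: "0 < ln l" using l by simp
  have "C * l / ln l \<le> C * l / \<beta>" using C l by (intro divide_left_mono mult_nonneg_nonneg) auto
  also have "\<dots> = C / \<beta> * l" by simp
  also have "\<dots> \<le> K * l" using K l by (intro mult_right_mono) auto
  finally have dK: "real d \<le> K * l" using d(2) by linarith
  have "ln (real d) \<le> ln (K * l)" using dK d(1) by (subst ln_le_cancel_iff) auto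
  also have "\<dots> = ln K + ln l" using K l by (simp add: ln_mult)
  finally have lnd: "ln (real d) \<le> ln K + ln l" .
  have lnd0: "0 \<le> ln (real d)" using d(1) by simp
  have "real d * ln (real d) \<le> real d * (ln K + ln l)" using lnd by (intro mult_left_mono) auto
  also have "\<dots> = real d * ln K + real d * ln l" by (simp add: algebra_simps)
  also have "\<dots> \<le> K * l * ln K + C * l / ln l * ln l"
    using dK d(2) K lnl by (intro add_mono mult_right_mono) auto
  also have "\<dots> = (K * ln K + C) * l" using lnl by (simp add: algebra_simps)
  finally have dlnd: "real d * ln (real d) \<le> (K * ln K + C) * l" .
  have lg0: "0 \<le> log 2 (real d)" using d(1) by simp
  then have "real (nat \<lceil>log 2 (real d)\<rceil>) \<le> log 2 (real d) + 1" by linarith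
  then have 1: "real (nat \<lceil>log 2 d\<rceil> + 1) \<le> log 2 (real d) + 2" by simp
  have 2: "real (d + 1) \<le> 2 * real d" using d(1) by simp
  have "real (d + 1) * real (nat \<lceil>log 2 d\<rceil> + 1) \<le> (2 * real d) * (log 2 (real d) + 2)"
    by (rule mult_mono[OF 2 1]) simp_all
  then have "real ((d + 1) * (nat \<lceil>log 2 d\<rceil> + 1)) \<le> (2 * real d) * (log 2 (real d) + 2)"
    unfolding of_nat_mult .
  also have "\<dots> = 2 / ln 2 * (real d * ln (real d)) + 4 * real d" by (simp add: log_def field_simps)
  also have "\<dots> \<le> 2 / ln 2 * ((K * ln K + C) * l) + 4 * (K * l)"
    using dlnd dK by (intro add_mono mult_left_mono) auto
  finally show ?thesis by (simp add: algebra_simps add_divide_distrib)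
qed

lemma le_two_power_log: "1 \<le> d \<Longrightarrow> d \<le> 2 ^ nat \<lceil>log 2 (real d)\<rceil>"
proof -
  assume d: "1 \<le> d"
  have "real d = 2 powr (log 2 (real d))" using d by simp
  also have "\<dots> \<le> 2 powr real (nat \<lceil>log 2 (real d)\<rceil>)" by (intro powr_mono) linarith+
  also have "\<dots> = real (2 ^ nat \<lceil>log 2 (real d)\<rceil>)" by (simp add: powr_realpow)
  finally show ?thesis by linarith
qed

text \<open>The case distinction is at \<open>q = N\<^sup>1\<^sup>/\<^sup>4\<close>. If \<open>k g \<ge> q\<close> then \<open>ln N / ln (k g) \<le> 4\<close> and \<open>d\<close> is bounded. Otherwise \<open>g < q\<close>, so
\<open>M \<ge> q\<^sup>3\<close>, while \<open>d \<le> C ln N \<le> 4 C q\<close>; both \<open>d\<^sup>2 N\<close> and \<open>M\<^sup>2\<close> are then of the order \<open>q\<^sup>6\<close>.\<close>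

lemma quadratic_degree_bound:
  fixes N M k g d C :: real
  assumes N: "2 \<le> N" "N \<le> M * g" and g: "exp 1 \<le> g" "1 \<le> k" and d: "0 \<le> d" "d \<le> C * ln N / ln (k * g)" and C: "0 \<le> C" "0 \<le> M"
  shows "d\<^sup>2 * N \<le> 16 * C\<^sup>2 * (M\<^sup>2 + N)"
proof -
  define q where "q = N powr (1 / 4)"
  have q: "0 < q" "q ^ 4 = N" using N by (simp_all add: q_def powr_power)
  have lnN: "ln N = 4 * ln q" "0 \<le> ln N" using N by (simp_all add: q_def ln_powr)
  have "1 * g \<le> k * g" using g by (intro mult_right_mono) (auto intro: order_trans[OF exp_ge_zero])
  then have gk: "g \<le> k * g" by simp
  then have e: "exp 1 \<le> k * g" using g(1) by linarith
  then have ln1: "1 \<le> ln (k * g)" by (subst ln_ge_iff) (auto intro: less_le_trans[OF exp_gt_zero])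
  show ?thesis
  proof (cases "q \<le> k * g")
    case True
    then have "ln q \<le> ln (k * g)" using q by simp
    then have "C * ln N \<le> C * (4 * ln (k * g))" using lnN C by (intro mult_left_mono) auto
    then have "C * ln N / ln (k * g) \<le> 4 * C" using ln1 by (simp add: divide_le_eq algebra_simps)
    then have "d\<^sup>2 \<le> (4 * C)\<^sup>2" using d by (intro power_mono) auto
    then have "d\<^sup>2 * N \<le> 16 * C\<^sup>2 * N" using N by (intro mult_right_mono) (auto simp: power_mult_distrib)
    also have "\<dots> \<le> 16 * C\<^sup>2 * (M\<^sup>2 + N)" by (intro mult_left_mono) auto
    finally show ?thesis .
  next
    case False
    then have "g \<le> q" using gk by linarith
    then have "q ^ 4 \<le> M * q" using N(2) q C(2) mult_left_mono[of g q M] by linarith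
    then have "q ^ 3 * q \<le> M * q" by (simp add: power_Suc2[symmetric] flip: power_Suc2)
    then have "q ^ 3 \<le> M" using q by simp
    then have M: "(q ^ 3)\<^sup>2 \<le> M\<^sup>2" using q by (intro power_mono) auto
    have "C * ln N / ln (k * g) \<le> C * ln N / 1" using ln1 C lnN by (intro divide_left_mono) auto
    moreover have "ln N \<le> 4 * q" using lnN(1) ln_le_minus_one[OF q(1)] by linarith
    then have "C * ln N \<le> C * (4 * q)" using C by (intro mult_left_mono) auto
    ultimately have "d \<le> 4 * C * q" using d by simp
    then have "d\<^sup>2 \<le> (4 * C * q)\<^sup>2" using d by (intro power_mono) auto
    then have "d\<^sup>2 * N \<le> (4 * C * q)\<^sup>2 * N" using N by (intro mult_right_mono) auto
    also have "\<dots> = 16 * C\<^sup>2 * (q ^ 3)\<^sup>2" unfolding q(2)[symmetric] by (simp add: power_mult_distrib flip: power_mult power_add)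
    also have "\<dots> \<le> 16 * C\<^sup>2 * (M\<^sup>2 + N)" using M N by (intro mult_left_mono) auto
    finally show ?thesis .
  qed
qed


text \<open>The order of the time for one median, with all factors positive.\<close>

definition sort_cost :: "nat \<Rightarrow> nat" where "sort_cost d = (d + 1) * (nat \<lceil>log 2 (real d)\<rceil> + 1)"

lemma sort_cost_le_square:
  assumes d: "1 \<le> d"
  shows "sort_cost d \<le> 4 * d\<^sup>2"
proof -
  have "log 2 (real d) \<le> real d"
  proof -
    have "real d \<le> 2 ^ d" using of_nat_mono[OF less_imp_le[OF less_exp[of d]], where 'a = real] by simp
    then have "real d \<le> 2 powr real d" by (simp add: powr_realpow)
    then show ?thesis using d by (subst log_le_iff) auto
  qed
  then have "nat \<lceil>log 2 (real d)\<rceil> + 1 \<le> 2 * d" using d by linarith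
  moreover have "d + 1 \<le> 2 * d" using d by simp
  ultimately have "sort_cost d \<le> (2 * d) * (2 * d)" unfolding sort_cost_def by (rule mult_le_mono[rotated])
  then show ?thesis by (simp add: power2_eq_square)
qed

lemma le_sort_cost: "d \<le> sort_cost d"
  by (simp add: sort_cost_def)

text \<open>Linear time \<open>N \<le> Z\<close> for the initialization and lower order terms are absorbed by the cost \<open>O(Z)\<close> of one iteration.\<close>

lemma iteration_cost_bound:
  fixes Z c :: real and N n :: nat
  assumes "1 \<le> N" "1 \<le> n" "real N \<le> Z" "real T \<le> c * Z"
  shows "real (20 * N + n * (T + 20) + 30) \<le> (c + 70) * (real n * Z)"
proof -
  have Z: "1 \<le> Z" using assms by linarith
  have "real n * real T \<le> real n * (c * Z)" using assms by (intro mult_left_mono) auto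
  moreover have "1 * Z \<le> real n * Z" using assms Z by (intro mult_right_mono) auto
  moreover have "real n * 1 \<le> real n * Z" using Z by (intro mult_left_mono) auto
  moreover have "real (20 * N + n * (T + 20) + 30) = 20 * real N + real n * real T + 20 * real n + 30"
    by (simp add: algebra_simps)
  moreover have "(c + 70) * (real n * Z) = real n * (c * Z) + 70 * (real n * Z)" by (simp add: algebra_simps)
  ultimately show ?thesis using assms(3) Z by linarith
qed

lemma median_cost_bound:
  fixes B :: real and N m d :: nat
  assumes "1 \<le> N" "real m \<le> B * (real d * real N)" "0 \<le> B"
  shows "real (400 * ((N + 1) * sort_cost d + m)) \<le> 400 * (2 + B) * (real N * real (sort_cost d))"
proof -
  have "real (N + 1) * real (sort_cost d) \<le> (2 * real N) * real (sort_cost d)"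
    using assms(1) by (intro mult_right_mono) auto
  moreover have "B * (real d * real N) \<le> B * (real N * real (sort_cost d))"
    using le_sort_cost[of d] assms(3) by (subst mult.commute[of "real d"]) (intro mult_left_mono, auto)
  ultimately show ?thesis using assms(2) by (simp add: algebra_simps)
qed

lemma tree_runtime:
  assumes inp: "tree_input D \<epsilon> N k m d n r par \<Gamma> y s"
  shows "\<exists>t \<le> 20 * N + n * (400 * ((N + 1) * sort_cost d + m) + 1000 * ((N + 1) * (k + 1)) + 20) + 30.
    runs_meiht med_prog tree_prog N (tree_model N r par k) \<Gamma> y n s t"
proof -
  have t: "dary_tree D N r par" "1 \<le> k" and reg: "left_regular N m d \<Gamma>"
    using inp by (auto simp: tree_input_def model_expander_def)
  have d: "d \<le> 2 ^ nat \<lceil>log 2 (real d)\<rceil>" using reg by (intro le_two_power_log) (simp add: left_regular_def)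
  have cost: "400 * ((N + 1) * (d + 1) * (nat \<lceil>log 2 (real d)\<rceil> + 1) + m) = 400 * ((N + 1) * sort_cost d + m)"
    unfolding sort_cost_def by (simp only: mult.assoc)
  define I where "I = (\<lambda>s. holds_tree s N r par k \<and> holds_matrix s N m d \<Gamma> \<and> holds_vector s ''y'' m y \<and> ints s ''n'' [] = n)"
  have I: "I s" using inp by (simp add: tree_input_def I_def)
  show ?thesis
  proof (rule meiht_prog_runs[where holds_input = I, OF I])
    show "runs med_prog s (400 * ((N + 1) * sort_cost d + m)) (\<lambda>s'. holds_vector s' ''b'' N (median_step N \<Gamma> y x))"
      if "I s" "holds_vector s ''x'' N x" for s x
      by (rule med_prog[OF reg _ _ that(2) d eq_imp_le[OF cost]]) (use that(1) in \<open>simp_all add: I_def\<close>)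
    show "runs tree_prog s (1000 * ((N + 1) * (k + 1)))
        (\<lambda>s'. \<exists>z. holds_vector s' ''x'' N z \<and> model_projection N (tree_model N r par k) b z)"
      if "I s" "holds_vector s ''b'' N b" for s b
      by (rule tree_prog[OF t _ that(2) order_refl]) (use that(1) in \<open>simp add: I_def\<close>)
    show "ints s ''N'' [] = N \<and> ints s ''n'' [] = n" if "I s" for s using that by (simp add: I_def holds_tree_def)
  qed (simp_all add: I_def holds_tree_def holds_matrix_def holds_vector_def frame_def)
qed

lemma group_runtime:
  assumes inp: "group_input \<epsilon> N M k m d n G \<Gamma> y s"
  shows "\<exists>t \<le> 20 * N + n * (400 * ((N + 1) * sort_cost d + m) + 3000 * ((M + 1) * (k + 1) * (M + k + 1) + N) + 20) + 30.
    runs_meiht med_prog group_prog N (group_model M G k) \<Gamma> y n s t"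
proof -
  have g: "group_structure N M G" "1 \<le> k" and reg: "left_regular N m d \<Gamma>"
    using inp by (auto simp: group_input_def model_expander_def)
  have d: "d \<le> 2 ^ nat \<lceil>log 2 (real d)\<rceil>" using reg by (intro le_two_power_log) (simp add: left_regular_def)
  have cost: "400 * ((N + 1) * (d + 1) * (nat \<lceil>log 2 (real d)\<rceil> + 1) + m) = 400 * ((N + 1) * sort_cost d + m)"
    unfolding sort_cost_def by (simp only: mult.assoc)
  define I where "I = (\<lambda>s. holds_groups s N M G k \<and> holds_matrix s N m d \<Gamma> \<and> holds_vector s ''y'' m y \<and> ints s ''n'' [] = n)"
  have I: "I s" using inp by (simp add: group_input_def I_def)
  show ?thesis
  proof (rule meiht_prog_runs[where holds_input = I, OF I])
    show "runs med_prog s (400 * ((N + 1) * sort_cost d + m)) (\<lambda>s'. holds_vector s' ''b'' N (median_step N \<Gamma> y x))"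
      if "I s" "holds_vector s ''x'' N x" for s x
      by (rule med_prog[OF reg _ _ that(2) d eq_imp_le[OF cost]]) (use that(1) in \<open>simp_all add: I_def\<close>)
    show "runs group_prog s (3000 * ((M + 1) * (k + 1) * (M + k + 1) + N))
        (\<lambda>s'. \<exists>z. holds_vector s' ''x'' N z \<and> model_projection N (group_model M G k) b z)"
      if "I s" "holds_vector s ''b'' N b" for s b
      by (rule group_prog[OF g _ that(2) order_refl]) (use that(1) in \<open>simp add: I_def\<close>)
    show "ints s ''N'' [] = N \<and> ints s ''n'' [] = n" if "I s" for s using that by (simp add: I_def holds_groups_def)
  qed (simp_all add: I_def holds_groups_def holds_matrix_def holds_vector_def frame_def)
qed

lemma group_cover_bound:
  assumes "group_structure N M G"
  shows "N \<le> M * max_group_size M G"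
proof -
  have U: "(\<Union>j\<in>{1..M}. G j) = {1..N}" using assms by (simp add: group_structure_def)
  have "card (\<Union>j\<in>{1..M}. G j) \<le> (\<Sum>j\<in>{1..M}. card (G j))" by (rule card_UN_le) simp
  also have "\<dots> \<le> (\<Sum>j\<in>{1..M}. max_group_size M G)"
    by (rule sum_mono) (auto simp: max_group_size_def intro!: Max_ge)
  finally show ?thesis using U by simp
qed

text \<open>The chain \<open>d log d = O(ln (N / k))\<close>, \<open>ln (N / k) \<le> ln N \<le> k\<close> eventually, bounds the \<open>N\<close> sorts by \<open>O(k N)\<close>.\<close>

lemma tree_asymptotics:
  fixes \<epsilon> \<rho> :: real and N k m d n t :: "nat \<Rightarrow> nat"
  assumes pos: "\<And>i. 1 \<le> N i" "\<And>i. 1 \<le> k i" "\<And>i. 1 \<le> n i" "\<And>i. 1 \<le> d i" and \<epsilon>: "0 < \<epsilon>"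
    and om: "(\<lambda>i. real (k i)) \<in> \<omega>(\<lambda>i. ln (real (N i)))"
    and \<rho>: "exp 1 < \<rho>" "\<And>i. \<rho> \<le> real (N i) / real (k i)"
    and dO: "(\<lambda>i. real (d i)) \<in> O(\<lambda>i. ln (real (N i) / real (k i)) / (\<epsilon> * ln (ln (real (N i) / real (k i)))))"
    and mO: "(\<lambda>i. real (m i)) \<in> O(\<lambda>i. real (d i) * real (k i) / \<epsilon>)"
    and t: "\<And>i. t i \<le> 20 * N i + n i * (400 * ((N i + 1) * sort_cost (d i) + m i) + 1000 * ((N i + 1) * (k i + 1)) + 20) + 30"
  shows "(\<lambda>i. real (t i)) \<in> O(\<lambda>i. real (k i) * real (n i) * real (N i))"
proof -
  obtain cd where cd: "0 < cd" "\<forall>\<^sub>F i in sequentially. norm (real (d i)) \<le>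
      cd * norm (ln (real (N i) / real (k i)) / (\<epsilon> * ln (ln (real (N i) / real (k i)))))"
    using dO by (elim landau_o.bigE)
  obtain cm where cm: "0 < cm" "\<forall>\<^sub>F i in sequentially. norm (real (m i)) \<le> cm * norm (real (d i) * real (k i) / \<epsilon>)"
    using mO by (elim landau_o.bigE)
  have kN: "\<forall>\<^sub>F i in sequentially. 1 * norm (ln (real (N i))) \<le> norm (real (k i))"
    using landau_omega.smallD[OF om, of 1] by simp
  have \<rho>0: "0 < \<rho>" using \<rho>(1) exp_gt_zero[of "1::real"] by linarith
  have "1 < ln \<rho>" using ln_less_cancel_iff[of "exp 1" \<rho>] \<rho>(1) \<rho>0 by simp
  define \<beta> where "\<beta> = ln (ln \<rho>)"
  have \<beta>: "0 < \<beta>" using \<open>1 < ln \<rho>\<close> by (simp add: \<beta>_def)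
  define K where "K = max 1 (cd / \<epsilon> / \<beta>)"
  define A where "A = 2 / ln 2 * (K * ln K + cd / \<epsilon>) + 4 * K"
  have "1 \<le> K" by (simp add: K_def)
  then have A: "0 \<le> A" using cd(1) \<epsilon> by (simp add: A_def)
  define B where "B = cm / \<epsilon>"
  have B: "0 \<le> B" using cm(1) \<epsilon> by (simp add: B_def)
  have "\<forall>\<^sub>F i in sequentially. norm (real (t i)) \<le> (400 * (2 + B) * A + 4000 + 70) * norm (real (k i) * real (n i) * real (N i))"
    using cd(2) cm(2) kN
  proof eventually_elim
    case (elim i)
    define l where "l = ln (real (N i) / real (k i))"
    have q: "0 < real (N i) / real (k i)" using pos[of i] by simp
    have "ln \<rho> \<le> l" unfolding l_def using \<rho>(2)[of i] \<rho>0 q by simp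
    then have l: "1 < l" "\<beta> \<le> ln l" using \<open>1 < ln \<rho>\<close> by (auto simp: \<beta>_def)
    have "real (N i) / real (k i) \<le> real (N i)" using pos[of i] by (simp add: divide_le_eq)
    then have "l \<le> ln (real (N i))" unfolding l_def using q by simp
    moreover have "ln (real (N i)) \<le> real (k i)" using elim(3) by simp
    ultimately have lk: "l \<le> real (k i)" by simp
    have "1 \<le> \<rho>" using \<rho>(1) exp_ge_add_one_self[of 1] by linarith
    then have "1 \<le> real (N i) / real (k i)" using \<rho>(2)[of i] by linarith
    then have kN': "k i \<le> N i" using pos(2)[of i] by (simp add: le_divide_eq)
    have "real (d i) \<le> cd / \<epsilon> * l / ln l"
      using elim(1) l \<epsilon> by (simp add: l_def[symmetric] abs_mult)
    then have "real (sort_cost (d i)) \<le> A * l"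
      unfolding sort_cost_def A_def K_def
      by (intro sort_cost_log) (use pos(4) cd(1) \<epsilon> l \<beta> in auto)
    also have "\<dots> \<le> A * real (k i)" using lk A by (intro mult_left_mono)
    finally have S: "real (sort_cost (d i)) \<le> A * real (k i)" .
    have "real (m i) \<le> B * (real (d i) * real (k i))" using elim(2) \<epsilon> by (simp add: B_def)
    also have "\<dots> \<le> B * (real (d i) * real (N i))" using B kN' by (intro mult_left_mono) auto
    finally have "real (400 * ((N i + 1) * sort_cost (d i) + m i)) \<le> 400 * (2 + B) * (real (N i) * real (sort_cost (d i)))"
      using pos(1) B by (intro median_cost_bound)
    also have "\<dots> \<le> 400 * (2 + B) * (real (N i) * (A * real (k i)))"
      using S B by (intro mult_left_mono) auto
    also have "\<dots> = 400 * (2 + B) * A * (real (k i) * real (N i))" by simp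
    finally have T1: "real (400 * ((N i + 1) * sort_cost (d i) + m i)) \<le> 400 * (2 + B) * A * (real (k i) * real (N i))" .
    have "real (N i + 1) * real (k i + 1) \<le> (2 * real (N i)) * (2 * real (k i))"
      using pos[of i] by (intro mult_mono) auto
    then have T2: "real (1000 * ((N i + 1) * (k i + 1))) \<le> 4000 * (real (k i) * real (N i))" by (simp add: algebra_simps)
    have "real (N i) \<le> real (k i) * real (N i)" using mult_right_mono[of 1 "real (k i)" "real (N i)"] pos(2)[of i] by simp
    then have "real (20 * N i + n i * ((400 * ((N i + 1) * sort_cost (d i) + m i) + 1000 * ((N i + 1) * (k i + 1))) + 20) + 30)
      \<le> (400 * (2 + B) * A + 4000 + 70) * (real (n i) * (real (k i) * real (N i)))"
      by (intro iteration_cost_bound) (use pos T1 T2 in \<open>simp_all add: distrib_right\<close>)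
    moreover have "real (t i) \<le> real (20 * N i + n i * ((400 * ((N i + 1) * sort_cost (d i) + m i) + 1000 * ((N i + 1) * (k i + 1))) + 20) + 30)"
      using t[of i] by (intro of_nat_mono) simp
    ultimately show ?case by (simp add: mult.commute mult.left_commute)
  qed
  then show ?thesis by (rule bigoI)
qed

text \<open>Since \<open>N \<ge> 2\<close>, the hypothesis on \<open>g\<close> makes it eventually larger than any constant, so that \<open>ln (k g) \<ge> 1\<close>. The number \<open>m\<close> of
measurements is dominated by \<open>d N\<close> because \<open>k g < N\<close>.\<close>

lemma group_asymptotics:
  fixes \<epsilon> :: real and N M k m d n g t :: "nat \<Rightarrow> nat"
  assumes pos: "\<And>i. 2 \<le> N i" "\<And>i. 1 \<le> k i" "\<And>i. 1 \<le> n i" "\<And>i. 1 \<le> d i" and \<epsilon>: "0 < \<epsilon>"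
    and NMg: "\<And>i. N i \<le> M i * g i" and kM: "\<And>i. k i \<le> M i" and kg: "\<And>i. k i * g i < N i"
    and om: "(\<lambda>i. real (g i)) \<in> \<omega>(\<lambda>i. ln (real (N i)))"
    and dO: "(\<lambda>i. real (d i)) \<in> O(\<lambda>i. ln (real (N i)) / (\<epsilon> * ln (real (k i) * real (g i))))"
    and mO: "(\<lambda>i. real (m i)) \<in> O(\<lambda>i. real (d i) * real (k i) * real (g i) / \<epsilon>)"
    and t: "\<And>i. t i \<le> 20 * N i + n i * (400 * ((N i + 1) * sort_cost (d i) + m i) +
       3000 * ((M i + 1) * (k i + 1) * (M i + k i + 1) + N i) + 20) + 30"
  shows "(\<lambda>i. real (t i)) \<in> O(\<lambda>i. real (M i) ^ 2 * real (k i) * real (n i) + real (n i) * real (N i))"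
proof -
  obtain cd where cd: "0 < cd" "\<forall>\<^sub>F i in sequentially. norm (real (d i)) \<le>
      cd * norm (ln (real (N i)) / (\<epsilon> * ln (real (k i) * real (g i))))"
    using dO by (elim landau_o.bigE)
  obtain cm where cm: "0 < cm" "\<forall>\<^sub>F i in sequentially. norm (real (m i)) \<le> cm * norm (real (d i) * real (k i) * real (g i) / \<epsilon>)"
    using mO by (elim landau_o.bigE)
  \<comment> \<open>the constant turns \<open>ln N \<ge> ln 2\<close> into \<open>g \<ge> exp 1\<close>\<close>
  have gl: "\<forall>\<^sub>F i in sequentially. exp 1 / ln 2 * norm (ln (real (N i))) \<le> norm (real (g i))"
    using landau_omega.smallD[OF om, of "exp 1 / ln 2"] by simp
  define C where "C = cd / \<epsilon>"
  define B where "B = cm / \<epsilon>"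
  have B: "0 \<le> B" and C: "0 \<le> C" using cm(1) cd(1) \<epsilon> by (simp_all add: B_def C_def)
  define c where "c = 400 * (2 + B) * (64 * C\<^sup>2) + 36000"
  have "\<forall>\<^sub>F i in sequentially. norm (real (t i)) \<le> (c + 70) * norm (real (M i) ^ 2 * real (k i) * real (n i) + real (n i) * real (N i))"
    using cd(2) cm(2) gl
  proof eventually_elim
    case (elim i)
    define Z where "Z = real (M i) ^ 2 * real (k i) + real (N i)"
    have N2: "2 \<le> real (N i)" using pos(1)[of i] by simp
    then have lnN: "ln 2 \<le> ln (real (N i))" by simp
    have "exp 1 / ln 2 * ln 2 \<le> exp 1 / ln 2 * ln (real (N i))" using lnN by (intro mult_left_mono) auto
    also have "\<dots> \<le> real (g i)" using elim(3) N2 by simp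
    finally have g: "exp 1 \<le> real (g i)" by simp
    have g1: "1 < real (g i)" using g exp_gt_one[of "1::real"] by linarith
    have k1: "1 \<le> real (k i)" using pos(2)[of i] by simp
    have "1 * real (g i) \<le> real (k i) * real (g i)" using k1 by (intro mult_right_mono) auto
    then have "1 < real (k i) * real (g i)" using g1 by linarith
    then have "0 < ln (real (k i) * real (g i))" by (rule ln_gt_zero)
    then have dC: "real (d i) \<le> C * ln (real (N i)) / ln (real (k i) * real (g i))"
    proof -
      have "0 \<le> ln (real (N i))" using N2 by simp
      then show ?thesis using elim(1) \<epsilon> \<open>0 < ln (real (k i) * real (g i))\<close> by (simp add: C_def abs_mult)
    qed
    have "(real (d i))\<^sup>2 * real (N i) \<le> 16 * C\<^sup>2 * ((real (M i))\<^sup>2 + real (N i))"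
      by (rule quadratic_degree_bound[OF N2 _ g k1 _ dC C]) (use NMg[of i] in \<open>simp_all flip: of_nat_mult\<close>)
    also have "\<dots> \<le> 16 * C\<^sup>2 * Z"
      unfolding Z_def using mult_left_mono[OF k1, of "(real (M i))\<^sup>2"] by (intro mult_left_mono) simp_all
    finally have dN: "(real (d i))\<^sup>2 * real (N i) \<le> 16 * C\<^sup>2 * Z" .
    have "real (sort_cost (d i)) \<le> 4 * (real (d i))\<^sup>2"
      using of_nat_mono[OF sort_cost_le_square[OF pos(4)[of i]], where 'a = real] by simp
    then have "real (N i) * real (sort_cost (d i)) \<le> real (N i) * (4 * (real (d i))\<^sup>2)" by (intro mult_left_mono) auto
    also have "\<dots> \<le> 64 * C\<^sup>2 * Z" using dN by (simp add: algebra_simps)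
    finally have S: "real (N i) * real (sort_cost (d i)) \<le> 64 * C\<^sup>2 * Z" .
    have "real (m i) \<le> B * (real (d i) * (real (k i) * real (g i)))" using elim(2) \<epsilon> by (simp add: B_def mult.assoc)
    also have "\<dots> \<le> B * (real (d i) * real (N i))"
      using B kg[of i] by (intro mult_left_mono) (auto simp flip: of_nat_mult)
    finally have "real (400 * ((N i + 1) * sort_cost (d i) + m i)) \<le> 400 * (2 + B) * (real (N i) * real (sort_cost (d i)))"
      using pos(1)[of i] B by (intro median_cost_bound) auto
    also have "\<dots> \<le> 400 * (2 + B) * (64 * C\<^sup>2 * Z)" using S B by (intro mult_left_mono) auto
    finally have T1: "real (400 * ((N i + 1) * sort_cost (d i) + m i)) \<le> 400 * (2 + B) * (64 * C\<^sup>2) * Z" by (simp add: mult.assoc)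
    have M1: "1 \<le> real (M i)" using kM[of i] pos(2)[of i] by simp
    have "(real (M i + 1) * real (k i + 1)) * real (M i + k i + 1) \<le> ((2 * real (M i)) * (2 * real (k i))) * (3 * real (M i))"
      using M1 k1 kM[of i] by (intro mult_mono) auto
    then have "real ((M i + 1) * (k i + 1) * (M i + k i + 1)) \<le> 12 * ((real (M i))\<^sup>2 * real (k i))"
      unfolding of_nat_mult by (simp add: power2_eq_square algebra_simps)
    then have T2: "real (3000 * ((M i + 1) * (k i + 1) * (M i + k i + 1) + N i)) \<le> 36000 * Z"
      by (simp add: Z_def)
    have "real (N i) \<le> Z" by (simp add: Z_def)
    moreover have "real (400 * ((N i + 1) * sort_cost (d i) + m i) + 3000 * ((M i + 1) * (k i + 1) * (M i + k i + 1) + N i)) \<le> c * Z"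
      using T1 T2 unfolding of_nat_add[of "400 * _"] c_def distrib_right by linarith
    ultimately have "real (20 * N i + n i * ((400 * ((N i + 1) * sort_cost (d i) + m i) + 3000 * ((M i + 1) * (k i + 1) * (M i + k i + 1) + N i)) + 20) + 30)
      \<le> (c + 70) * (real (n i) * Z)"
      using pos(1)[of i] pos(3)[of i] by (intro iteration_cost_bound) auto
    moreover have "real (t i) \<le> real (20 * N i + n i * ((400 * ((N i + 1) * sort_cost (d i) + m i) + 3000 * ((M i + 1) * (k i + 1) * (M i + k i + 1) + N i)) + 20) + 30)"
      using t[of i] by (intro of_nat_mono) simp
    moreover have "real (n i) * Z = norm (real (M i) ^ 2 * real (k i) * real (n i) + real (n i) * real (N i))"
      by (simp add: Z_def algebra_simps)
    ultimately show ?case by simp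
  qed
  then show ?thesis by (rule bigoI)
qed

theorem proposition3p2:
  shows "\<exists>med projT projG.
    computes_median_step med \<and> computes_tree_projection projT \<and> computes_group_projection projG \<and>
    (\<forall>(D :: nat) (\<epsilon> :: real) (\<rho> :: real)
        (N :: nat \<Rightarrow> nat) (k :: nat \<Rightarrow> nat) (m :: nat \<Rightarrow> nat) (d :: nat \<Rightarrow> nat) (n :: nat \<Rightarrow> nat)
        (r :: nat \<Rightarrow> nat) (par :: nat \<Rightarrow> nat \<Rightarrow> nat) (\<Gamma> :: nat \<Rightarrow> nat \<Rightarrow> nat set)
        (y :: nat \<Rightarrow> nat \<Rightarrow> real) (s :: nat \<Rightarrow> memory).
      2 \<le> D \<and> 0 < \<epsilon> \<and>
      (\<forall>i. tree_input D \<epsilon> (N i) (k i) (m i) (d i) (n i) (r i) (par i) (\<Gamma> i) (y i) (s i)) \<and>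
      (\<lambda>i. real (k i)) \<in> \<omega>(\<lambda>i. ln (real (N i))) \<and>
      exp 1 < \<rho> \<and> (\<forall>i. \<rho> \<le> real (N i) / real (k i)) \<and>
      (\<lambda>i. real (d i)) \<in>
        O(\<lambda>i. ln (real (N i) / real (k i)) / (\<epsilon> * ln (ln (real (N i) / real (k i))))) \<and>
      (\<lambda>i. real (m i)) \<in> O(\<lambda>i. real (d i) * real (k i) / \<epsilon>) \<longrightarrow>
      (\<exists>t :: nat \<Rightarrow> nat.
        (\<forall>i. runs_meiht med projT (N i) (tree_model (N i) (r i) (par i) (k i))
               (\<Gamma> i) (y i) (n i) (s i) (t i)) \<and>
        (\<lambda>i. real (t i)) \<in> O(\<lambda>i. real (k i) * real (n i) * real (N i)))) \<and>
    (\<forall>(\<epsilon> :: real)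
        (N :: nat \<Rightarrow> nat) (M :: nat \<Rightarrow> nat) (k :: nat \<Rightarrow> nat) (m :: nat \<Rightarrow> nat) (d :: nat \<Rightarrow> nat)
        (n :: nat \<Rightarrow> nat) (G :: nat \<Rightarrow> nat \<Rightarrow> nat set) (\<Gamma> :: nat \<Rightarrow> nat \<Rightarrow> nat set)
        (y :: nat \<Rightarrow> nat \<Rightarrow> real) (s :: nat \<Rightarrow> memory).
      0 < \<epsilon> \<and>
      (\<forall>i. group_input \<epsilon> (N i) (M i) (k i) (m i) (d i) (n i) (G i) (\<Gamma> i) (y i) (s i)) \<and>
      (\<lambda>i. real (max_group_size (M i) (G i))) \<in> \<omega>(\<lambda>i. ln (real (N i))) \<and>
      (\<lambda>i. real (d i)) \<in>
        O(\<lambda>i. ln (real (N i)) / (\<epsilon> * ln (real (k i) * real (max_group_size (M i) (G i))))) \<and>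
      (\<lambda>i. real (m i)) \<in>
        O(\<lambda>i. real (d i) * real (k i) * real (max_group_size (M i) (G i)) / \<epsilon>) \<longrightarrow>
      (\<exists>t :: nat \<Rightarrow> nat.
        (\<forall>i. runs_meiht med projG (N i) (group_model (M i) (G i) (k i))
               (\<Gamma> i) (y i) (n i) (s i) (t i)) \<and>
        (\<lambda>i. real (t i)) \<in>
          O(\<lambda>i. real (M i) ^ 2 * real (k i) * real (n i) + real (n i) * real (N i))))"
proof (rule exI[of _ med_prog], rule exI[of _ tree_prog], rule exI[of _ group_prog], intro conjI allI impI)
  show "computes_median_step med_prog"
    unfolding computes_median_step_def
  proof (intro allI impI)
    fix N m d \<Gamma> x y and s :: memory
    assume a: "left_regular N m d \<Gamma> \<and> holds_matrix s N m d \<Gamma> \<and> holds_vector s ''y'' m y \<and> holds_vector s ''x'' N x"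
    then have "d \<le> 2 ^ nat \<lceil>log 2 (real d)\<rceil>" by (intro le_two_power_log) (simp add: left_regular_def)
    from med_prog[OF _ _ _ _ this order_refl] a
    show "\<exists>t s'. exec med_prog s t s' \<and> holds_vector s' ''b'' N (median_step N \<Gamma> y x)" unfolding wp_def by blast
  qed
  show "computes_tree_projection tree_prog"
    unfolding computes_tree_projection_def
  proof (intro allI impI)
    fix D N r par k b and s :: memory
    assume "2 \<le> D \<and> dary_tree D N r par \<and> 1 \<le> k \<and> holds_tree s N r par k \<and> holds_vector s ''b'' N b"
    with tree_prog[OF _ _ _ _ order_refl]
    show "\<exists>t s' z. exec tree_prog s t s' \<and> holds_vector s' ''x'' N z \<and> model_projection N (tree_model N r par k) b z"
      unfolding wp_def by blast
  qed
  show "computes_group_projection group_prog"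
    unfolding computes_group_projection_def
  proof (intro allI impI)
    fix N M G k b and s :: memory
    assume "2 \<le> M \<and> group_structure N M G \<and> 1 \<le> k \<and> holds_groups s N M G k \<and> holds_vector s ''b'' N b"
    with group_prog[OF _ _ _ _ order_refl]
    show "\<exists>t s' z. exec group_prog s t s' \<and> holds_vector s' ''x'' N z \<and> model_projection N (group_model M G k) b z"
      unfolding wp_def by blast
  qed
next
  fix D :: nat and \<epsilon> \<rho> :: real and N k m d n r :: "nat \<Rightarrow> nat" and par \<Gamma> y and s :: "nat \<Rightarrow> memory"
  assume a: "2 \<le> D \<and> 0 < \<epsilon> \<and>
      (\<forall>i. tree_input D \<epsilon> (N i) (k i) (m i) (d i) (n i) (r i) (par i) (\<Gamma> i) (y i) (s i)) \<and>
      (\<lambda>i. real (k i)) \<in> \<omega>(\<lambda>i. ln (real (N i))) \<and>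
      exp 1 < \<rho> \<and> (\<forall>i. \<rho> \<le> real (N i) / real (k i)) \<and>
      (\<lambda>i. real (d i)) \<in>
        O(\<lambda>i. ln (real (N i) / real (k i)) / (\<epsilon> * ln (ln (real (N i) / real (k i))))) \<and>
      (\<lambda>i. real (m i)) \<in> O(\<lambda>i. real (d i) * real (k i) / \<epsilon>)"
  then have inp: "tree_input D \<epsilon> (N i) (k i) (m i) (d i) (n i) (r i) (par i) (\<Gamma> i) (y i) (s i)" for i by blast
  have "\<exists>t \<le> 20 * N i + n i * (400 * ((N i + 1) * sort_cost (d i) + m i) + 1000 * ((N i + 1) * (k i + 1)) + 20) + 30.
    runs_meiht med_prog tree_prog (N i) (tree_model (N i) (r i) (par i) (k i)) (\<Gamma> i) (y i) (n i) (s i) t" for i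
    by (rule tree_runtime[OF inp])
  then obtain t where t: "\<And>i. t i \<le> 20 * N i + n i * (400 * ((N i + 1) * sort_cost (d i) + m i) + 1000 * ((N i + 1) * (k i + 1)) + 20) + 30"
    "\<And>i. runs_meiht med_prog tree_prog (N i) (tree_model (N i) (r i) (par i) (k i)) (\<Gamma> i) (y i) (n i) (s i) (t i)"
    by metis
  have pos: "1 \<le> N i" "1 \<le> k i" "1 \<le> n i" "1 \<le> d i" for i
    using inp[of i] by (auto simp: tree_input_def dary_tree_def model_expander_def left_regular_def)
  have "(\<lambda>i. real (t i)) \<in> O(\<lambda>i. real (k i) * real (n i) * real (N i))"
    by (rule tree_asymptotics[of N k n d \<epsilon> \<rho> m t]) (use a pos t(1) in auto)
  with t(2) show "\<exists>t. (\<forall>i. runs_meiht med_prog tree_prog (N i) (tree_model (N i) (r i) (par i) (k i)) (\<Gamma> i) (y i) (n i) (s i) (t i)) \<and>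
        (\<lambda>i. real (t i)) \<in> O(\<lambda>i. real (k i) * real (n i) * real (N i))" by blast
next
  fix \<epsilon> :: real and N M k m d n :: "nat \<Rightarrow> nat" and G \<Gamma> y and s :: "nat \<Rightarrow> memory"
  assume a: "0 < \<epsilon> \<and>
      (\<forall>i. group_input \<epsilon> (N i) (M i) (k i) (m i) (d i) (n i) (G i) (\<Gamma> i) (y i) (s i)) \<and>
      (\<lambda>i. real (max_group_size (M i) (G i))) \<in> \<omega>(\<lambda>i. ln (real (N i))) \<and>
      (\<lambda>i. real (d i)) \<in>
        O(\<lambda>i. ln (real (N i)) / (\<epsilon> * ln (real (k i) * real (max_group_size (M i) (G i))))) \<and>
      (\<lambda>i. real (m i)) \<in>
        O(\<lambda>i. real (d i) * real (k i) * real (max_group_size (M i) (G i)) / \<epsilon>)"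
  then have inp: "group_input \<epsilon> (N i) (M i) (k i) (m i) (d i) (n i) (G i) (\<Gamma> i) (y i) (s i)" for i by blast
  obtain t where t: "\<And>i. t i \<le> 20 * N i + n i * (400 * ((N i + 1) * sort_cost (d i) + m i) +
       3000 * ((M i + 1) * (k i + 1) * (M i + k i + 1) + N i) + 20) + 30"
    "\<And>i. runs_meiht med_prog group_prog (N i) (group_model (M i) (G i) (k i)) (\<Gamma> i) (y i) (n i) (s i) (t i)"
    using group_runtime[OF inp] by metis
  have pos: "1 \<le> k i" "1 \<le> n i" "1 \<le> d i" "k i * max_group_size (M i) (G i) < N i" for i
    using inp[of i] by (auto simp: group_input_def model_expander_def left_regular_def)
  have NMg: "N i \<le> M i * max_group_size (M i) (G i)" for i
    using group_cover_bound[of "N i" "M i" "G i"] inp[of i] by (simp add: group_input_def)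
  have "k i * max_group_size (M i) (G i) < M i * max_group_size (M i) (G i)" for i
    using pos(4)[of i] NMg[of i] by linarith
  then have kM: "k i < M i" and g0: "0 < max_group_size (M i) (G i)" for i by simp_all
  have N2: "2 \<le> N i" for i
  proof -
    have "0 < k i * max_group_size (M i) (G i)" using pos(1)[of i] g0[of i] by simp
    with pos(4)[of i] show ?thesis by linarith
  qed
  have "(\<lambda>i. real (t i)) \<in> O(\<lambda>i. real (M i) ^ 2 * real (k i) * real (n i) + real (n i) * real (N i))"
    by (rule group_asymptotics[of N k n d \<epsilon> M "\<lambda>i. max_group_size (M i) (G i)" m t])
      (use a pos t(1) NMg N2 kM in \<open>auto intro: less_imp_le\<close>)
  with t(2) show "\<exists>t. (\<forall>i. runs_meiht med_prog group_prog (N i) (group_model (M i) (G i) (k i)) (\<Gamma> i) (y i) (n i) (s i) (t i)) \<and>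
        (\<lambda>i. real (t i)) \<in> O(\<lambda>i. real (M i) ^ 2 * real (k i) * real (n i) + real (n i) * real (N i))" by blast
qed

end
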